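(* Let $\alpha\ge0$. For all $t\in\mathbb R$, $$\left\|e^{-itH_\alpha}\right\|_{\ell^1\to\ell^\infty}\le\frac1{\sqrt{1+t^2}},$$ and for $\alpha=0$ equality holds. More generally, if $1\le p\le2$ and $p'=p/(p-1)$ (with $p'=\infty$ for $p=1$), then for all $t\in\mathbb R$, $$\left\|e^{-itH_\alpha}\right\|_{\ell^p\to\ell^{p'}}\le(1+t^2)^{-(1/p-1/2)}.$$
   Context: For $\alpha>-1$, the discrete Laguerre operator $H_\alpha$ is the self-adjoint Jacobi operator on $\ell^2(\mathbb N_0)$ (with its maximal domain) associated with $$(H_\alpha u)_n=\sqrt{n(n+\alpha)}\,u_{n-1}+(2n+1+\alpha)u_n+\sqrt{(n+1)(n+1+\alpha)}\,u_{n+1},\quad u_{-1}=0.$$ $e^{-itH_\alpha}$ is the associated unitary group on $\ell^2(\mathbb N_0)$; $\|\cdot\|_{\ell^p\to\ell^{p'}}$ is the operator norm from $\ell^p(\mathbb N_0)$ (which is contained in $\ell^2(\mathbb N_0)$ for $1\le p\le 2$) to $\ell^{p'}(\mathbb N_0)$. *)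

theory Defs
  imports "HOL-Analysis.Analysis"
begin

text \<open>
  The \<open>\<ell>\<^sup>p\<close> norm of an arbitrary complex sequence for an extended exponent \<open>1 \<le> p \<le> \<infinity>\<close>; it takes
  the value \<open>\<infinity>\<close> exactly on sequences outside \<open>\<ell>\<^sup>p\<close>.
\<close>

definition lp_norm :: "ennreal \<Rightarrow> (nat \<Rightarrow> complex) \<Rightarrow> ennreal" where
  "lp_norm p u =
    (if p = \<infinity> then (SUP n. ennreal (cmod (u n)))
     else if summable (\<lambda>n. cmod (u n) powr enn2real p)
       then ennreal ((\<Sum>n. cmod (u n) powr enn2real p) powr (1 / enn2real p))
     else \<infinity>)"

definition lp_space :: "ennreal \<Rightarrow> (nat \<Rightarrow> complex) set" where
  "lp_space p = {u. lp_norm p u < \<infinity>}"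

definition lp_opnorm ::
    "ennreal \<Rightarrow> ennreal \<Rightarrow> ((nat \<Rightarrow> complex) \<Rightarrow> nat \<Rightarrow> complex) \<Rightarrow> ennreal" where
  "lp_opnorm p q A = (SUP u \<in> {u \<in> lp_space p. lp_norm p u \<le> 1}. lp_norm q (A u))"

definition conj_exponent :: "real \<Rightarrow> ennreal" where
  "conj_exponent p = (if p = 1 then \<infinity> else ennreal (p / (p - 1)))"

text \<open>
  Operators on \<open>\<ell>\<^sup>2\<close> are functions on all sequences; only their values on \<open>\<ell>\<^sup>2\<close> (or on the stated
  domain) are constrained.
\<close>

definition unitary_l2 :: "((nat \<Rightarrow> complex) \<Rightarrow> nat \<Rightarrow> complex) \<Rightarrow> bool" where
  "unitary_l2 A \<longleftrightarrow>
    (\<forall>u \<in> lp_space 2. \<forall>v \<in> lp_space 2. \<forall>a b :: complex.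
       A (\<lambda>n. a * u n + b * v n) = (\<lambda>n. a * A u n + b * A v n)) \<and>
    bij_betw A (lp_space 2) (lp_space 2) \<and>
    (\<forall>u \<in> lp_space 2. lp_norm 2 (A u) = lp_norm 2 u)"

definition unitary_group :: "(real \<Rightarrow> (nat \<Rightarrow> complex) \<Rightarrow> nat \<Rightarrow> complex) \<Rightarrow> bool" where
  "unitary_group U \<longleftrightarrow>
    (\<forall>t. unitary_l2 (U t)) \<and>
    (\<forall>u \<in> lp_space 2. U 0 u = u) \<and>
    (\<forall>u \<in> lp_space 2. \<forall>s t. U (s + t) u = U s (U t u)) \<and>
    (\<forall>u \<in> lp_space 2. ((\<lambda>t. lp_norm 2 (\<lambda>n. U t u n - u n)) \<longlongrightarrow> 0) (at 0))"

text \<open>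
  \<open>U t = e\<^sup>-\<^sup>i\<^sup>t\<^sup>H\<close> for the operator \<open>H\<close> with domain \<open>D\<close>: by Stone's theorem, for self-adjoint \<open>H\<close>
  this is the unique strongly continuous unitary group whose infinitesimal generator is
  \<open>-\<i>H\<close>.  The equivalence fixes the domain of the generator to be exactly \<open>D\<close>.
\<close>

definition unitary_group_of ::
    "(nat \<Rightarrow> complex) set \<Rightarrow> ((nat \<Rightarrow> complex) \<Rightarrow> nat \<Rightarrow> complex) \<Rightarrow>
     (real \<Rightarrow> (nat \<Rightarrow> complex) \<Rightarrow> nat \<Rightarrow> complex) \<Rightarrow> bool" where
  "unitary_group_of D H U \<longleftrightarrow>
    unitary_group U \<and>
    (\<forall>u \<in> lp_space 2. \<forall>v \<in> lp_space 2.
       ((\<lambda>t. lp_norm 2 (\<lambda>n. (U t u n - u n) / complex_of_real t - v n)) \<longlongrightarrow> 0) (at 0) \<longleftrightarrow>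
       u \<in> D \<and> v = (\<lambda>n. - \<i> * H u n))"

definition laguerre_op :: "real \<Rightarrow> (nat \<Rightarrow> complex) \<Rightarrow> nat \<Rightarrow> complex" where
  "laguerre_op \<alpha> u n =
    complex_of_real (sqrt (real n * (real n + \<alpha>))) * (if n = 0 then 0 else u (n - 1)) +
    complex_of_real (2 * real n + 1 + \<alpha>) * u n +
    complex_of_real (sqrt ((real n + 1) * (real n + 1 + \<alpha>))) * u (n + 1)"

definition laguerre_dom :: "real \<Rightarrow> (nat \<Rightarrow> complex) set" where
  "laguerre_dom \<alpha> = {u \<in> lp_space 2. laguerre_op \<alpha> u \<in> lp_space 2}"

end

theory Submission
  imports Defs "HOL-Complex_Analysis.Complex_Analysis"
begin

text \<open>
  The matrix of \<open>e\<^bsup>-itH\<^esup>\<close> is an explicit Meixner-type sum. With \<open>s = 1/(1 + t\<^sup>2)\<close> and \<open>k = |n - m|\<close>, its entries have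
  modulus \<open>s\<^bsup>1/2\<^esup>\<close> times that of a normalised Jacobi function
  \<open>g(s) = c \<cdot> s\<^bsup>\<alpha>/2\<^esup> (1 - s)\<^bsup>k/2\<^esup> P(s)\<close>, and the \<open>\<ell>\<^sup>1 \<rightarrow> \<ell>\<^sup>\<infinity>\<close> bound amounts to \<open>|g| \<le> 1\<close>. At the critical point
  closest to \<open>0\<close> this follows from \<open>(g\<^sup>2)' \<le> \<alpha> g\<^sup>2/s\<close> and \<open>\<integral>\<^sub>0\<^sup>1 \<alpha> g\<^sup>2/s ds = 1\<close>, similarly near \<open>1\<close>, and Sonin's
  monotonicity argument shows that the critical values in between are smaller (this is for real \<open>\<alpha>, k > 0\<close>; the boundary
  cases follow by continuity). For \<open>\<alpha> = 0\<close> the entry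
  \<open>(0, 0)\<close> is \<open>1/(1 + it)\<close>. Riesz--Thorin interpolation with the unitarity on \<open>\<ell>\<^sup>2\<close> gives the remaining exponents.
\<close>

subsection \<open>Jacobi polynomials\<close>

text \<open>The constant has to be exactly 1, so estimates of Jacobi functions up to a constant are
  of no use and an exact quantity must be found to compare with. It is the integral of a s^(a-1)
  (1-s)^b P^2, whose weight has one power of s less than the orthogonality weight. This lower power
  is the one produced by the logarithmic derivative a/s of s^a, and the value of the integral is the
  inverse of the product of the squared normalising weights of the kernel. As a tends to 0 the
  measure a s^(a-1) ds concentrates at s = 0, which is why a = 0 is reached only as a limit.

  The second obstacle is that the group is given only through its generator on the maximal domain.
  No spectral representation is built: the explicit kernel is shown to solve the evolution equation
  entrywise, and pairing its columns with those of the group identifies the two. This needs only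
  decay of the kernel columns, not a proof that the kernel is unitary.\<close>

lemma sum_alternating_choose_Suc:
  fixes f :: "nat \<Rightarrow> real"
  shows "(\<Sum>j\<le>Suc n. (-1) ^ j * real (Suc n choose j) * f j) =
         (\<Sum>j\<le>n. (-1) ^ j * real (n choose j) * f j) - (\<Sum>j\<le>n. (-1) ^ j * real (n choose j) * f (Suc j))"
proof -
  have "(\<Sum>j\<le>Suc n. (-1) ^ j * real (Suc n choose j) * f j) =
        f 0 + (\<Sum>j\<le>n. (-1) ^ Suc j * real (Suc n choose Suc j) * f (Suc j))"
    by (subst sum.atMost_Suc_shift) simp
  also have "\<dots> = f 0 + (\<Sum>j\<le>n. (-1) ^ Suc j * real (n choose Suc j) * f (Suc j))
                - (\<Sum>j\<le>n. (-1) ^ j * real (n choose j) * f (Suc j))"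
    by (simp add: algebra_simps sum.distrib sum_subtractf sum_negf)
  also have "f 0 + (\<Sum>j\<le>n. (-1) ^ Suc j * real (n choose Suc j) * f (Suc j)) =
             (\<Sum>j\<le>Suc n. (-1) ^ j * real (n choose j) * f j)"
    by (simp only: sum.atMost_Suc_shift) simp
  also have "\<dots> = (\<Sum>j\<le>n. (-1) ^ j * real (n choose j) * f j)"
    by simp
  finally show ?thesis .
qed

text \<open>The sum is an n-fold finite difference, and each difference lowers the degree of a
  Pochhammer symbol by one, so degree d < n is annihilated.\<close>

lemma sum_alternating_choose_pochhammer:
  fixes x :: real
  assumes "d < n"
  shows "(\<Sum>j\<le>n. (-1) ^ j * real (n choose j) * pochhammer (x + real j) d) = 0"
  using assms
proof (induction n arbitrary: x d)
  case (Suc n)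
  have diff: "pochhammer y d - pochhammer (y + 1) d = - real d * pochhammer (y + 1) (d - 1)" for y :: real
  proof (cases d)
    case (Suc e)
    have "pochhammer (y + 1) (Suc e) = pochhammer (y + 1) e * (y + 1 + real e)"
      by (simp add: pochhammer_Suc)
    moreover have "pochhammer y (Suc e) = y * pochhammer (y + 1) e"
      by (simp add: pochhammer_rec)
    ultimately show ?thesis
      by (simp add: Suc algebra_simps)
  qed simp
  have "(\<Sum>j\<le>Suc n. (-1) ^ j * real (Suc n choose j) * pochhammer (x + real j) d) =
        (\<Sum>j\<le>n. (-1) ^ j * real (n choose j) * (pochhammer (x + real j) d - pochhammer (x + real j + 1) d))"
    unfolding sum_alternating_choose_Suc
    by (simp add: algebra_simps sum_subtractf)
  also have "\<dots> = - real d * (\<Sum>j\<le>n. (-1) ^ j * real (n choose j) * pochhammer ((x + 1) + real j) (d - 1))"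
    unfolding diff sum_distrib_left by (intro sum.cong) (auto simp: algebra_simps)
  also have "\<dots> = 0"
  proof (cases "d = 0")
    case False
    then have "d - 1 < n" using Suc.prems by simp
    from Suc.IH[OF this] show ?thesis by simp
  qed simp
  finally show ?case .
qed simp

text \<open>This is the partial fraction expansion of n! / (a (a+1) ... (a+n)), or equivalently the
  n-fold difference of 1/x.\<close>

lemma sum_alternating_choose_inverse:
  fixes a :: real
  assumes "a > 0"
  shows "(\<Sum>j\<le>n. (-1) ^ j * real (n choose j) * (1 / (a + real j))) = fact n / pochhammer a (Suc n)"
  using assms
proof (induction n arbitrary: a)
  case (Suc n)
  have pos: "pochhammer (a + 1) n > 0" by (rule pochhammer_pos) (use Suc.prems in simp)
  have p1: "pochhammer a (Suc n) = a * pochhammer (a + 1) n"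
    by (simp add: pochhammer_rec)
  have p2: "pochhammer (a + 1) (Suc n) = pochhammer (a + 1) n * (a + 1 + real n)"
    by (simp add: pochhammer_Suc)
  have p3: "pochhammer a (Suc (Suc n)) = a * (pochhammer (a + 1) n * (a + 1 + real n))"
    by (simp only: pochhammer_rec[of a] p2)
  have "(\<Sum>j\<le>Suc n. (-1) ^ j * real (Suc n choose j) * (1 / (a + real j))) =
        fact n / pochhammer a (Suc n) - fact n / pochhammer (a + 1) (Suc n)"
    unfolding sum_alternating_choose_Suc Suc.IH[OF Suc.prems, symmetric]
    using Suc.IH[of "a + 1"] Suc.prems by (simp add: add_ac)
  also have "\<dots> = fact (Suc n) / pochhammer a (Suc (Suc n))"
  proof -
    have "fact n / (a * p) - fact n / (p * c) = fact (Suc n) / (a * (p * c))"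
      if "p > 0" "c > 0" "c = a + 1 + real n" for p c
      using that(1,2) Suc.prems by (simp add: divide_simps) (simp add: that(3) algebra_simps)
    then show ?thesis
      unfolding p1 p2 p3 using pos Suc.prems by simp
  qed
  finally show ?case .
qed simp

text \<open>With generalised binomials this is binom(n+a, n-j) binom(n+b, j) / binom(n+a, n), the
  classical coefficient of the Jacobi polynomial divided by its value at s = 0.\<close>

definition jacobi_coeff :: "nat \<Rightarrow> real \<Rightarrow> real \<Rightarrow> nat \<Rightarrow> real" where
  "jacobi_coeff n a b j = 
   real (n choose j) * pochhammer (1 + b) n / (pochhammer (1 + b) (n - j) * pochhammer (1 + a) j)"

text \<open>
  \<open>jacobi_poly n a b\<close> is the Jacobi polynomial on \<open>[0, 1]\<close> with weight \<open>s\<^sup>a (1 - s)\<^sup>b\<close>, normalised to be \<open>1\<close>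
  at \<open>s = 0\<close> and expanded in the basis \<open>s\<^sup>j (1 - s)\<^bsup>n - j\<^esup>\<close>, in which it occurs in the Laguerre kernel and
  in which the symmetry \<open>s \<leftrightarrow> 1 - s\<close>, \<open>a \<leftrightarrow> b\<close> is manifest.
\<close>

definition jacobi_basis :: "nat \<Rightarrow> nat \<Rightarrow> real poly" where
  "jacobi_basis n j = monom 1 j * [:1, -1:] ^ (n - j)"

definition jacobi_poly :: "nat \<Rightarrow> real \<Rightarrow> real \<Rightarrow> real poly" where
  "jacobi_poly n a b = (\<Sum>j\<le>n. smult ((-1) ^ j * jacobi_coeff n a b j) (jacobi_basis n j))"

lemma poly_jacobi_basis: "poly (jacobi_basis n j) s = s ^ j * (1 - s) ^ (n - j)"
  by (simp add: jacobi_basis_def poly_monom)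

lemma poly_jacobi_poly:
  "poly (jacobi_poly n a b) s = (\<Sum>j\<le>n. (-1) ^ j * jacobi_coeff n a b j * (s ^ j * (1 - s) ^ (n - j)))"
  by (simp add: jacobi_poly_def poly_sum poly_jacobi_basis)

lemma degree_jacobi_poly: "degree (jacobi_poly n a b) \<le> n"
  unfolding jacobi_poly_def
proof (intro degree_sum_le)
  fix j assume "j \<in> {..n}"
  have "degree (jacobi_basis n j) \<le> degree (monom (1::real) j) + degree ([:1, -1:] ^ (n - j) :: real poly)"
    unfolding jacobi_basis_def by (rule degree_mult_le)
  also have "\<dots> \<le> j + (n - j)"
    by (simp add: degree_monom_eq degree_linear_power)
  finally show "degree (smult ((-1) ^ j * jacobi_coeff n a b j) (jacobi_basis n j)) \<le> n"
    using \<open>j \<in> {..n}\<close> by (intro order_trans[OF degree_smult_le]) simp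
qed auto

lemma poly_jacobi_poly_0:
  assumes "b > -1"
  shows "poly (jacobi_poly n a b) 0 = 1"
proof -
  have "pochhammer (1 + b) n > 0" by (rule pochhammer_pos) (use assms in simp)
  moreover have "poly (jacobi_poly n a b) 0 = (\<Sum>j\<in>{0}. (-1) ^ j * jacobi_coeff n a b j * (0 ^ j * (1 - 0) ^ (n - j)))"
    unfolding poly_jacobi_poly by (rule sum.mono_neutral_right) auto
  ultimately show ?thesis by (simp add: jacobi_coeff_def)
qed

text \<open>This two-term recurrence is what makes the differential equation telescope. For j = n
  both sides vanish.\<close>

lemma jacobi_coeff_Suc:
  assumes "a > -1" "b > -1" "j \<le> n"
  shows "jacobi_coeff n a b (Suc j) * (real (Suc j) * (real (Suc j) + a)) =
         jacobi_coeff n a b j * (real (n - j) * (real (n - j) + b))"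
proof (cases "j = n")
  case False
  then obtain i where n: "n - j = Suc i" "n - Suc j = i" using assms
    by (metis Suc_diff_Suc le_neq_implies_less)
  have pos: "pochhammer (1 + a) j > 0" "pochhammer (1 + b) i > 0"
    by (rule pochhammer_pos; use assms in simp)+
  have "real (Suc j) * real (n choose Suc j) = real (n - j) * real (n choose j)"
    by (metis binomial_absorb_comp binomial_absorption of_nat_mult)
  then have *: "real (Suc j) * real (n choose Suc j) = real (Suc i) * real (n choose j)" by (simp add: n)
  have eq: "x * y / (q * (p * c)) * (t * c) = z * y / ((q * d) * p) * (u * d)"
    if "p > 0" "c > 0" "q > 0" "d > 0" "t * x = u * z" for x y z p q c d t u :: real
    using that by (simp add: divide_simps) algebra
  have "jacobi_coeff n a b (Suc j) * (real (Suc j) * (real (Suc j) + a)) =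
     real (n choose Suc j) * pochhammer (1 + b) n /
       (pochhammer (1 + b) i * (pochhammer (1 + a) j * (1 + a + real j))) * (real (Suc j) * (1 + a + real j))"
    unfolding jacobi_coeff_def pochhammer_Suc n by (simp add: add_ac)
  also have "\<dots> = real (n choose j) * pochhammer (1 + b) n /
       ((pochhammer (1 + b) i * (1 + b + real i)) * pochhammer (1 + a) j) * (real (Suc i) * (1 + b + real i))"
    by (rule eq) (use pos assms * in auto)
  also have "\<dots> = jacobi_coeff n a b j * (real (n - j) * (real (n - j) + b))"
    unfolding jacobi_coeff_def pochhammer_Suc n by (simp add: add_ac)
  finally show ?thesis .
qed (simp add: jacobi_coeff_def)

lemma jacobi_coeff_mirror:
  assumes "a > -1" "b > -1" "j \<le> n"
  shows "jacobi_coeff n a b (n - j) = jacobi_coeff n a b n * jacobi_coeff n b a j"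
proof -
  have "pochhammer (1 + a) n > 0" by (rule pochhammer_pos) (use assms in simp)
  then show ?thesis
    using assms by (simp add: jacobi_coeff_def binomial_symmetric[symmetric] mult_ac)
qed

text \<open>Reflection reverses the basis s^j (1-s)^(n-j) and swaps the parameters. The constant in
  front is the value of the polynomial at s = 1.\<close>

lemma poly_jacobi_poly_mirror:
  assumes "a > -1" "b > -1"
  shows "poly (jacobi_poly n a b) (1 - s) = (-1) ^ n * jacobi_coeff n a b n * poly (jacobi_poly n b a) s"
proof -
  have "poly (jacobi_poly n a b) (1 - s) =
    (\<Sum>j\<le>n. (-1) ^ (n - j) * jacobi_coeff n a b (n - j) * ((1 - s) ^ (n - j) * s ^ (n - (n - j))))"
    unfolding poly_jacobi_poly
    by (rule sum.reindex_bij_witness[of _ "\<lambda>j. n - j" "\<lambda>j. n - j"]) auto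
  also have "\<dots> = (\<Sum>j\<le>n. (-1) ^ n * jacobi_coeff n a b n * ((-1) ^ j * jacobi_coeff n b a j * (s ^ j * (1 - s) ^ (n - j))))"
  proof (intro sum.cong refl)
    fix j assume "j \<in> {..n}"
    then have "jacobi_coeff n a b (n - j) = jacobi_coeff n a b n * jacobi_coeff n b a j"
      using assms by (intro jacobi_coeff_mirror) auto
    moreover have "(-1 :: real) ^ (n - j) = (-1) ^ n * (-1) ^ j"
      using \<open>j \<in> {..n}\<close> by (simp add: uminus_power_if)
    ultimately show "(-1) ^ (n - j) * jacobi_coeff n a b (n - j) * ((1 - s) ^ (n - j) * s ^ (n - (n - j))) =
      (-1) ^ n * jacobi_coeff n a b n * ((-1) ^ j * jacobi_coeff n b a j * (s ^ j * (1 - s) ^ (n - j)))"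
      using \<open>j \<in> {..n}\<close> by (simp add: mult_ac)
  qed
  also have "\<dots> = (-1) ^ n * jacobi_coeff n a b n * poly (jacobi_poly n b a) s"
    unfolding poly_jacobi_poly sum_distrib_left ..
  finally show ?thesis .
qed

text \<open>
  The differential equation is stated with \<open>\<theta> = s (1 - s) d/ds\<close>, which acts on the basis by
  multiplication with linear polynomials.
\<close>

definition euler_poly :: "real poly \<Rightarrow> real poly" where
  "euler_poly p = [:0, 1, -1:] * pderiv p"

lemma euler_poly_smult: "euler_poly (smult c p) = smult c (euler_poly p)"
  by (simp add: euler_poly_def pderiv_smult)

lemma euler_poly_sum: "euler_poly (\<Sum>j\<in>A. f j) = (\<Sum>j\<in>A. euler_poly (f j))"
  by (induction A rule: infinite_finite_induct)
     (simp_all add: euler_poly_def pderiv_add distrib_left)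

lemma poly_euler_poly: "poly (euler_poly p) s = s * (1 - s) * poly (pderiv p) s"
  by (simp add: euler_poly_def algebra_simps)

lemma poly_euler_jacobi_basis:
  "poly (euler_poly (jacobi_basis n j)) s =
     (real j * (1 - s) - real (n - j) * s) * poly (jacobi_basis n j) s"
proof -
  define k where "k = n - j"
  have 1: "s * (real j * s ^ (j - 1)) = real j * s ^ j"
    by (cases j) auto
  have 2: "(1 - s) * (real k * (1 - s) ^ (k - 1)) = real k * (1 - s) ^ k"
    by (cases k) auto
  have "poly (euler_poly (jacobi_basis n j)) s =
     (s * (real j * s ^ (j - 1))) * ((1 - s) * (1 - s) ^ k)
      - (s * s ^ j) * ((1 - s) * (real k * (1 - s) ^ (k - 1)))"
    by (simp add: poly_euler_poly jacobi_basis_def pderiv_mult pderiv_monom pderiv_power poly_monom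
        pderiv_pCons k_def[symmetric] algebra_simps)
  also have "\<dots> = (real j * (1 - s) - real k * s) * poly (jacobi_basis n j) s"
    unfolding 1 2 by (simp add: poly_jacobi_basis k_def[symmetric] algebra_simps)
  finally show ?thesis by (simp add: k_def)
qed

lemma euler_jacobi_basis:
  assumes "j \<le> n"
  shows "euler_poly (jacobi_basis n j) = [:real j, - real n:] * jacobi_basis n j"
proof -
  have "poly (euler_poly (jacobi_basis n j)) = poly ([:real j, - real n:] * jacobi_basis n j)"
    using assms by (intro ext) (simp add: poly_euler_jacobi_basis of_nat_diff algebra_simps)
  then show ?thesis by (simp only: poly_eq_poly_eq_iff)
qed

lemma poly_euler_euler_jacobi_basis:
  assumes "j \<le> n"
  shows "poly (euler_poly (euler_poly (jacobi_basis n j))) s =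
    ((real j - real n * s)^2 - real n * (s * (1 - s))) * poly (jacobi_basis n j) s"
proof -
  have "poly (euler_poly ([:real j, - real n:] * p)) s =
      (real j - real n * s) * poly (euler_poly p) s - real n * (s * (1 - s)) * poly p s" for p
  proof -
    have "pderiv ([:real j, - real n:] * p) = [:real j, - real n:] * pderiv p + p * [:- real n:]"
      by (simp only: pderiv_mult) (simp add: pderiv_pCons)
    note * = this
    show ?thesis unfolding poly_euler_poly * by (simp add: algebra_simps)
  qed
  note ** = this
  show ?thesis
    unfolding euler_jacobi_basis[OF assms] **
    by (simp add: euler_jacobi_basis[OF assms] power2_eq_square algebra_simps)
qed

text \<open>On the basis element \<open>j\<close> the operator gives \<open>j (j + a) (1 - s) + (n - j) (n - j + b) s\<close>, and the sum telescopes.\<close>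

lemma jacobi_ode:
  assumes "a > -1" "b > -1"
  shows "poly (euler_poly (euler_poly (jacobi_poly n a b))) s
     + (a * (1 - s) - b * s) * poly (euler_poly (jacobi_poly n a b)) s
     + real n * (real n + a + b + 1) * (s * (1 - s)) * poly (jacobi_poly n a b) s = 0"
    (is "?L = 0")
proof -
  define c where "c j = (-1) ^ j * jacobi_coeff n a b j" for j
  \<comment> \<open>\<open>h j\<close> is the part of the j-th term with factor j (j+a) (1-s). By
    the coefficient recurrence and the sign (-1)^j the other part is
    \<open>- h (Suc j)\<close>.\<close>
  define h where "h j = c j * (real j * (real j + a)) * (s ^ j * (1 - s) ^ (Suc n - j))" for j
  have "?L = (\<Sum>j\<le>n. c j * (poly (euler_poly (euler_poly (jacobi_basis n j))) s
     + (a * (1 - s) - b * s) * poly (euler_poly (jacobi_basis n j)) s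
     + real n * (real n + a + b + 1) * (s * (1 - s)) * poly (jacobi_basis n j) s))"
    unfolding jacobi_poly_def euler_poly_sum euler_poly_smult poly_sum poly_smult sum_distrib_left
      sum.distrib[symmetric] c_def
    by (intro sum.cong refl) (simp add: algebra_simps)
  also have "\<dots> = (\<Sum>j\<le>n. h j - h (Suc j))"
  proof (intro sum.cong refl)
    fix j assume "j \<in> {..n}"
    then obtain k where k: "n = j + k" by (auto simp: le_iff_add)
    have "c (Suc j) * (real (Suc j) * (real (Suc j) + a)) = - c j * (real k * (real k + b))"
      using jacobi_coeff_Suc[OF assms, of j n] by (simp add: c_def k)
    then have h2: "h (Suc j) = - c j * (real k * (real k + b)) * (s ^ Suc j * (1 - s) ^ k)"
      by (simp add: h_def k)
    have h1: "h j = c j * (real j * (real j + a)) * (s ^ j * (1 - s) ^ Suc k)"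
      by (simp add: h_def k Suc_diff_le)
    have "(real j - real n * s)^2 - real n * (s * (1 - s)) + (a * (1 - s) - b * s) * (real j * (1 - s) - real k * s)
        + real n * (real n + a + b + 1) * (s * (1 - s)) = real j * (real j + a) * (1 - s) + real k * (real k + b) * s"
      by (simp add: k power2_eq_square algebra_simps)
    then have "poly (euler_poly (euler_poly (jacobi_basis n j))) s
     + (a * (1 - s) - b * s) * poly (euler_poly (jacobi_basis n j)) s
     + real n * (real n + a + b + 1) * (s * (1 - s)) * poly (jacobi_basis n j) s
     = (real j * (real j + a) * (1 - s) + real k * (real k + b) * s) * (s ^ j * (1 - s) ^ k)"
      unfolding poly_euler_euler_jacobi_basis[of j n s, unfolded k, OF le_add1, folded k] poly_euler_jacobi_basis poly_jacobi_basis
      by (simp only: k diff_add_inverse) (simp only: distrib_right[symmetric] mult.assoc[symmetric])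
    note * = this
    show "c j * (poly (euler_poly (euler_poly (jacobi_basis n j))) s
     + (a * (1 - s) - b * s) * poly (euler_poly (jacobi_basis n j)) s
     + real n * (real n + a + b + 1) * (s * (1 - s)) * poly (jacobi_basis n j) s) = h j - h (Suc j)"
      unfolding * h1 h2 by (simp add: algebra_simps)
  qed
  also have "\<dots> = h 0 - h (Suc n)"
    by (rule sum_telescope)
  \<comment> \<open>\<open>h 0\<close> vanishes through its factor j, and \<open>h (Suc n)\<close>
    through the binomial coefficient n over n+1.\<close>
  also have "\<dots> = 0"
    by (simp add: h_def c_def jacobi_coeff_def)
  finally show ?thesis .
qed

text \<open>The reciprocal of the integral in \<open>has_integral_jacobi_square\<close>. For a =
  \<alpha> and natural b it is the product of two squared kernel weights.\<close>

definition jacobi_norm :: "nat \<Rightarrow> real \<Rightarrow> real \<Rightarrow> real" where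
  "jacobi_norm n a b = Gamma (real n + a + b + 1) * Gamma (real n + a + 1) /
     (fact n * Gamma (real n + b + 1) * (Gamma (a + 1))\<^sup>2)"

text \<open>Each basis term gives a Beta integral. Its factor Gamma(b+n-j+1) cancels against the
  coefficient, and the Gamma function in its denominator does not depend on j, so what remains is an
  n-fold finite difference.\<close>

lemma has_integral_jacobi_moment:
  assumes "a > 0" "b > 0"
  shows "((\<lambda>s. s powr (a - 1) * (1 - s) powr b * poly (jacobi_poly n a b) s * s ^ i) has_integral
     Gamma (real n + b + 1) * Gamma (1 + a) / Gamma (a + b + real n + real i + 1) *
       (\<Sum>j\<le>n. (-1) ^ j * real (n choose j) * (Gamma (a + real i + real j) / Gamma (a + real j + 1)))) {0..1}"
proof -
  have "((\<lambda>s. \<Sum>j\<le>n. (-1) ^ j * jacobi_coeff n a b j * (s powr (a + real i + real j - 1) * (1 - s) powr (b + real (n - j) + 1 - 1)))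
     has_integral (\<Sum>j\<le>n. (-1) ^ j * jacobi_coeff n a b j * Beta (a + real i + real j) (b + real (n - j) + 1))) {0..1}"
    by (intro has_integral_sum has_integral_mult_right has_integral_Beta_real) (use assms in auto)
  also have "(\<Sum>j\<le>n. (-1) ^ j * jacobi_coeff n a b j * Beta (a + real i + real j) (b + real (n - j) + 1)) =
     Gamma (real n + b + 1) * Gamma (1 + a) / Gamma (a + b + real n + real i + 1) *
       (\<Sum>j\<le>n. (-1) ^ j * real (n choose j) * (Gamma (a + real i + real j) / Gamma (a + real j + 1)))"
    unfolding sum_distrib_left
  proof (intro sum.cong refl)
    fix j assume "j \<in> {..n}"
    then obtain k where k: "n = j + k" by (auto simp: le_iff_add)
    have pos: "pochhammer (1 + a) j > 0" "pochhammer (1 + b) k > 0"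
      by (rule pochhammer_pos; use assms in simp)+
    have pg: "pochhammer (1 + x) l = Gamma (x + real l + 1) / Gamma (1 + x)" if "x > 0" for x :: real and l
      using that by (subst pochhammer_Gamma) (auto simp: add_ac elim!: nonpos_Ints_cases)
    have G: "Gamma (1 + a) > 0" "Gamma (1 + b) > 0" "Gamma (a + real j + 1) > 0" "Gamma (b + real k + 1) > 0"
      using assms by (auto intro!: Gamma_real_pos add_pos_nonneg)
    show "(-1) ^ j * jacobi_coeff n a b j * Beta (a + real i + real j) (b + real (n - j) + 1) =
      Gamma (real n + b + 1) * Gamma (1 + a) / Gamma (a + b + real n + real i + 1) *
       ((-1) ^ j * real (n choose j) * (Gamma (a + real i + real j) / Gamma (a + real j + 1)))"
      unfolding jacobi_coeff_def Beta_def pg[OF assms(1)] pg[OF assms(2)]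
      using G by (simp add: k field_simps)
  qed
  finally have *: "((\<lambda>s. \<Sum>j\<le>n. (-1) ^ j * jacobi_coeff n a b j * (s powr (a + real i + real j - 1) * (1 - s) powr (b + real (n - j) + 1 - 1)))
     has_integral Gamma (real n + b + 1) * Gamma (1 + a) / Gamma (a + b + real n + real i + 1) *
       (\<Sum>j\<le>n. (-1) ^ j * real (n choose j) * (Gamma (a + real i + real j) / Gamma (a + real j + 1)))) {0..1}" .
  show ?thesis
  proof (rule has_integral_spike[OF _ _ *])
    show "negligible {0, 1 :: real}" by simp
    fix s :: real assume "s \<in> {0..1} - {0, 1}"
    then have s: "0 < s" "s < 1" by auto
    have e1: "s powr (a + real i + real j - 1) = s powr (a - 1) * s ^ i * s ^ j" for j
    proof -
      have "a + real i + real j - 1 = (a - 1) + real i + real j" by simp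
      then show ?thesis using s by (simp only: powr_add powr_realpow)
    qed
    have e2: "(1 - s) powr (b + real (n - j) + 1 - 1) = (1 - s) powr b * (1 - s) ^ (n - j)" for j
      using s by (simp add: powr_add powr_realpow del: of_nat_diff)
    show "s powr (a - 1) * (1 - s) powr b * poly (jacobi_poly n a b) s * s ^ i =
      (\<Sum>j\<le>n. (-1) ^ j * jacobi_coeff n a b j * (s powr (a + real i + real j - 1) * (1 - s) powr (b + real (n - j) + 1 - 1)))"
      unfolding poly_jacobi_poly sum_distrib_left sum_distrib_right e1 e2
      by (intro sum.cong refl) (simp only: mult_ac)
  qed
qed

text \<open>
  By orthogonality to \<open>s\<^sup>i\<close> for \<open>1 \<le> i \<le> n\<close>, only the constant coefficient of the second factor contributes.
\<close>

lemma has_integral_jacobi_square: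
  assumes "a > 0" "b > 0"
  shows "((\<lambda>s. a * s powr (a - 1) * (1 - s) powr b * (poly (jacobi_poly n a b) s)\<^sup>2) has_integral
     1 / jacobi_norm n a b) {0..1}"
proof -
  define q where "q = jacobi_poly n a b"
  define A where "A i = Gamma (real n + b + 1) * Gamma (1 + a) / Gamma (a + b + real n + real i + 1) *
       (\<Sum>j\<le>n. (-1) ^ j * real (n choose j) * (Gamma (a + real i + real j) / Gamma (a + real j + 1)))" for i
  \<comment> \<open>For i >= 1 the Gamma quotient is a polynomial in j of degree i-1 < n, which the
    n-fold difference kills.\<close>
  have A0: "A i = 0" if "i \<in> {1..n}" for i
  proof -
    have "Gamma (a + real i + real j) / Gamma (a + real j + 1) = pochhammer ((a + 1) + real j) (i - 1)" for j
      using that assms by (subst pochhammer_Gamma) (auto simp: add_ac of_nat_diff elim!: nonpos_Ints_cases)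
    then have "A i = Gamma (real n + b + 1) * Gamma (1 + a) / Gamma (a + b + real n + real i + 1) *
       (\<Sum>j\<le>n. (-1) ^ j * real (n choose j) * pochhammer ((a + 1) + real j) (i - 1))"
      unfolding A_def by simp
    also have "i - 1 < n" using that by auto
    note sum_alternating_choose_pochhammer[OF this, of "a + 1"]
    finally show ?thesis by simp
  qed
  \<comment> \<open>For i = 0 the quotient is a simple pole instead, so the moment survives and has
    a closed form.\<close>
  have "Gamma (a + real j) / Gamma (a + real j + 1) = 1 / (a + real j)" for j
  proof -
    have "a + real j > 0" using assms by simp
    then have "Gamma (a + real j) > 0" by (rule Gamma_real_pos)
    moreover have "Gamma (a + real j + 1) = (a + real j) * Gamma (a + real j)"
      using \<open>a + real j > 0\<close> by (intro Gamma_plus1) (auto elim!: nonpos_Ints_cases)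
    ultimately show ?thesis by simp
  qed
  then have "A 0 = Gamma (real n + b + 1) * Gamma (1 + a) / Gamma (a + b + real n + 1) * (fact n / pochhammer a (Suc n))"
    unfolding A_def using sum_alternating_choose_inverse[OF assms(1), of n] by simp
  also have "pochhammer a (Suc n) = a * (Gamma (real n + a + 1) / Gamma (a + 1))"
    using assms by (simp add: pochhammer_rec) (subst pochhammer_Gamma, auto simp: add_ac elim!: nonpos_Ints_cases)
  finally have A1: "a * A 0 = 1 / jacobi_norm n a b"
    unfolding jacobi_norm_def using assms by (simp add: add_ac power2_eq_square field_simps)
  have "((\<lambda>s. \<Sum>i\<le>n. (a * coeff q i) * (s powr (a - 1) * (1 - s) powr b * poly q s * s ^ i)) has_integral
     (\<Sum>i\<le>n. (a * coeff q i) * A i)) {0..1}"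
    unfolding q_def A_def by (intro has_integral_sum has_integral_mult_right has_integral_jacobi_moment assms) auto
  also have "(\<Sum>i\<le>n. (a * coeff q i) * A i) = (\<Sum>i\<in>{0}. (a * coeff q i) * A i)"
    by (rule sum.mono_neutral_right) (use A0 in auto)
  also have "\<dots> = 1 / jacobi_norm n a b"
    using A1 poly_jacobi_poly_0[of b n a] assms by (simp add: q_def poly_0_coeff_0)
  also have "(\<lambda>s. \<Sum>i\<le>n. (a * coeff q i) * (s powr (a - 1) * (1 - s) powr b * poly q s * s ^ i)) =
     (\<lambda>s. a * s powr (a - 1) * (1 - s) powr b * (poly q s)\<^sup>2)"
  proof
    fix s :: real
    have "poly q s = (\<Sum>i\<le>n. coeff q i * s ^ i)"
      unfolding poly_altdef using degree_jacobi_poly[of n a b]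
      by (intro sum.mono_neutral_left) (auto simp: q_def coeff_eq_0)
    then have "a * s powr (a - 1) * (1 - s) powr b * (poly q s)\<^sup>2 =
       a * s powr (a - 1) * (1 - s) powr b * poly q s * (\<Sum>i\<le>n. coeff q i * s ^ i)"
      by (simp add: power2_eq_square)
    then show "(\<Sum>i\<le>n. (a * coeff q i) * (s powr (a - 1) * (1 - s) powr b * poly q s * s ^ i)) =
      a * s powr (a - 1) * (1 - s) powr b * (poly q s)\<^sup>2"
      by (simp add: sum_distrib_left mult_ac)
  qed
  finally show ?thesis unfolding q_def .
qed

subsection \<open>A sup-norm bound for Jacobi functions\<close>

definition jacobi_fun :: "nat \<Rightarrow> real \<Rightarrow> real \<Rightarrow> real \<Rightarrow> real" where
  "jacobi_fun n a b s = s powr (a / 2) * (1 - s) powr (b / 2) * poly (jacobi_poly n a b) s"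

text \<open>
  With \<open>\<theta> = s (1 - s) d/ds\<close>, the function \<open>g = jacobi_fun n a b\<close> satisfies \<open>\<theta> g = jacobi_dfun n a b\<close> and
  \<open>\<theta>\<^sup>2 g = - jacobi_pot n a b \<cdot> g\<close>.
\<close>

definition jacobi_dfun :: "nat \<Rightarrow> real \<Rightarrow> real \<Rightarrow> real \<Rightarrow> real" where
  "jacobi_dfun n a b s = s powr (a / 2) * (1 - s) powr (b / 2) *
     ((a * (1 - s) - b * s) / 2 * poly (jacobi_poly n a b) s + poly (euler_poly (jacobi_poly n a b)) s)"

definition jacobi_pot :: "nat \<Rightarrow> real \<Rightarrow> real \<Rightarrow> real \<Rightarrow> real" where
  "jacobi_pot n a b s = s * (1 - s) * (real n * (real n + a + b + 1) + (a + b) / 2)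
     - ((a * (1 - s) - b * s) / 2)\<^sup>2"

definition jacobi_dpot :: "nat \<Rightarrow> real \<Rightarrow> real \<Rightarrow> real \<Rightarrow> real" where
  "jacobi_dpot n a b s = (1 - 2 * s) * (real n * (real n + a + b + 1) + (a + b) / 2)
     + (a * (1 - s) - b * s) * (a + b) / 2"

lemma weight_has_derivative:
  fixes a b s :: real
  assumes "0 < s" "s < 1"
  shows "((\<lambda>s. s powr a * (1 - s) powr b) has_real_derivative
     s powr a * (1 - s) powr b * (a * (1 - s) - b * s) / (s * (1 - s))) (at s)"
proof -
  have "((\<lambda>s. s powr a * (1 - s) powr b) has_real_derivative
     a * s powr (a - 1) * (1 - s) powr b + s powr a * (b * (1 - s) powr (b - 1) * (-1))) (at s)"
    using assms by (auto intro!: derivative_eq_intros simp: algebra_simps)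
  moreover have "s powr (a - 1) = s powr a / s" "(1 - s) powr (b - 1) = (1 - s) powr b / (1 - s)"
    using assms by (simp_all add: powr_diff)
  then have "a * s powr (a - 1) * (1 - s) powr b + s powr a * (b * (1 - s) powr (b - 1) * (-1)) =
      s powr a * (1 - s) powr b * (a * (1 - s) - b * s) / (s * (1 - s))"
    using assms by (simp only:) (simp add: divide_simps, simp add: algebra_simps)
  ultimately show ?thesis
    by (rule DERIV_cong)
qed

lemma jacobi_fun_has_derivative:
  assumes "0 < s" "s < 1"
  shows "(jacobi_fun n a b has_real_derivative jacobi_dfun n a b s / (s * (1 - s))) (at s)"
proof -
  define w where "w = (\<lambda>s::real. s powr (a / 2) * (1 - s) powr (b / 2))"
  define q where "q = jacobi_poly n a b"
  have "(w has_real_derivative w s * (a / 2 * (1 - s) - b / 2 * s) / (s * (1 - s))) (at s)"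
    using weight_has_derivative[OF assms, of "a / 2" "b / 2"] by (simp add: w_def)
  then have "((\<lambda>s. w s * poly q s) has_real_derivative
     w s * (a / 2 * (1 - s) - b / 2 * s) / (s * (1 - s)) * poly q s + w s * poly (pderiv q) s) (at s)"
    by (auto intro!: derivative_eq_intros)
  also have "w s * (a / 2 * (1 - s) - b / 2 * s) / (s * (1 - s)) * poly q s + w s * poly (pderiv q) s
     = jacobi_dfun n a b s / (s * (1 - s))"
    using assms by (simp add: jacobi_dfun_def poly_euler_poly w_def q_def divide_simps)
      (simp add: algebra_simps)
  finally show ?thesis
    by (simp add: jacobi_fun_def[abs_def] w_def q_def)
qed

text \<open>The factor s^(a/2) (1-s)^(b/2) is the square root of the weight that makes the Jacobi
  equation self-adjoint. Multiplying by it removes the first-order term (Liouville normal form),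
  which Sonin's argument requires.\<close>

lemma jacobi_dfun_has_derivative:
  assumes "0 < s" "s < 1" "a > -1" "b > -1"
  shows "(jacobi_dfun n a b has_real_derivative
     - jacobi_pot n a b s * jacobi_fun n a b s / (s * (1 - s))) (at s)"
proof -
  define w where "w = (\<lambda>s::real. s powr (a / 2) * (1 - s) powr (b / 2))"
  define q where "q = jacobi_poly n a b"
  define r where "r = euler_poly q"
  define k where "k s = (a * (1 - s) - b * s) / 2 * poly q s + poly r s" for s
  have "(w has_real_derivative w s * (a / 2 * (1 - s) - b / 2 * s) / (s * (1 - s))) (at s)"
    using weight_has_derivative[OF assms(1,2), of "a / 2" "b / 2"] by (simp add: w_def)
  moreover have "(k has_real_derivative
      - ((a + b) / 2) * poly q s + (a * (1 - s) - b * s) / 2 * poly (pderiv q) s + poly (pderiv r) s) (at s)"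
    unfolding k_def by (auto intro!: derivative_eq_intros simp: algebra_simps) (simp add: field_simps)
  ultimately have "((\<lambda>s. w s * k s) has_real_derivative
     w s * (a / 2 * (1 - s) - b / 2 * s) / (s * (1 - s)) * k s + 
     (- ((a + b) / 2) * poly q s + (a * (1 - s) - b * s) / 2 * poly (pderiv q) s + poly (pderiv r) s) * w s) (at s)"
    by (rule DERIV_mult)
  moreover have "w s * (a / 2 * (1 - s) - b / 2 * s) / (s * (1 - s)) * k s + 
     (- ((a + b) / 2) * poly q s + (a * (1 - s) - b * s) / 2 * poly (pderiv q) s + poly (pderiv r) s) * w s
     = w s / (s * (1 - s)) * ((a * (1 - s) - b * s) / 2 * k s - (a + b) / 2 * (s * (1 - s)) * poly q s
         + (a * (1 - s) - b * s) / 2 * poly r s + poly (euler_poly r) s)"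
  proof -
    have eq: "W * x / e * K + (- c * Q + x * p' + r') * W
      = W / e * (x * K - c * e * Q + x * (e * p') + e * r')" if "e \<noteq> 0" for W x e K c Q p' r' :: real
      using that by (simp add: field_simps)
    have "a / 2 * (1 - s) - b / 2 * s = (a * (1 - s) - b * s) / 2" by (simp add: field_simps)
    then show ?thesis
      unfolding poly_euler_poly[of r] poly_euler_poly[of q, folded r_def]
      using assms by (simp only:) (rule eq, simp)
  qed
  moreover have "poly (euler_poly r) s = - (a * (1 - s) - b * s) * poly r s
     - real n * (real n + a + b + 1) * (s * (1 - s)) * poly q s"
    using jacobi_ode[OF assms(3,4), of n s] by (simp add: r_def q_def algebra_simps)
  moreover have "(a * (1 - s) - b * s) / 2 * k s - (a + b) / 2 * (s * (1 - s)) * poly q s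
         + (a * (1 - s) - b * s) / 2 * poly r s + (- (a * (1 - s) - b * s) * poly r s
     - real n * (real n + a + b + 1) * (s * (1 - s)) * poly q s) = - jacobi_pot n a b s * poly q s"
    by (simp add: k_def jacobi_pot_def power2_eq_square field_simps)
  ultimately have "((\<lambda>s. w s * k s) has_real_derivative w s / (s * (1 - s)) * (- jacobi_pot n a b s * poly q s)) (at s)"
    by simp
  then show ?thesis
    by (simp add: jacobi_dfun_def[abs_def] jacobi_fun_def w_def k_def q_def r_def mult_ac)
qed

section \<open>Critical points and critical values of Jacobi functions\<close>

lemma continuous_on_jacobi_fun:
  assumes "a > 0" "b > 0"
  shows "continuous_on {0..1} (jacobi_fun n a b)"
  unfolding jacobi_fun_def[abs_def] using assms by (intro continuous_intros continuous_on_powr') auto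

lemma continuous_on_jacobi_dfun:
  assumes "a > 0" "b > 0"
  shows "continuous_on {0..1} (jacobi_dfun n a b)"
  unfolding jacobi_dfun_def[abs_def] using assms by (intro continuous_intros continuous_on_powr') auto

text \<open>\<open>jacobi_dpot\<close> is affine in s with negative slope: the potential is a
  concave parabola. If it is nondecreasing at a critical point c, it increases strictly on all of
  the interval to the left of c.\<close>

lemma jacobi_dpot_decreasing:
  assumes "a > 0" "b > 0" "s < c" "jacobi_dpot n a b c \<ge> 0"
  shows "jacobi_dpot n a b s > 0"
proof -
  have "jacobi_dpot n a b s - jacobi_dpot n a b c =
     (c - s) * (2 * (real n * (real n + a + b + 1) + (a + b) / 2) + (a + b)^2 / 2)"
    by (simp add: jacobi_dpot_def power2_eq_square field_simps)
  also have "\<dots> > 0"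
    using assms by (intro mult_pos_pos add_nonneg_pos) auto
  finally show ?thesis using assms by simp
qed

lemma jacobi_pot_has_derivative:
  "(jacobi_pot n a b has_real_derivative jacobi_dpot n a b s) (at s)"
  unfolding jacobi_pot_def[abs_def] jacobi_dpot_def
  by (auto intro!: derivative_eq_intros simp: algebra_simps power2_eq_square) (simp add: field_simps)

text \<open>\<open>jacobi_dfun\<close> itself vanishes at 0, so the least zero is sought for its
  polynomial factor k, for which k(0) = a/2 > 0. The zeros of k in [0, c] form a compact set, and k
  cannot change sign before the least of them.\<close>

lemma jacobi_first_critical_point:
  assumes "a > 0" "b > 0" "0 < c" "c < 1" "jacobi_dfun n a b c = 0"
  obtains d where "0 < d" "d \<le> c" "jacobi_dfun n a b d = 0" "\<And>s. 0 < s \<Longrightarrow> s < d \<Longrightarrow> jacobi_dfun n a b s > 0"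
proof -
  define k where "k s = (a * (1 - s) - b * s) / 2 * poly (jacobi_poly n a b) s
      + poly (euler_poly (jacobi_poly n a b)) s" for s
  have k: "jacobi_dfun n a b s = s powr (a / 2) * (1 - s) powr (b / 2) * k s" for s
    by (simp add: jacobi_dfun_def k_def)
  have cont: "continuous_on A k" for A
    unfolding k_def[abs_def] by (intro continuous_intros) auto
  have k0: "k 0 > 0"
    using assms by (simp add: k_def poly_euler_poly poly_jacobi_poly_0)
  define Z where "Z = {s \<in> {0..c}. k s = 0}"
  have "closed Z"
    unfolding Z_def by (rule continuous_closed_preimage_constant[OF cont closed_atLeastAtMost])
  then have "compact Z"
    unfolding compact_eq_bounded_closed
    by (intro conjI bounded_subset[OF bounded_closed_interval[of 0 c]]) (auto simp: Z_def)
  moreover have "c \<in> Z" using assms by (simp add: Z_def k)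
  ultimately obtain d where d: "d \<in> Z" "\<And>s. s \<in> Z \<Longrightarrow> d \<le> s"
    using compact_attains_inf[of Z] by blast
  have kd: "0 \<le> d" "d \<le> c" "k d = 0" using d(1) by (auto simp: Z_def)
  then have "d \<noteq> 0" using k0 by force
  have k_pos: "k s > 0" if "0 < s" "s < d" for s
  proof (rule ccontr)
    assume "\<not> k s > 0"
    then have "k s \<le> 0" by simp
    from IVT2'[OF this less_imp_le[OF k0] less_imp_le[OF that(1)] cont]
    obtain u where "0 \<le> u" "u \<le> s" "k u = 0" by blast
    then have "u \<in> Z" using that kd(2) by (simp add: Z_def)
    from d(2)[OF this] show False using \<open>u \<le> s\<close> that by simp
  qed
  have d_range: "0 < d" "d \<le> c" "k d = 0" using kd \<open>d \<noteq> 0\<close> by auto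
  show ?thesis
  proof (rule that[of d])
    show "jacobi_dfun n a b d = 0" by (simp add: k d_range)
    fix s assume s: "0 < s" "s < d"
    have "s powr (a / 2) * (1 - s) powr (b / 2) > 0"
      using s d_range assms by (intro mult_pos_pos) auto
    then show "jacobi_dfun n a b s > 0"
      unfolding k by (rule mult_pos_pos) (rule k_pos[OF s])
  qed (use d_range in auto)
qed

lemma jacobi_fun_pos_before_critical:
  assumes "a > 0" "b > 0" "0 < d" "d < 1" "\<And>s. 0 < s \<Longrightarrow> s < d \<Longrightarrow> jacobi_dfun n a b s > 0"
    and s: "0 < s" "s \<le> d"
  shows "jacobi_fun n a b s > 0"
proof -
  have "jacobi_fun n a b 0 < jacobi_fun n a b s"
  proof (rule DERIV_pos_imp_increasing_open[OF s(1)])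
    show "continuous_on {0..s} (jacobi_fun n a b)"
      using continuous_on_jacobi_fun[OF assms(1,2)] by (rule continuous_on_subset) (use s assms(4) in auto)
    fix x assume x: "0 < x" "x < s"
    have "x < d" "x < 1" using x s assms(4) by auto
    then have "jacobi_dfun n a b x / (x * (1 - x)) > 0"
      using assms(5)[OF x(1)] x by (intro divide_pos_pos mult_pos_pos) auto
    then show "\<exists>y. (jacobi_fun n a b has_real_derivative y) (at x) \<and> y > 0"
      using jacobi_fun_has_derivative[OF x(1) \<open>x < 1\<close>] by blast
  qed
  moreover have "jacobi_fun n a b 0 = 0" using assms(1) by (simp add: jacobi_fun_def)
  ultimately show ?thesis by simp
qed

lemma jacobi_norm_pos: "a \<ge> 0 \<Longrightarrow> b \<ge> 0 \<Longrightarrow> jacobi_norm n a b > 0"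
  unfolding jacobi_norm_def by (intro divide_pos_pos mult_pos_pos Gamma_real_pos zero_less_power) auto

text \<open>
  Up to the first critical point the polynomial factor is positive and decreasing, so \<open>(g\<^sup>2)' \<le> a g\<^sup>2 / s\<close>; the
  integral of the right-hand side over \<open>[0, 1]\<close> is known exactly.
\<close>

lemma jacobi_fun_first_critical_le:
  assumes "a > 0" "b > 0" "0 < d" "d < 1" "\<And>s. 0 < s \<Longrightarrow> s < d \<Longrightarrow> jacobi_dfun n a b s > 0"
  shows "jacobi_norm n a b * (jacobi_fun n a b d)\<^sup>2 \<le> 1"
proof -
  define q where "q = jacobi_poly n a b"
  define Y where "Y = poly (euler_poly q)"
  define D where "D s = s powr a * (1 - s) powr b * Y s" for s
  define f where "f s = a * s powr (a - 1) * (1 - s) powr b * (poly q s)\<^sup>2" for s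
  have q_pos: "poly q s > 0" if "0 < s" "s \<le> d" for s
  proof -
    have "jacobi_fun n a b s > 0"
      using jacobi_fun_pos_before_critical[OF assms that] .
    moreover have "s powr (a / 2) * (1 - s) powr (b / 2) > 0"
      using that assms by (intro mult_pos_pos) auto
    ultimately show ?thesis
      unfolding jacobi_fun_def q_def by (rule zero_less_mult_pos)
  qed
  \<comment> \<open>The Jacobi equation in self-adjoint form. As q is positive up to d, it makes D
    decrease from D(0) = 0, hence q is decreasing there.\<close>
  have D_deriv: "(D has_real_derivative - (real n * (real n + a + b + 1)) * (s powr a * (1 - s) powr b) * poly q s) (at s)"
    if "0 < s" "s < 1" for s
  proof -
    have deriv: "(D has_real_derivative s powr a * (1 - s) powr b * (a * (1 - s) - b * s) / (s * (1 - s)) * Y s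
       + poly (pderiv (euler_poly q)) s * (s powr a * (1 - s) powr b)) (at s)"
      unfolding D_def[abs_def] Y_def by (rule DERIV_mult[OF weight_has_derivative[OF that] poly_DERIV])
    have pd: "poly (pderiv (euler_poly q)) s = poly (euler_poly (euler_poly q)) s / (s * (1 - s))"
      using that by (simp add: poly_euler_poly[of "euler_poly q"])
    have ee: "poly (euler_poly (euler_poly q)) s = - (a * (1 - s) - b * s) * Y s
       - real n * (real n + a + b + 1) * (s * (1 - s)) * poly q s"
      using jacobi_ode[of a b n s] assms by (simp add: Y_def q_def algebra_simps)
    have eq: "W * X / e * y + (- X * y - L * e * v) / e * W = - L * W * v"
      if "e \<noteq> 0" for W X e y L v :: real
      using that by (simp add: field_simps)
    have "s powr a * (1 - s) powr b * (a * (1 - s) - b * s) / (s * (1 - s)) * Y s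
       + poly (pderiv (euler_poly q)) s * (s powr a * (1 - s) powr b) =
       - (real n * (real n + a + b + 1)) * (s powr a * (1 - s) powr b) * poly q s"
      unfolding pd ee by (rule eq) (use that in simp)
    then show ?thesis
      by (rule DERIV_cong[OF deriv])
  qed
  have Y_nonpos: "Y s \<le> 0" if "0 < s" "s \<le> d" for s
  proof -
    have "D s \<le> D 0"
    proof (rule DERIV_nonpos_imp_decreasing_open[where f = D and a = 0 and b = s])
      show "0 \<le> s" using that by simp
      show "continuous_on {0..s} D"
        unfolding D_def[abs_def] Y_def using assms that by (intro continuous_intros continuous_on_powr') auto
      fix x assume x: "0 < x" "x < s"
      have x1: "x < 1" using x assms that by simp
      have nonneg: "(real n * (real n + a + b + 1)) * (x powr a * (1 - x) powr b) * poly q x \<ge> 0"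
        using q_pos[of x] x assms that by (intro mult_nonneg_nonneg add_nonneg_nonneg) auto
      show "\<exists>y. (D has_real_derivative y) (at x) \<and> y \<le> 0"
        by (rule exI, rule conjI, rule D_deriv[OF x(1) x1]) (use nonneg in simp)
    qed
    then show ?thesis using that assms by (simp add: D_def mult_le_0_iff)
  qed
  have "((\<lambda>s. 2 * jacobi_fun n a b s * (jacobi_dfun n a b s / (s * (1 - s)))) has_integral
     (jacobi_fun n a b d)\<^sup>2 - (jacobi_fun n a b 0)\<^sup>2) {0..d}"
  proof (rule fundamental_theorem_of_calculus_interior)
    show "continuous_on {0..d} (\<lambda>s. (jacobi_fun n a b s)\<^sup>2)"
      by (intro continuous_intros continuous_on_subset[OF continuous_on_jacobi_fun]) (use assms in auto)
    fix x assume "x \<in> {0<..<d}"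
    then have "(jacobi_fun n a b has_real_derivative jacobi_dfun n a b x / (x * (1 - x))) (at x)"
      using assms by (intro jacobi_fun_has_derivative) auto
    from DERIV_power[OF this, of 2]
    show "((\<lambda>s. (jacobi_fun n a b s)\<^sup>2) has_vector_derivative
       2 * jacobi_fun n a b x * (jacobi_dfun n a b x / (x * (1 - x)))) (at x)"
      unfolding has_real_derivative_iff_has_vector_derivative by (simp add: mult_ac)
  qed (use assms in auto)
  then have int1: "((\<lambda>s. 2 * jacobi_fun n a b s * (jacobi_dfun n a b s / (s * (1 - s)))) has_integral
     (jacobi_fun n a b d)\<^sup>2) {0..d}"
    using assms by (simp add: jacobi_fun_def)
  have int2: "(f has_integral 1 / jacobi_norm n a b) {0..1}"
    using has_integral_jacobi_square[OF assms(1,2), of n] by (simp add: f_def[abs_def] q_def)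
  have f_int: "f integrable_on {0..d}"
    by (rule integrable_on_subinterval[OF has_integral_integrable[OF int2]]) (use assms in auto)
  have "(jacobi_fun n a b d)\<^sup>2 \<le> integral {0..d} f"
  proof (rule has_integral_le[OF int1 integrable_integral[OF f_int]])
    fix s assume s: "s \<in> {0..d}"
    show "2 * jacobi_fun n a b s * (jacobi_dfun n a b s / (s * (1 - s))) \<le> f s"
    proof (cases "s = 0")
      case False
      then have s: "0 < s" "s \<le> d" "s < 1" using s assms by auto
      define w where "w = s powr (a / 2) * (1 - s) powr (b / 2)"
      have w2: "w * w = s powr a * (1 - s) powr b"
      proof -
        have "w * w = (s powr (a / 2) * s powr (a / 2)) * ((1 - s) powr (b / 2) * (1 - s) powr (b / 2))"
          by (simp only: w_def mult_ac)
        then show ?thesis by (simp flip: powr_add)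
      qed
      have "2 * (w * poly q s) * (w * ((a * (1 - s) - b * s) / 2 * poly q s + Y s) / (s * (1 - s)))
         = (w * w) * (poly q s)\<^sup>2 * (a / s - b / (1 - s)) + 2 * (w * w) * (poly q s * Y s) / (s * (1 - s))"
      proof -
        have e1: "2 * (w * v) * (w * (x / 2 * v + y) / e) = (w * w) * v\<^sup>2 * (x / e) + 2 * (w * w) * (v * y) / e"
          if "e \<noteq> 0" for w v x y e :: real
          using that by (simp add: field_simps power2_eq_square)
        have e2: "(a * (1 - s) - b * s) / (s * (1 - s)) = a / s - b / (1 - s)"
          using s by (simp add: divide_simps)
        have "s * (1 - s) \<noteq> 0" using s by simp
        then show ?thesis
          by (simp only: e1 e2 not_False_eq_True)
      qed
      \<comment> \<open>Both discarded contributions are nonpositive: the one from the decay of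
        (1-s)^b and the one from the decay of q.\<close>
      also have "\<dots> \<le> (w * w) * (poly q s)\<^sup>2 * (a / s) + 0"
      proof (rule add_mono)
        show "(w * w) * (poly q s)\<^sup>2 * (a / s - b / (1 - s)) \<le> (w * w) * (poly q s)\<^sup>2 * (a / s)"
          using s assms by (intro mult_left_mono) auto
        have "poly q s * Y s \<le> 0"
          using q_pos[of s] Y_nonpos[of s] s by (intro mult_nonneg_nonpos) auto
        then show "2 * (w * w) * (poly q s * Y s) / (s * (1 - s)) \<le> 0"
          using s by (intro divide_nonpos_pos mult_nonneg_nonpos[of "2 * (w * w)"] mult_pos_pos) auto
      qed
      also have "\<dots> = f s"
        using s by (simp add: w2 f_def powr_diff)
      finally show ?thesis
        by (simp add: jacobi_fun_def jacobi_dfun_def w_def q_def Y_def)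
    qed (simp add: f_def)
  qed
  also have "\<dots> \<le> integral {0..1} f"
  proof (rule integral_subset_le[OF _ f_int has_integral_integrable[OF int2]])
    show "\<forall>x\<in>{0..1}. 0 \<le> f x"
      using assms by (simp add: f_def)
  qed (use assms in auto)
  also have "\<dots> = 1 / jacobi_norm n a b"
    using int2 by (rule integral_unique)
  finally show ?thesis
    using jacobi_norm_pos[of a b n] assms by (simp add: field_simps)
qed

text \<open>
  Sonin's argument: while the potential \<open>\<Phi>\<close> is positive and increasing, \<open>g\<^sup>2 + (\<theta> g)\<^sup>2 / \<Phi>\<close> decreases, so the first
  critical value dominates the later ones.
\<close>

lemma jacobi_fun_left_critical_le:
  assumes ab: "a > 0" "b > 0" and c: "0 < c" "c < 1"
    and crit: "(jacobi_fun n a b has_real_derivative 0) (at c)"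
    and dpot: "jacobi_dpot n a b c \<ge> 0"
  shows "jacobi_norm n a b * (jacobi_fun n a b c)\<^sup>2 \<le> 1"
proof -
  have "jacobi_dfun n a b c / (c * (1 - c)) = 0"
    by (rule DERIV_unique[OF jacobi_fun_has_derivative[OF c] crit])
  then have dfun_c: "jacobi_dfun n a b c = 0" using c by simp
  then obtain d where d: "0 < d" "d \<le> c" "jacobi_dfun n a b d = 0"
      "\<And>s. 0 < s \<Longrightarrow> s < d \<Longrightarrow> jacobi_dfun n a b s > 0"
    using jacobi_first_critical_point[OF ab c] by blast
  have d1: "d < 1" using d c by simp
  have pot_mono: "jacobi_pot n a b s < jacobi_pot n a b s'" if "s < s'" "s' \<le> c" for s s'
  proof (rule DERIV_pos_imp_increasing_open[OF that(1)])
    fix x assume "s < x" "x < s'"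
    then show "\<exists>y. (jacobi_pot n a b has_real_derivative y) (at x) \<and> y > 0"
      using jacobi_pot_has_derivative jacobi_dpot_decreasing[OF ab _ dpot, of x] that by fastforce
  qed (intro DERIV_continuous_on[of _ _ "jacobi_dpot n a b"] DERIV_subset[OF jacobi_pot_has_derivative], simp)
  \<comment> \<open>Were the potential not positive at d, it would be negative on (0, d). Since g is
    positive there, theta g would increase strictly from its value 0 at s = 0 and could not vanish
    at d.\<close>
  have pot_d: "jacobi_pot n a b d > 0"
  proof (rule ccontr)
    assume neg: "\<not> jacobi_pot n a b d > 0"
    have "jacobi_dfun n a b 0 < jacobi_dfun n a b d"
    proof (rule DERIV_pos_imp_increasing_open[OF d(1)])
      show "continuous_on {0..d} (jacobi_dfun n a b)"
        using continuous_on_jacobi_dfun[OF ab] by (rule continuous_on_subset) (use d1 in auto)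
      fix x assume x: "0 < x" "x < d"
      have "jacobi_pot n a b x < 0" using pot_mono[of x d] x d neg by simp
      moreover have "jacobi_fun n a b x > 0"
        using jacobi_fun_pos_before_critical[OF ab d(1) d1 d(4)] x by simp
      ultimately have "- jacobi_pot n a b x * jacobi_fun n a b x / (x * (1 - x)) > 0"
        using x d1 by (intro divide_pos_pos mult_pos_pos) auto
      then show "\<exists>y. (jacobi_dfun n a b has_real_derivative y) (at x) \<and> y > 0"
        using jacobi_dfun_has_derivative[of x a b n] x d1 ab by fastforce
    qed
    moreover have "jacobi_dfun n a b 0 = 0" using ab by (simp add: jacobi_dfun_def)
    ultimately show False using d(3) by simp
  qed
  define S where "S s = (jacobi_fun n a b s)\<^sup>2 + (jacobi_dfun n a b s)\<^sup>2 / jacobi_pot n a b s" for s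
  have "S c \<le> S d"
  proof (rule DERIV_nonpos_imp_nonincreasing[OF d(2)])
    fix x assume x: "d \<le> x" "x \<le> c"
    have pot: "jacobi_pot n a b x > 0" using pot_mono[of d x] x pot_d by (cases "x = d") auto
    have dp: "jacobi_dpot n a b x \<ge> 0"
      using jacobi_dpot_decreasing[OF ab _ dpot, of x] dpot x by (cases "x = c") auto
    have x01: "0 < x" "x < 1" using x d c by auto
    \<comment> \<open>The mixed terms in g and theta g cancel, and only the derivative of the
      potential is left.\<close>
    have deriv: "(S has_real_derivative - jacobi_dpot n a b x * (jacobi_dfun n a b x / jacobi_pot n a b x)\<^sup>2) (at x)"
    proof -
      let ?g = "jacobi_fun n a b x" and ?y = "jacobi_dfun n a b x" and ?P = "jacobi_pot n a b x"
        and ?e = "x * (1 - x)"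
      have G: "(jacobi_fun n a b has_real_derivative ?y / ?e) (at x)"
        by (rule jacobi_fun_has_derivative[OF x01])
      have Y: "(jacobi_dfun n a b has_real_derivative - ?P * ?g / ?e) (at x)"
        using ab by (intro jacobi_dfun_has_derivative x01) auto
      have "(S has_real_derivative
          2 * ?g * (?y / ?e) + (2 * ?y * (- ?P * ?g / ?e) * ?P - ?y\<^sup>2 * jacobi_dpot n a b x) / (?P * ?P)) (at x)"
        unfolding S_def[abs_def] using pot
        by (auto intro!: derivative_eq_intros G Y jacobi_pot_has_derivative simp: mult_ac)
      moreover have "2 * g * (y / e) + (2 * y * (- P * g / e) * P - y\<^sup>2 * D) / (P * P) = - D * (y / P)\<^sup>2"
        if "e > 0" "P > 0" for g y e P D :: real
        using that by (simp add: divide_simps power2_eq_square)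
      ultimately show ?thesis
        using pot x01 by simp
    qed
    show "\<exists>y. (S has_real_derivative y) (at x) \<and> y \<le> 0"
      by (rule exI, rule conjI, rule deriv) (use dp in simp)
  qed
  \<comment> \<open>At both c and d theta g vanishes, so S reduces to g^2 there.\<close>
  then have "(jacobi_fun n a b c)\<^sup>2 \<le> (jacobi_fun n a b d)\<^sup>2"
    by (simp add: S_def dfun_c d(3))
  then have "jacobi_norm n a b * (jacobi_fun n a b c)\<^sup>2 \<le> jacobi_norm n a b * (jacobi_fun n a b d)\<^sup>2"
    using jacobi_norm_pos[of a b n] ab by (intro mult_left_mono) auto
  also have "\<dots> \<le> 1"
    using jacobi_fun_first_critical_le[OF ab d(1) d1 d(4)] by simp
  finally show ?thesis .
qed

lemma jacobi_norm_mirror: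
  assumes "a > 0" "b > 0"
  shows "jacobi_norm n a b * (jacobi_coeff n a b n)\<^sup>2 = jacobi_norm n b a"
proof -
  have pg: "pochhammer (1 + x) n = Gamma (real n + x + 1) / Gamma (x + 1)" if "x > 0" for x :: real
    using that by (subst pochhammer_Gamma) (auto simp: add_ac elim!: nonpos_Ints_cases)
  have "Gamma (real n + a + 1) > 0" "Gamma (a + 1) > 0" "Gamma (real n + b + 1) > 0" "Gamma (b + 1) > 0"
    using assms by (auto intro!: Gamma_real_pos add_nonneg_pos)
  then show ?thesis
    unfolding jacobi_norm_def jacobi_coeff_def pg[OF assms(1)] pg[OF assms(2)]
    by (simp add: field_simps power2_eq_square)
qed

lemma jacobi_fun_mirror:
  assumes "a > -1" "b > -1"
  shows "jacobi_fun n a b (1 - s) = (-1) ^ n * jacobi_coeff n a b n * jacobi_fun n b a s"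
  using poly_jacobi_poly_mirror[OF assms, of n s] by (simp add: jacobi_fun_def mult_ac)

text \<open>Past the vertex of the potential the reflection s -> 1-s is applied: it swaps a and b
  and reverses the sign of \<open>jacobi_dpot\<close>. The constant it introduces is absorbed by
  \<open>jacobi_norm_mirror\<close>.\<close>

lemma jacobi_fun_critical_le:
  assumes ab: "a > 0" "b > 0" and c: "0 < c" "c < 1"
    and crit: "(jacobi_fun n a b has_real_derivative 0) (at c)"
  shows "jacobi_norm n a b * (jacobi_fun n a b c)\<^sup>2 \<le> 1"
proof (cases "jacobi_dpot n a b c \<ge> 0")
  case False
  define T where "T = (-1) ^ n * jacobi_coeff n b a n"
  have mirror: "jacobi_fun n b a (1 - s) = T * jacobi_fun n a b s" for s
    using jacobi_fun_mirror[of b a n s] ab by (simp add: T_def)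
  have "jacobi_fun n b a = (\<lambda>s. T * jacobi_fun n a b (1 - s))"
    using mirror[of "1 - s" for s] by auto
  moreover have "((\<lambda>s. T * jacobi_fun n a b (1 - s)) has_real_derivative 0) (at (1 - c))"
  proof -
    have "((\<lambda>s. 1 - s) has_real_derivative -1) (at (1 - c))"
      by (auto intro!: derivative_eq_intros)
    then have "((\<lambda>s. jacobi_fun n a b (1 - s)) has_real_derivative 0 * -1) (at (1 - c))"
      using crit by (intro DERIV_chain2[where f = "jacobi_fun n a b"]) auto
    from DERIV_cmult[OF this, of T] show ?thesis by simp
  qed
  ultimately have "(jacobi_fun n b a has_real_derivative 0) (at (1 - c))" by simp
  moreover have "jacobi_dpot n b a (1 - c) = - jacobi_dpot n a b c"
    by (simp add: jacobi_dpot_def field_simps)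
  ultimately have "jacobi_norm n b a * (jacobi_fun n b a (1 - c))\<^sup>2 \<le> 1"
    using False ab c by (intro jacobi_fun_left_critical_le) auto
  also have "jacobi_norm n b a * (jacobi_fun n b a (1 - c))\<^sup>2 =
     (jacobi_norm n b a * (jacobi_coeff n b a n)\<^sup>2) * (jacobi_fun n a b c)\<^sup>2"
  proof -
    have "((-1 :: real) ^ n)\<^sup>2 = 1" by (simp add: power2_eq_square flip: power_mult_distrib)
    then show ?thesis by (simp add: mirror T_def power_mult_distrib)
  qed
  also have "jacobi_norm n b a * (jacobi_coeff n b a n)\<^sup>2 = jacobi_norm n a b"
    by (rule jacobi_norm_mirror) (use ab in auto)
  finally show ?thesis .
qed (use jacobi_fun_left_critical_le[OF assms] in auto)

text \<open>For positive parameters g vanishes at both endpoints, so a nonzero maximum of g^2 sits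
  at an interior critical point.\<close>

lemma jacobi_fun_le_pos:
  assumes ab: "a > 0" "b > 0" and s: "s \<in> {0..1}"
  shows "jacobi_norm n a b * (jacobi_fun n a b s)\<^sup>2 \<le> 1"
proof -
  let ?g = "jacobi_fun n a b"
  have "continuous_on {0..1} (\<lambda>s. (?g s)\<^sup>2)"
    by (intro continuous_intros continuous_on_jacobi_fun ab)
  then obtain c where c: "c \<in> {0..1}" "\<And>x. x \<in> {0..1} \<Longrightarrow> (?g x)\<^sup>2 \<le> (?g c)\<^sup>2"
    using continuous_attains_sup[of "{0..1::real}" "\<lambda>s. (?g s)\<^sup>2"] by auto
  have "jacobi_norm n a b * (?g c)\<^sup>2 \<le> 1"
  proof (cases "?g c = 0")
    case False
    then have "c \<noteq> 0" "c \<noteq> 1" using ab by (auto simp: jacobi_fun_def)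
    then have c01: "0 < c" "c < 1" using c by auto
    let ?D = "jacobi_dfun n a b c / (c * (1 - c))"
    have D: "(?g has_real_derivative ?D) (at c)"
      by (rule jacobi_fun_has_derivative[OF c01])
    then have "((\<lambda>s. (?g s)\<^sup>2) has_real_derivative 2 * ?g c * ?D) (at c)"
      by (auto intro!: derivative_eq_intros)
    then have "2 * ?g c * ?D = 0"
    proof (rule DERIV_local_max[where d = "min c (1 - c)"])
      show "\<forall>y. \<bar>c - y\<bar> < min c (1 - c) \<longrightarrow> (?g y)\<^sup>2 \<le> (?g c)\<^sup>2"
      proof (intro allI impI)
        fix y assume "\<bar>c - y\<bar> < min c (1 - c)"
        then have "y \<in> {0..1}" by (auto simp: abs_if split: if_splits)
        then show "(?g y)\<^sup>2 \<le> (?g c)\<^sup>2" by (rule c(2))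
      qed
    qed (use c01 in auto)
    then have "?D = 0" using False by simp
    with D have "(?g has_real_derivative 0) (at c)" by metis
    then show ?thesis
      by (rule jacobi_fun_critical_le[OF ab c01])
  qed simp
  moreover have "jacobi_norm n a b * (?g s)\<^sup>2 \<le> jacobi_norm n a b * (?g c)\<^sup>2"
    using c(2)[OF s] jacobi_norm_pos[of a b n] ab by (intro mult_left_mono) auto
  ultimately show ?thesis by linarith
qed

text \<open>Both parameters are raised by e > 0 and e tends to 0. At an interior s the powers and
  coefficients depend continuously on the parameters.\<close>

theorem jacobi_fun_le:
  assumes ab: "a \<ge> 0" "b \<ge> 0" and s: "0 < s" "s < 1"
  shows "jacobi_norm n a b * (jacobi_fun n a b s)\<^sup>2 \<le> 1"
proof (rule tendsto_upperbound)
  have poch: "((\<lambda>e. pochhammer (1 + (x + e)) k) \<longlongrightarrow> pochhammer (1 + x) k) (at_right 0)" for x :: real and k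
    unfolding pochhammer_prod by (auto intro!: tendsto_eq_intros)
  have pos: "pochhammer (1 + x) k > 0" if "x \<ge> 0" for x :: real and k
    by (rule pochhammer_pos) (use that in simp)
  have Gam: "((\<lambda>e. Gamma (y + e)) \<longlongrightarrow> Gamma y) (at_right 0)" if "y > 0" for y :: real
    by (rule tendsto_Gamma) (use that in \<open>auto intro!: tendsto_eq_intros elim!: nonpos_Ints_cases\<close>)
  have Gam2: "((\<lambda>e. Gamma (y + 2 * e)) \<longlongrightarrow> Gamma y) (at_right 0)" if "y > 0" for y :: real
    by (rule tendsto_Gamma) (use that in \<open>auto intro!: tendsto_eq_intros elim!: nonpos_Ints_cases\<close>)
  have Gpos: "Gamma (real n + a + 1) > 0" "Gamma (a + 1) > 0" "Gamma (real n + b + 1) > 0"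
    using ab by (auto intro!: Gamma_real_pos add_nonneg_pos)
  have Gne: "Gamma (a + 1) \<noteq> 0" "Gamma (real n + b + 1) \<noteq> 0"
    using Gpos(2,3) by (metis less_irrefl)+
  have "((\<lambda>e. Gamma (real n + a + b + 1 + 2 * e) * Gamma (real n + a + 1 + e) /
     (fact n * Gamma (real n + b + 1 + e) * (Gamma (a + 1 + e))\<^sup>2)) \<longlongrightarrow> jacobi_norm n a b) (at_right 0)"
    unfolding jacobi_norm_def using ab Gne
    by (intro tendsto_divide tendsto_mult tendsto_power tendsto_const Gam Gam2) auto
  then have norm: "((\<lambda>e. jacobi_norm n (a + e) (b + e)) \<longlongrightarrow> jacobi_norm n a b) (at_right 0)"
  proof -
    have "real n + (a + e) + (b + e) + 1 = real n + a + b + 1 + 2 * e"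
      "real n + (a + e) + 1 = real n + a + 1 + e" "real n + (b + e) + 1 = real n + b + 1 + e"
      "a + e + 1 = a + 1 + e" for e
      by simp_all
    with \<open>(_ \<longlongrightarrow> jacobi_norm n a b) _\<close> show ?thesis
      by (simp only: jacobi_norm_def[of n "a + _" "b + _"])
  qed
  have coeff: "((\<lambda>e. jacobi_coeff n (a + e) (b + e) j) \<longlongrightarrow> jacobi_coeff n a b j) (at_right 0)" for j
  proof -
    have "pochhammer (1 + b) (n - j) * pochhammer (1 + a) j \<noteq> 0"
      using pos[OF ab(1), of j] pos[OF ab(2), of "n - j"] by (metis less_irrefl mult_pos_pos)
    then show ?thesis
      unfolding jacobi_coeff_def by (intro tendsto_divide tendsto_mult tendsto_const poch)
  qed
  have weight: "((\<lambda>e. x powr ((c + e) / 2)) \<longlongrightarrow> x powr (c / 2)) (at_right 0)" if "x > 0" for x c :: real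
  proof (rule tendsto_powr)
    have "((\<lambda>e. (c + e) / 2) \<longlongrightarrow> (c + 0) / 2) (at_right 0)"
      by (intro tendsto_intros) auto
    then show "((\<lambda>e. (c + e) / 2) \<longlongrightarrow> c / 2) (at_right 0)" by simp
  qed (use that in auto)
  have "((\<lambda>e. jacobi_fun n (a + e) (b + e) s) \<longlongrightarrow> jacobi_fun n a b s) (at_right 0)"
    unfolding jacobi_fun_def poly_jacobi_poly using s
    by (intro tendsto_mult tendsto_sum tendsto_const coeff weight) auto
  then show "((\<lambda>e. jacobi_norm n (a + e) (b + e) * (jacobi_fun n (a + e) (b + e) s)\<^sup>2) \<longlongrightarrow>
     jacobi_norm n a b * (jacobi_fun n a b s)\<^sup>2) (at_right 0)"
    by (intro tendsto_mult tendsto_power norm)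
  show "\<forall>\<^sub>F e in at_right 0. jacobi_norm n (a + e) (b + e) * (jacobi_fun n (a + e) (b + e) s)\<^sup>2 \<le> 1"
    using eventually_at_right_less
  proof eventually_elim
    case (elim e)
    show ?case by (rule jacobi_fun_le_pos) (use elim ab s in auto)
  qed
qed simp

subsection \<open>The kernel of the discrete Laguerre evolution\<close>

text \<open>The absolute value at 0 of the n-th Laguerre polynomial, orthonormal for x^\<alpha>
  e^(-x) / Gamma(1+\<alpha>).\<close>

definition laguerre_weight :: "real \<Rightarrow> nat \<Rightarrow> real" where
  "laguerre_weight \<alpha> n = sqrt (pochhammer (1 + \<alpha>) n / fact n)"

definition meixner_coeff :: "real \<Rightarrow> nat \<Rightarrow> nat \<Rightarrow> nat \<Rightarrow> real" where
  "meixner_coeff \<alpha> n m j = real (n choose j) * real (m choose j) * fact j / pochhammer (1 + \<alpha>) j"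

text \<open>This is b^(n+m) times the hypergeometric sum 2F1(-n, -m; 1+\<alpha>; 1/b^2), with the
  power multiplied in so that b = 0 is allowed. Where the exponent would be truncated, j > n and the
  coefficient is 0.\<close>

definition meixner_poly :: "real \<Rightarrow> nat \<Rightarrow> nat \<Rightarrow> complex \<Rightarrow> complex" where
  "meixner_poly \<alpha> n m b = (\<Sum>j\<le>m. of_real (meixner_coeff \<alpha> n m j) * b ^ (n + m - 2 * j))"

text \<open>H acts as multiplication by x in the basis p_n of orthonormal Laguerre polynomials with
  signs (-1)^n. The formula is the integral of e^(-itx) p_n p_m against x^\<alpha> e^(-x) /
  Gamma(1+\<alpha>).\<close>

definition laguerre_kernel :: "real \<Rightarrow> nat \<Rightarrow> nat \<Rightarrow> real \<Rightarrow> complex" where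
  "laguerre_kernel \<alpha> n m t = of_real (laguerre_weight \<alpha> n * laguerre_weight \<alpha> m) *
     ((1 + \<i> * t) powr (- of_real (1 + \<alpha>)) * meixner_poly \<alpha> n m (- (\<i> * t)) / (1 + \<i> * t) ^ (n + m))"

lemma pochhammer_pos_nonneg: "\<alpha> \<ge> 0 \<Longrightarrow> pochhammer (1 + \<alpha>) n > (0 :: real)"
  by (rule pochhammer_pos) simp

lemma laguerre_weight_pos: "\<alpha> \<ge> 0 \<Longrightarrow> laguerre_weight \<alpha> n > 0"
  using pochhammer_pos_nonneg[of \<alpha> n] by (simp add: laguerre_weight_def)

text \<open>Two readings of the ratio of consecutive weights. They turn the square roots in the
  Jacobi matrix into linear coefficients, so that the kernel equation becomes an identity between
  polynomials.\<close>

lemma laguerre_weight_Suc: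
  assumes "\<alpha> \<ge> 0"
  shows "sqrt ((real n + 1) * (real n + 1 + \<alpha>)) * laguerre_weight \<alpha> (Suc n) = (real n + 1 + \<alpha>) * laguerre_weight \<alpha> n"
    and "sqrt ((real n + 1) * (real n + 1 + \<alpha>)) * laguerre_weight \<alpha> n = (real n + 1) * laguerre_weight \<alpha> (Suc n)"
proof -
  define p where "p = pochhammer (1 + \<alpha>) n / fact n"
  define x where "x = real n + 1"
  define y where "y = real n + 1 + \<alpha>"
  have xy: "x > 0" "y > 0" using assms by (simp_all add: x_def y_def)
  have "pochhammer (1 + \<alpha>) (Suc n) / fact (Suc n) = p * (y / x)"
    by (simp add: p_def x_def y_def pochhammer_Suc add_ac)
  then have w: "laguerre_weight \<alpha> (Suc n) = sqrt p * (sqrt y / sqrt x)" "laguerre_weight \<alpha> n = sqrt p"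
    by (simp_all add: laguerre_weight_def p_def[symmetric] real_sqrt_mult real_sqrt_divide)
  have s: "sqrt x * sqrt x = x" "sqrt y * sqrt y = y" "sqrt x \<noteq> 0" using xy by simp_all
  have "sqrt (x * y) * laguerre_weight \<alpha> (Suc n) = (sqrt y * sqrt y) * laguerre_weight \<alpha> n"
    using s(3) by (simp add: w real_sqrt_mult)
  then have "sqrt (x * y) * laguerre_weight \<alpha> (Suc n) = y * laguerre_weight \<alpha> n"
    by (simp only: s(2))
  then show "sqrt ((real n + 1) * (real n + 1 + \<alpha>)) * laguerre_weight \<alpha> (Suc n) = (real n + 1 + \<alpha>) * laguerre_weight \<alpha> n"
    by (simp only: x_def y_def)
  have "sqrt (x * y) * laguerre_weight \<alpha> n = (sqrt x * sqrt x) * laguerre_weight \<alpha> (Suc n)"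
  proof -
    have "(a * b) * q = (a * a) * (q * (b / a))" if "a \<noteq> 0" for a b q :: real
      using that by (simp add: field_simps)
    then show ?thesis unfolding w real_sqrt_mult using s(3) by blast
  qed
  then have "sqrt (x * y) * laguerre_weight \<alpha> n = x * laguerre_weight \<alpha> (Suc n)"
    by (simp only: s(1))
  then show "sqrt ((real n + 1) * (real n + 1 + \<alpha>)) * laguerre_weight \<alpha> n = (real n + 1) * laguerre_weight \<alpha> (Suc n)"
    by (simp only: x_def y_def)
qed

text \<open>Polynomial growth is enough against the geometric decay of the kernel. By Bernoulli's
  inequality the growth factor (x+\<alpha>)/x with x = n+1 is at most ((x+1)/x)^K, and these bounds
  telescope.\<close>

lemma laguerre_weight_le:
  assumes "\<alpha> \<ge> 0" "\<alpha> \<le> real K"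
  shows "laguerre_weight \<alpha> n \<le> (real n + 1) ^ K"
proof -
  have "pochhammer (1 + \<alpha>) n \<le> fact n * (real n + 1) ^ K"
  proof (induction n)
    case (Suc n)
    define x where "x = real n + 1"
    have x: "x > 0" by (simp add: x_def)
    have "1 + real K * (1 / x) \<le> (1 + 1 / x) ^ K"
      by (rule Bernoulli_inequality, rule order_trans[of _ 0]) (use x in auto)
    then have "(1 + real K * (1 / x)) * x ^ K \<le> (1 + 1 / x) ^ K * x ^ K"
      using x by (intro mult_right_mono) auto
    also have "\<dots> = (x + 1) ^ K"
      using x by (simp add: power_mult_distrib[symmetric] field_simps)
    finally have "x * ((1 + real K * (1 / x)) * x ^ K) \<le> x * (x + 1) ^ K"
      using x by (intro mult_left_mono) auto
    moreover have "x * ((1 + real K * (1 / x)) * x ^ K) = (x + real K) * x ^ K"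
      using x by (simp add: field_simps)
    ultimately have bern: "(x + real K) * x ^ K \<le> x * (x + 1) ^ K"
      by linarith
    have "pochhammer (1 + \<alpha>) (Suc n) = pochhammer (1 + \<alpha>) n * (x + \<alpha>)"
      by (simp add: pochhammer_Suc x_def add_ac)
    also have "\<dots> \<le> (fact n * x ^ K) * (x + real K)"
      using Suc.IH assms x by (intro mult_mono) (auto simp: x_def)
    also have "\<dots> \<le> fact n * (x * (x + 1) ^ K)"
      using bern by (simp add: mult_ac)
    also have "\<dots> = fact (Suc n) * (real (Suc n) + 1) ^ K"
      by (simp add: x_def add_ac)
    finally show ?case .
  qed simp
  then have "pochhammer (1 + \<alpha>) n / fact n \<le> (real n + 1) ^ K"
    by (simp add: field_simps)
  also have "\<dots> \<le> ((real n + 1) ^ K)\<^sup>2"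
    by (simp add: power2_eq_square)
  finally show ?thesis
    unfolding laguerre_weight_def by (intro real_le_lsqrt) auto
qed

section \<open>Recurrences of the Meixner coefficients and the kernel equation\<close>

lemma choose_Suc_right: "real (Suc j) * real (m choose Suc j) = (real m - real j) * real (m choose j)"
proof (cases "j \<le> m")
  case True
  have "real (Suc j) * real (m choose Suc j) = real (m - j) * real (m choose j)"
    by (metis binomial_absorb_comp binomial_absorption of_nat_mult)
  then show ?thesis using True by (simp add: of_nat_diff)
qed (simp add: binomial_eq_0)

lemma meixner_coeff_sym: "meixner_coeff \<alpha> n m j = meixner_coeff \<alpha> m n j"
  by (simp add: meixner_coeff_def)

lemma meixner_coeff_eq_0: "j > n \<or> j > m \<Longrightarrow> meixner_coeff \<alpha> n m j = 0"
  by (auto simp: meixner_coeff_def)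

lemma meixner_coeff_0 [simp]: "meixner_coeff \<alpha> n m 0 = 1"
  by (simp add: meixner_coeff_def)

lemma meixner_coeff_recurrence:
  assumes "\<alpha> \<ge> 0"
  shows "(real n + 1 + \<alpha>) * meixner_coeff \<alpha> (Suc n) m (Suc j) =
    (real n + 1 + \<alpha> + real (Suc j)) * meixner_coeff \<alpha> n m (Suc j) + (real m - real j) * meixner_coeff \<alpha> n m j"
proof -
  define p where "p = pochhammer (1 + \<alpha>) j"
  define q where "q = 1 + \<alpha> + real j"
  have pq: "p \<noteq> 0" "q \<noteq> 0"
    using assms pochhammer_pos_nonneg[OF assms, of j] by (auto simp: p_def q_def)
  define A where "A = real (n choose j)"
  define B where "B = real (n choose Suc j)"
  define C where "C = real (m choose Suc j)"
  define D where "D = real (m choose j)"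
  have AB: "real (Suc j) * B = (real n - real j) * A" and CD: "real (Suc j) * C = (real m - real j) * D"
    unfolding A_def B_def C_def D_def by (rule choose_Suc_right)+
  have m1: "meixner_coeff \<alpha> (Suc n) m (Suc j) = (A + B) * (real (Suc j) * C) * fact j / (p * q)"
    by (simp add: meixner_coeff_def pochhammer_Suc p_def q_def A_def B_def C_def)
  have m2: "meixner_coeff \<alpha> n m (Suc j) = B * (real (Suc j) * C) * fact j / (p * q)"
    by (simp add: meixner_coeff_def pochhammer_Suc p_def q_def B_def C_def)
  have m3: "meixner_coeff \<alpha> n m j = A * D * fact j / p"
    by (simp add: meixner_coeff_def p_def A_def D_def)
  have "(real n + 1 + \<alpha>) * (A + B) = (real n + 1 + \<alpha> + real (Suc j)) * B + q * A"
    using AB by (simp add: q_def algebra_simps)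
  then have "(real n + 1 + \<alpha>) * (A + B) * ((real m - real j) * D * fact j / (p * q)) =
    ((real n + 1 + \<alpha> + real (Suc j)) * B + q * A) * ((real m - real j) * D * fact j / (p * q))"
    by simp
  also have "\<dots> = (real n + 1 + \<alpha> + real (Suc j)) * (B * ((real m - real j) * D) * fact j / (p * q))
      + (real m - real j) * (A * D * fact j / p)"
    using pq by (simp add: field_simps)
  finally show ?thesis
    unfolding m1 m2 m3 CD by (simp add: mult_ac)
qed

lemma meixner_coeff_pred:
  "real n * meixner_coeff \<alpha> (n - 1) m j = (real n - real j) * meixner_coeff \<alpha> n m j"
proof (cases n)
  case 0
  then show ?thesis by (cases j) (auto simp: meixner_coeff_def)
next
  case (Suc k)
  have "real (Suc k) * real (k choose j) = (real (Suc k) - real j) * real (Suc k choose j)"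
  proof (cases j)
    case (Suc i)
    have "real (Suc i) * real (k choose Suc i) = (real k - real i) * real (k choose i)"
      by (rule choose_Suc_right)
    then show ?thesis by (simp add: Suc algebra_simps)
  qed simp
  then have "real (Suc k) * real (k choose j) * (real (m choose j) * fact j / pochhammer (1 + \<alpha>) j) =
     (real (Suc k) - real j) * real (Suc k choose j) * (real (m choose j) * fact j / pochhammer (1 + \<alpha>) j)"
    by simp
  then show ?thesis by (simp add: Suc meixner_coeff_def mult_ac)
qed

lemma meixner_poly_sym: "meixner_poly \<alpha> n m b = meixner_poly \<alpha> m n b"
proof -
  have *: "meixner_poly \<alpha> n m b = (\<Sum>j\<le>n + m. of_real (meixner_coeff \<alpha> n m j) * b ^ (n + m - 2 * j))" for n m
    unfolding meixner_poly_def by (rule sum.mono_neutral_left) (auto simp: meixner_coeff_eq_0)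
  show ?thesis unfolding * by (simp add: meixner_coeff_sym[of \<alpha> n m] add.commute)
qed

lemma laguerre_kernel_sym: "laguerre_kernel \<alpha> n m t = laguerre_kernel \<alpha> m n t"
  by (simp add: laguerre_kernel_def meixner_poly_sym[of \<alpha> n m] mult_ac add.commute)

lemma meixner_poly_nonzero:
  assumes "b \<noteq> 0"
  shows "meixner_poly \<alpha> n m b = b ^ (n + m) * (\<Sum>j\<le>m. of_real (meixner_coeff \<alpha> n m j) * (1 / b\<^sup>2) ^ j)"
  unfolding meixner_poly_def sum_distrib_left
proof (intro sum.cong refl)
  fix j assume "j \<in> {..m}"
  show "of_real (meixner_coeff \<alpha> n m j) * b ^ (n + m - 2 * j) =
    b ^ (n + m) * (of_real (meixner_coeff \<alpha> n m j) * (1 / b\<^sup>2) ^ j)"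
  proof (cases "j \<le> n")
    case True
    then have "n + m = (n + m - 2 * j) + 2 * j" using \<open>j \<in> {..m}\<close> by simp
    then have "b ^ (n + m) = b ^ (n + m - 2 * j) * (b\<^sup>2) ^ j"
      by (metis power_add power_mult)
    then show ?thesis using assms by (simp add: field_simps)
  qed (simp add: meixner_coeff_eq_0)
qed

definition meixner_dpoly :: "real \<Rightarrow> nat \<Rightarrow> nat \<Rightarrow> complex \<Rightarrow> complex" where
  "meixner_dpoly \<alpha> n m b = (\<Sum>j\<le>m. of_real (meixner_coeff \<alpha> n m j) * (of_nat (n + m - 2 * j) * b ^ (n + m - 2 * j - 1)))"

lemma meixner_poly_has_derivative:
  "(meixner_poly \<alpha> n m has_field_derivative meixner_dpoly \<alpha> n m b) (at b)"
proof -
  have "((\<lambda>b. \<Sum>j\<le>m. of_real (meixner_coeff \<alpha> n m j) * b ^ (n + m - 2 * j)) has_field_derivative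
     (\<Sum>j\<le>m. of_real (meixner_coeff \<alpha> n m j) * (of_nat (n + m - 2 * j) * b ^ (n + m - 2 * j - 1)))) (at b)"
  proof (intro DERIV_sum DERIV_cmult)
    fix j
    show "((\<lambda>b. b ^ (n + m - 2 * j)) has_field_derivative of_nat (n + m - 2 * j) * b ^ (n + m - 2 * j - 1)) (at b)"
      using DERIV_power[OF DERIV_ident, where n = "n + m - 2 * j"] by simp
  qed
  then show ?thesis
    by (simp add: meixner_poly_def[abs_def] meixner_dpoly_def)
qed

text \<open>
  For \<open>b = - \<i> t\<close> this is the equation \<open>\<i> \<partial>\<^sub>t K = H K\<close> for the kernel, with the powers of \<open>1 + \<i> t\<close> and the
  weights cleared. Dividing by powers of \<open>b\<close> avoids truncated exponents, hence \<open>b \<noteq> 0\<close>.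
\<close>

lemma meixner_poly_equation:
  fixes b :: complex
  assumes "\<alpha> \<ge> 0" "b \<noteq> 0"
  shows "of_real (1 + \<alpha> + real (n + m)) * meixner_poly \<alpha> n m b + (1 - b) * meixner_dpoly \<alpha> n m b =
    of_nat n * (1 - b)\<^sup>2 * meixner_poly \<alpha> (n - 1) m b
    + of_real (2 * real n + 1 + \<alpha>) * (1 - b) * meixner_poly \<alpha> n m b
    + of_real (real n + 1 + \<alpha>) * meixner_poly \<alpha> (Suc n) m b"
proof -
  define x where "x = 1 / b\<^sup>2"
  define R where "R k = (\<Sum>j\<le>m. of_real (meixner_coeff \<alpha> k m j) * x ^ j)" for k
  \<comment> \<open>X is x times the derivative of R n with respect to x. The b-derivative and both
    shifts of n are expressed through R n and X alone, which reduces the equation to algebra with x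
    b^2 = 1.\<close>
  define X where "X = (\<Sum>j\<le>m. of_nat j * (of_real (meixner_coeff \<alpha> n m j) * x ^ j))"
  define a where "a = (of_real \<alpha> :: complex)"
  have S: "meixner_poly \<alpha> k m b = b ^ (k + m) * R k" for k
    unfolding R_def x_def by (rule meixner_poly_nonzero[OF assms(2)])
  have dS: "b * meixner_dpoly \<alpha> n m b = b ^ (n + m) * (of_nat (n + m) * R n - 2 * X)"
  proof -
    have "b * meixner_dpoly \<alpha> n m b = (\<Sum>j\<le>m. b ^ (n + m) *
        (of_nat (n + m) * (of_real (meixner_coeff \<alpha> n m j) * x ^ j) - 2 * (of_nat j * (of_real (meixner_coeff \<alpha> n m j) * x ^ j))))"
      unfolding meixner_dpoly_def sum_distrib_left
    proof (intro sum.cong refl)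
      fix j assume "j \<in> {..m}"
      show "b * (of_real (meixner_coeff \<alpha> n m j) * (of_nat (n + m - 2 * j) * b ^ (n + m - 2 * j - 1))) =
        b ^ (n + m) * (of_nat (n + m) * (of_real (meixner_coeff \<alpha> n m j) * x ^ j) - 2 * (of_nat j * (of_real (meixner_coeff \<alpha> n m j) * x ^ j)))"
      proof (cases "j \<le> n")
        case True
        then obtain l where l: "n + m = l + 2 * j" using \<open>j \<in> {..m}\<close>
          by (metis add.commute add_mono atMost_iff le_Suc_ex mult_2)
        have "b * (of_nat l * b ^ (l - 1)) = of_nat l * b ^ l" by (cases l) auto
        moreover have "b ^ (n + m) * x ^ j = b ^ l"
          using assms(2) by (simp add: l x_def power_add power_mult power_divide)
        moreover have "(of_nat (n + m) :: complex) - 2 * of_nat j = of_nat l" by (simp add: l)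
        moreover have "b * (c * (of_nat l * b ^ (l - 1))) = c * (b * (of_nat l * b ^ (l - 1)))" for c
          by (simp add: mult_ac)
        moreover have "b ^ (n + m) * (of_nat (n + m) * (c * x ^ j) - 2 * (of_nat j * (c * x ^ j))) =
            c * ((of_nat (n + m) - 2 * of_nat j) * (b ^ (n + m) * x ^ j))" for c
          by (simp add: algebra_simps)
        ultimately show ?thesis by (simp add: l)
      qed (simp add: meixner_coeff_eq_0)
    qed
    then show ?thesis
      by (simp add: R_def X_def sum_distrib_left sum_subtractf algebra_simps)
  qed
  have pred: "of_nat n * R (n - 1) = of_nat n * R n - X"
  proof -
    have "of_nat n * R (n - 1) = (\<Sum>j\<le>m. of_real (real n * meixner_coeff \<alpha> (n - 1) m j) * x ^ j)"
      by (simp add: R_def sum_distrib_left mult_ac)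
    also have "\<dots> = of_nat n * R n - X"
      unfolding meixner_coeff_pred by (simp add: R_def X_def sum_distrib_left sum_subtractf algebra_simps)
    finally show ?thesis .
  qed
  have succ: "(of_nat n + 1 + a) * R (Suc n) = (of_nat n + 1 + a) * R n + X + x * (of_nat m * R n - X)"
  proof -
    define h where "h j = (of_nat m - of_nat j) * (of_real (meixner_coeff \<alpha> n m j) * x ^ Suc j)" for j
    define g where "g j = (of_nat n + 1 + a + of_nat j) * (of_real (meixner_coeff \<alpha> n m j) * x ^ j)" for j
    define f where "f j = (of_nat n + 1 + a) * (of_real (meixner_coeff \<alpha> (Suc n) m j) * x ^ j)" for j
    have f0: "f 0 = g 0" by (simp add: f_def g_def)
    have fS: "f (Suc j) = g (Suc j) + h j" for j
    proof -
      have "f (Suc j) = of_real ((real n + 1 + \<alpha>) * meixner_coeff \<alpha> (Suc n) m (Suc j)) * x ^ Suc j"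
        by (simp add: f_def a_def)
      also have "\<dots> = g (Suc j) + h j"
        unfolding meixner_coeff_recurrence[OF assms(1)]
        by (simp add: g_def h_def a_def algebra_simps)
      finally show ?thesis .
    qed
    have "(\<Sum>j\<le>m. f j) = (\<Sum>j\<le>m. g j) + (\<Sum>j<m. h j)"
    proof (cases m)
      case (Suc k)
      have "(\<Sum>j\<le>m. f j) = f 0 + (\<Sum>j\<le>k. f (Suc j))" by (simp only: Suc sum.atMost_Suc_shift)
      also have "\<dots> = (g 0 + (\<Sum>j\<le>k. g (Suc j))) + (\<Sum>j\<le>k. h j)"
        by (simp add: f0 fS sum.distrib)
      also have "g 0 + (\<Sum>j\<le>k. g (Suc j)) = (\<Sum>j\<le>m. g j)" by (simp only: Suc sum.atMost_Suc_shift)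
      finally show ?thesis by (simp add: Suc lessThan_Suc_atMost)
    qed (simp add: f0)
    \<comment> \<open>The added term \<open>h m\<close> carries the factor m - m.\<close>
    also have "(\<Sum>j<m. h j) = (\<Sum>j\<le>m. h j)"
      by (simp add: h_def lessThan_Suc_atMost[symmetric])
    also have "(\<Sum>j\<le>m. f j) = (of_nat n + 1 + a) * R (Suc n)"
      by (simp only: f_def R_def sum_distrib_left)
    also have "(\<Sum>j\<le>m. g j) = (of_nat n + 1 + a) * R n + X"
      unfolding g_def R_def X_def sum_distrib_left sum.distrib[symmetric] by (simp only: distrib_right)
    also have "(\<Sum>j\<le>m. h j) = x * (of_nat m * R n - X)"
      unfolding h_def R_def X_def
      by (simp add: sum_distrib_left sum_subtractf algebra_simps)
    finally show ?thesis .
  qed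
  have xb: "x * b\<^sup>2 = 1" using assms(2) by (simp add: x_def)
  have pw: "of_nat n * (1 - b)\<^sup>2 * (b * meixner_poly \<alpha> (n - 1) m b) = (1 - b)\<^sup>2 * (b ^ (n + m) * (of_nat n * R (n - 1)))"
    by (cases n) (simp_all add: S mult_ac)
  have sw: "(of_nat n + 1 + a) * (b * meixner_poly \<alpha> (Suc n) m b) = b ^ (n + m) * (b\<^sup>2 * ((of_nat n + 1 + a) * R (Suc n)))"
    by (simp add: S power2_eq_square mult_ac)
  have "b * ((of_nat (n + m) + 1 + a) * meixner_poly \<alpha> n m b) + (1 - b) * (b * meixner_dpoly \<alpha> n m b) =
     of_nat n * (1 - b)\<^sup>2 * (b * meixner_poly \<alpha> (n - 1) m b)
    + (2 * of_nat n + 1 + a) * (1 - b) * (b * meixner_poly \<alpha> n m b)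
    + (of_nat n + 1 + a) * (b * meixner_poly \<alpha> (Suc n) m b)"
    unfolding pw sw dS unfolding pred succ unfolding S
  proof -
    define P where "P = b ^ (n + m)"
    define r where "r = R n"
    define N where "N = (of_nat n :: complex)"
    define M where "M = (of_nat m :: complex)"
    have "b * ((N + M + 1 + a) * r) + (1 - b) * ((N + M) * r - 2 * X) =
      (1 - b)\<^sup>2 * (N * r - X) + (2 * N + 1 + a) * (1 - b) * (b * r) +
      (b\<^sup>2 * ((N + 1 + a) * r + X) + (x * b\<^sup>2) * (M * r - X))"
      unfolding xb by (simp add: power2_eq_square algebra_simps)
    then have "P * (b * ((N + M + 1 + a) * r) + (1 - b) * ((N + M) * r - 2 * X)) =
      P * ((1 - b)\<^sup>2 * (N * r - X) + (2 * N + 1 + a) * (1 - b) * (b * r) +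
      (b\<^sup>2 * ((N + 1 + a) * r + X) + (x * b\<^sup>2) * (M * r - X)))"
      by (simp only:)
    then show "b * ((of_nat (n + m) + 1 + a) * (b ^ (n + m) * R n)) + (1 - b) * (b ^ (n + m) * (of_nat (n + m) * R n - 2 * X)) =
      (1 - b)\<^sup>2 * (b ^ (n + m) * (of_nat n * R n - X)) + (2 * of_nat n + 1 + a) * (1 - b) * (b * (b ^ (n + m) * R n)) +
      b ^ (n + m) * (b\<^sup>2 * ((of_nat n + 1 + a) * R n + X + x * (of_nat m * R n - X)))"
      unfolding P_def[symmetric] r_def[symmetric] of_nat_add N_def[symmetric] M_def[symmetric]
      by (simp only: distrib_left mult_ac add_ac)
  qed
  then have "b * ((of_nat (n + m) + 1 + a) * meixner_poly \<alpha> n m b + (1 - b) * meixner_dpoly \<alpha> n m b) =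
     b * (of_nat n * (1 - b)\<^sup>2 * meixner_poly \<alpha> (n - 1) m b
    + (2 * of_nat n + 1 + a) * (1 - b) * meixner_poly \<alpha> n m b
    + (of_nat n + 1 + a) * meixner_poly \<alpha> (Suc n) m b)"
    by (simp only: distrib_left mult.left_commute[of b])
  then show ?thesis
    using assms(2) by (simp add: a_def add_ac)
qed

lemma laguerre_op_kernel:
  assumes "\<alpha> \<ge> 0"
  shows "laguerre_op \<alpha> (\<lambda>k. laguerre_kernel \<alpha> k m t) n =
    of_real (laguerre_weight \<alpha> n * laguerre_weight \<alpha> m) *
      ((1 + \<i> * t) powr (- of_real (1 + \<alpha>)) / (1 + \<i> * t) ^ Suc (n + m) *
       (of_nat n * (1 + \<i> * t)\<^sup>2 * meixner_poly \<alpha> (n - 1) m (- (\<i> * t))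
        + of_real (2 * real n + 1 + \<alpha>) * (1 + \<i> * t) * meixner_poly \<alpha> n m (- (\<i> * t))
        + of_real (real n + 1 + \<alpha>) * meixner_poly \<alpha> (Suc n) m (- (\<i> * t))))"
proof -
  define a where "a = 1 + \<i> * complex_of_real t"
  define p where "p = a powr (- of_real (1 + \<alpha>))"
  define w where "w = laguerre_weight \<alpha>"
  define S where "S k = meixner_poly \<alpha> k m (- (\<i> * t))" for k
  have "Re a = 1" by (simp add: a_def)
  then have a0: "a \<noteq> 0" by auto
  have K: "laguerre_kernel \<alpha> k m t = of_real (w k) * (of_real (w m) * (p * S k / a ^ (k + m)))" for k
    by (simp add: laguerre_kernel_def a_def p_def w_def S_def)
  have t1: "complex_of_real (sqrt (real n * (real n + \<alpha>))) * (if n = 0 then 0 else laguerre_kernel \<alpha> (n - 1) m t) =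
     of_real (w n * w m) * (p / a ^ Suc (n + m) * (of_nat n * a\<^sup>2 * S (n - 1)))"
  proof (cases n)
    case (Suc k)
    have "sqrt (real n * (real n + \<alpha>)) * w k = real n * w n"
      using laguerre_weight_Suc(2)[OF assms, of k] by (simp add: Suc w_def add_ac)
    then have "complex_of_real (sqrt (real n * (real n + \<alpha>))) * of_real (w k) = of_real (real n * w n)"
      by (metis of_real_mult)
    then have "complex_of_real (sqrt (real n * (real n + \<alpha>))) * laguerre_kernel \<alpha> k m t =
       of_real (real n * w n) * (of_real (w m) * (p * S k / a ^ (k + m)))"
      unfolding K by (simp only: mult.assoc[symmetric])
    also have "p * S k / a ^ (k + m) = p / a ^ Suc (n + m) * (a\<^sup>2 * S k)"
      using a0 by (simp add: Suc power2_eq_square field_simps)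
    finally show ?thesis by (simp add: Suc mult_ac)
  qed simp
  have t2: "complex_of_real (2 * real n + 1 + \<alpha>) * laguerre_kernel \<alpha> n m t =
     of_real (w n * w m) * (p / a ^ Suc (n + m) * (of_real (2 * real n + 1 + \<alpha>) * a * S n))"
  proof -
    have e: "p * S n / a ^ (n + m) = p / a ^ Suc (n + m) * (a * S n)"
      using a0 by simp
    show ?thesis unfolding K e by (simp only: of_real_mult mult_ac)
  qed
  have t3: "complex_of_real (sqrt ((real n + 1) * (real n + 1 + \<alpha>))) * laguerre_kernel \<alpha> (n + 1) m t =
     of_real (w n * w m) * (p / a ^ Suc (n + m) * (of_real (real n + 1 + \<alpha>) * S (Suc n)))"
  proof -
    have "complex_of_real (sqrt ((real n + 1) * (real n + 1 + \<alpha>))) * of_real (w (Suc n)) = of_real ((real n + 1 + \<alpha>) * w n)"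
      using laguerre_weight_Suc(1)[OF assms, of n] unfolding w_def by (metis of_real_mult)
    then have "complex_of_real (sqrt ((real n + 1) * (real n + 1 + \<alpha>))) * laguerre_kernel \<alpha> (Suc n) m t =
       of_real ((real n + 1 + \<alpha>) * w n) * (of_real (w m) * (p * S (Suc n) / a ^ (Suc n + m)))"
      unfolding K by (simp only: mult.assoc[symmetric])
    then show ?thesis by (simp add: mult_ac)
  qed
  show ?thesis
    unfolding laguerre_op_def t1 t2 t3
    unfolding a_def[symmetric] p_def[symmetric] S_def[symmetric] w_def[symmetric]
    by (simp only: distrib_left)
qed

text \<open>The kernel is a function G, complex differentiable at b = -it, composed with the line t
  -> -it, whose velocity supplies the factor -i. The exclusion of t = 0 comes from b \<noteq> 0 in
  \<open>meixner_poly_equation\<close>.\<close>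

lemma laguerre_kernel_has_derivative:
  assumes "\<alpha> \<ge> 0" "t \<noteq> 0"
  shows "((\<lambda>t. laguerre_kernel \<alpha> n m t) has_vector_derivative
     - \<i> * laguerre_op \<alpha> (\<lambda>k. laguerre_kernel \<alpha> k m t) n) (at t)"
proof -
  define \<nu> where "\<nu> = complex_of_real (1 + \<alpha>)"
  define G where "G b = (1 - b) powr (- \<nu>) * meixner_poly \<alpha> n m b / (1 - b) ^ (n + m)" for b
  define b where "b = - (\<i> * complex_of_real t)"
  define S where "S = meixner_poly \<alpha> n m b"
  define S' where "S' = meixner_dpoly \<alpha> n m b"
  define p where "p = (1 - b) powr (- \<nu>)"
  have re: "Re (1 - b) = 1" by (simp add: b_def)
  then have b0: "1 - b \<noteq> 0" by force
  have nonpos: "1 - b \<notin> \<real>\<^sub>\<le>\<^sub>0" using re by (auto simp: complex_nonpos_Reals_iff)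
  have lin: "((\<lambda>b. 1 - b) has_field_derivative -1) (at b)"
    by (auto intro!: derivative_eq_intros)
  have "((\<lambda>z. z powr (- \<nu>)) has_field_derivative - \<nu> * (1 - b) powr (- \<nu> - 1)) (at (1 - b))"
    by (rule has_field_derivative_powr[OF nonpos])
  from DERIV_chain2[OF this lin]
  have dp: "((\<lambda>b. (1 - b) powr (- \<nu>)) has_field_derivative \<nu> * p / (1 - b)) (at b)"
    using b0 by (simp add: powr_diff p_def)
  have "((\<lambda>z. z ^ (n + m)) has_field_derivative of_nat (n + m) * (1 - b) ^ (n + m - 1)) (at (1 - b))"
    using DERIV_power[OF DERIV_ident, where n = "n + m"] by simp
  from DERIV_chain2[OF this lin]
  have da: "((\<lambda>b. (1 - b) ^ (n + m)) has_field_derivative of_nat (n + m) * (1 - b) ^ (n + m - 1) * -1) (at b)" .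
  have "(G has_field_derivative (((\<nu> * p / (1 - b)) * S + S' * p) * (1 - b) ^ (n + m)
      - (p * S) * (of_nat (n + m) * (1 - b) ^ (n + m - 1) * -1)) / ((1 - b) ^ (n + m) * (1 - b) ^ (n + m))) (at b)"
    unfolding G_def[abs_def] p_def S_def S'_def
    by (rule DERIV_divide[OF DERIV_mult[OF dp[unfolded p_def] meixner_poly_has_derivative] da]) (use b0 in simp)
  moreover have "(((\<nu> * p / (1 - b)) * S + S' * p) * (1 - b) ^ (n + m)
      - (p * S) * (of_nat (n + m) * (1 - b) ^ (n + m - 1) * -1)) / ((1 - b) ^ (n + m) * (1 - b) ^ (n + m))
    = p / (1 - b) ^ Suc (n + m) * ((\<nu> + of_nat (n + m)) * S + (1 - b) * S')"
  proof -
    have "of_nat N * c ^ (N - 1) = of_nat N * c ^ N / c" if "c \<noteq> 0" for c :: complex and N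
      using that by (cases N) auto
    note e = this[OF b0]
    have "((\<nu> * p / c * S + S' * p) * A - (p * S) * (M * A / c * -1)) / (A * A) =
       p / (c * A) * ((\<nu> + M) * S + c * S')" if "c \<noteq> 0" "A \<noteq> 0" for c A M :: complex
      using that by (simp add: field_simps)
    from this[of "1 - b" "(1 - b) ^ (n + m)" "of_nat (n + m)"] show ?thesis
      unfolding e using b0 by simp
  qed
  moreover have "(\<nu> + of_nat (n + m)) * S + (1 - b) * S' = of_nat n * (1 - b)\<^sup>2 * meixner_poly \<alpha> (n - 1) m b
    + of_real (2 * real n + 1 + \<alpha>) * (1 - b) * meixner_poly \<alpha> n m b
    + of_real (real n + 1 + \<alpha>) * meixner_poly \<alpha> (Suc n) m b"
  proof -
    have "\<nu> + of_nat (n + m) = of_real (1 + \<alpha> + real (n + m))" by (simp add: \<nu>_def)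
    then show ?thesis
      using meixner_poly_equation[OF assms(1), of b n m] assms(2) by (simp only: S_def S'_def b_def) simp
  qed
  ultimately have G': "(G has_field_derivative p / (1 - b) ^ Suc (n + m) *
    (of_nat n * (1 - b)\<^sup>2 * meixner_poly \<alpha> (n - 1) m b
    + of_real (2 * real n + 1 + \<alpha>) * (1 - b) * meixner_poly \<alpha> n m b
    + of_real (real n + 1 + \<alpha>) * meixner_poly \<alpha> (Suc n) m b)) (at b)" (is "(_ has_field_derivative ?G') _")
    by (simp only:)
  have lin2: "((\<lambda>t. - (\<i> * complex_of_real t)) has_vector_derivative - \<i>) (at t)"
    by (auto intro!: derivative_eq_intros)
  have "((G \<circ> (\<lambda>t. - (\<i> * complex_of_real t))) has_vector_derivative - \<i> * ?G') (at t)"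
    by (rule field_vector_diff_chain_at[OF lin2]) (use G' in \<open>simp only: b_def\<close>)
  from has_vector_derivative_mult_right[OF this, of "of_real (laguerre_weight \<alpha> n * laguerre_weight \<alpha> m)"]
  have "((\<lambda>t. laguerre_kernel \<alpha> n m t) has_vector_derivative
     of_real (laguerre_weight \<alpha> n * laguerre_weight \<alpha> m) * (- \<i> * ?G')) (at t)"
    by (simp add: laguerre_kernel_def G_def comp_def \<nu>_def)
  moreover have "of_real (laguerre_weight \<alpha> n * laguerre_weight \<alpha> m) * (- \<i> * ?G') =
     - \<i> * laguerre_op \<alpha> (\<lambda>k. laguerre_kernel \<alpha> k m t) n"
  proof -
    have c: "1 + \<i> * t = 1 - b" by (simp add: b_def)
    show ?thesis
      unfolding laguerre_op_kernel[OF assms(1)] p_def \<nu>_def b_def[symmetric] c by (simp add: mult_ac)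
  qed
  ultimately show ?thesis by simp
qed

subsection \<open>Unitary groups on the sequence space\<close>

lemma lp_norm_2:
  "lp_norm 2 u = (if summable (\<lambda>n. (cmod (u n))\<^sup>2) then ennreal (sqrt (\<Sum>n. (cmod (u n))\<^sup>2)) else \<infinity>)"
proof -
  have "cmod (u n) powr 2 = (cmod (u n))\<^sup>2" for n
    by (cases "u n = 0") auto
  moreover have "(\<Sum>n. (cmod (u n))\<^sup>2) powr (1 / 2) = sqrt (\<Sum>n. (cmod (u n))\<^sup>2)" if "summable (\<lambda>n. (cmod (u n))\<^sup>2)"
    using suminf_nonneg[OF that] by (intro powr_half_sqrt) auto
  ultimately show ?thesis
    unfolding lp_norm_def by simp
qed

lemma lp_space_2: "u \<in> lp_space 2 \<longleftrightarrow> summable (\<lambda>n. (cmod (u n))\<^sup>2)"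
  by (simp add: lp_space_def lp_norm_2)

lemma norm_le_lp_norm_2: "ennreal (cmod (u n)) \<le> lp_norm 2 u"
proof (cases "summable (\<lambda>n. (cmod (u n))\<^sup>2)")
  case True
  have "(\<Sum>k\<in>{n}. (cmod (u k))\<^sup>2) \<le> (\<Sum>k. (cmod (u k))\<^sup>2)"
    by (rule sum_le_suminf[OF True]) auto
  then have "sqrt ((cmod (u n))\<^sup>2) \<le> sqrt (\<Sum>k. (cmod (u k))\<^sup>2)"
    by (intro real_sqrt_le_mono) simp
  then have "cmod (u n) \<le> sqrt (\<Sum>k. (cmod (u k))\<^sup>2)"
    by simp
  then show ?thesis using True by (simp add: lp_norm_2 ennreal_leI)
qed (simp add: lp_norm_2)

lemma finite_support_lp_space_2:
  assumes "finite {n. u n \<noteq> 0}"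
  shows "u \<in> lp_space 2"
  unfolding lp_space_2 by (rule summable_finite[OF assms]) simp

definition unit_seq :: "nat \<Rightarrow> nat \<Rightarrow> complex" where
  "unit_seq m n = (if n = m then 1 else 0)"

lemma unit_seq_lp_space_2: "unit_seq m \<in> lp_space 2"
proof (rule finite_support_lp_space_2)
  have "{n. unit_seq m n \<noteq> 0} = {m}" by (auto simp: unit_seq_def)
  then show "finite {n. unit_seq m n \<noteq> 0}" by simp
qed

lemma lp_norm_2_unit_seq: "lp_norm 2 (unit_seq m) = 1"
proof -
  have "(\<lambda>n. (cmod (unit_seq m n))\<^sup>2) sums (\<Sum>n\<in>{m}. (cmod (unit_seq m n))\<^sup>2)"
    by (rule sums_finite) (auto simp: unit_seq_def)
  then have "(\<lambda>n. (cmod (unit_seq m n))\<^sup>2) sums 1" by (simp add: unit_seq_def)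
  then show ?thesis
    by (simp add: lp_norm_2 sums_iff)
qed

lemma unit_seq_laguerre_dom: "unit_seq m \<in> laguerre_dom \<alpha>"
  unfolding laguerre_dom_def
proof (intro CollectI conjI unit_seq_lp_space_2 finite_support_lp_space_2)
  have "{n. laguerre_op \<alpha> (unit_seq m) n \<noteq> 0} \<subseteq> {..m + 1}"
    by (auto simp: laguerre_op_def unit_seq_def split: if_splits)
  then show "finite {n. laguerre_op \<alpha> (unit_seq m) n \<noteq> 0}"
    by (rule finite_subset) simp
qed

lemma lp_space_2_scale:
  assumes "u \<in> lp_space 2"
  shows "(\<lambda>n. c * u n) \<in> lp_space 2"
  using assms unfolding lp_space_2 by (simp add: norm_mult power_mult_distrib summable_mult)

lemma lp_space_2_add:
  assumes "u \<in> lp_space 2" "v \<in> lp_space 2"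
  shows "(\<lambda>n. u n + v n) \<in> lp_space 2"
  unfolding lp_space_2
proof (rule summable_comparison_test')
  show "summable (\<lambda>n. 2 * (cmod (u n))\<^sup>2 + 2 * (cmod (v n))\<^sup>2)"
    using assms unfolding lp_space_2 by (intro summable_add summable_mult)
  fix n :: nat
  have "(cmod (u n + v n))\<^sup>2 \<le> (cmod (u n) + cmod (v n))\<^sup>2"
    by (intro power_mono norm_triangle_ineq) auto
  also have "\<dots> \<le> 2 * (cmod (u n))\<^sup>2 + 2 * (cmod (v n))\<^sup>2"
    using sum_squares_bound[of "cmod (u n)" "cmod (v n)"] by (simp add: power2_sum)
  finally show "norm ((cmod (u n + v n))\<^sup>2) \<le> 2 * (cmod (u n))\<^sup>2 + 2 * (cmod (v n))\<^sup>2"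
    by simp
qed

context
  fixes A :: "(nat \<Rightarrow> complex) \<Rightarrow> nat \<Rightarrow> complex"
  assumes A: "unitary_l2 A"
begin

lemma unitary_l2_linear:
  assumes "u \<in> lp_space 2" "v \<in> lp_space 2"
  shows "A (\<lambda>n. a * u n + b * v n) = (\<lambda>n. a * A u n + b * A v n)"
  using A assms unfolding unitary_l2_def by blast

lemma unitary_l2_closed: "u \<in> lp_space 2 \<Longrightarrow> A u \<in> lp_space 2"
  using A unfolding unitary_l2_def by (blast dest: bij_betw_apply)

lemma unitary_l2_isometry: "u \<in> lp_space 2 \<Longrightarrow> lp_norm 2 (A u) = lp_norm 2 u"
  using A unfolding unitary_l2_def by blast

lemma unitary_l2_sum:
  "A (\<lambda>n. \<Sum>m<L. u m * unit_seq m n) = (\<lambda>n. \<Sum>m<L. u m * A (unit_seq m) n)"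
  and sum_unit_seq_lp_space_2: "(\<lambda>n. \<Sum>m<L. u m * unit_seq m n) \<in> lp_space 2"
proof (induction L)
  case 0
  show "(\<lambda>n. \<Sum>m<0. u m * unit_seq m n) \<in> lp_space 2" by (simp add: lp_space_2)
  have "A (\<lambda>n. 0 * unit_seq 0 n + 0 * unit_seq 0 n) = (\<lambda>n. 0 * A (unit_seq 0) n + 0 * A (unit_seq 0) n)"
    by (rule unitary_l2_linear[OF unit_seq_lp_space_2 unit_seq_lp_space_2])
  then show "A (\<lambda>n. \<Sum>m<0. u m * unit_seq m n) = (\<lambda>n. \<Sum>m<0. u m * A (unit_seq m) n)" by simp
next
  case (Suc L)
  show "(\<lambda>n. \<Sum>m<Suc L. u m * unit_seq m n) \<in> lp_space 2"
    using lp_space_2_add[OF Suc.IH(2) lp_space_2_scale[OF unit_seq_lp_space_2, of "u L" L]] by simp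
  have "A (\<lambda>n. 1 * (\<Sum>m<L. u m * unit_seq m n) + u L * unit_seq L n) =
     (\<lambda>n. 1 * A (\<lambda>n. \<Sum>m<L. u m * unit_seq m n) n + u L * A (unit_seq L) n)"
    by (rule unitary_l2_linear[OF Suc.IH(2) unit_seq_lp_space_2])
  then show "A (\<lambda>n. \<Sum>m<Suc L. u m * unit_seq m n) = (\<lambda>n. \<Sum>m<Suc L. u m * A (unit_seq m) n)"
    unfolding Suc.IH(1) by simp
qed

end

text \<open>\<open>U t\<close> is isometric and commutes with \<open>U h\<close>, so the difference
  quotient at \<open>U t u\<close> is the image of the one at u and converges in the norm as well.
  Each coordinate is dominated by that norm.\<close>

lemma unitary_group_of_has_derivative:
  assumes U: "unitary_group_of D H U" and D: "D \<subseteq> lp_space 2" "\<And>u. u \<in> D \<Longrightarrow> H u \<in> lp_space 2"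
    and u: "u \<in> D"
  shows "((\<lambda>t. U t u n) has_vector_derivative - \<i> * H (U t u) n) (at t)"
proof -
  have grp: "unitary_l2 (U t)" "\<And>v s t. v \<in> lp_space 2 \<Longrightarrow> U (s + t) v = U s (U t v)" for t
    using U unfolding unitary_group_of_def unitary_group_def by blast+
  have gen: "((\<lambda>t. lp_norm 2 (\<lambda>n. (U t u n - u n) / complex_of_real t - v n)) \<longlongrightarrow> 0) (at 0) \<longleftrightarrow>
       u \<in> D \<and> v = (\<lambda>n. - \<i> * H u n)" if "u \<in> lp_space 2" "v \<in> lp_space 2" for u v
  proof -
    from U have "\<forall>u\<in>lp_space 2. \<forall>v\<in>lp_space 2.
       ((\<lambda>t. lp_norm 2 (\<lambda>n. (U t u n - u n) / complex_of_real t - v n)) \<longlongrightarrow> 0) (at 0) \<longleftrightarrow>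
       u \<in> D \<and> v = (\<lambda>n. - \<i> * H u n)"
      unfolding unitary_group_of_def by (rule conjunct2)
    from bspec[OF bspec[OF this that(1)] that(2)] show ?thesis .
  qed
  define v where "v = (\<lambda>n. - \<i> * H u n)"
  have u2: "u \<in> lp_space 2" using u D by blast
  have v2: "v \<in> lp_space 2" unfolding v_def by (rule lp_space_2_scale[OF D(2)[OF u]])
  have Uu2: "U s u \<in> lp_space 2" for s by (rule unitary_l2_closed[OF grp(1) u2])
  have Uv2: "U s v \<in> lp_space 2" for s by (rule unitary_l2_closed[OF grp(1) v2])
  define f where "f h = (\<lambda>n. (U h u n - u n) / complex_of_real h - v n)" for h
  have lim: "((\<lambda>h. lp_norm 2 (f h)) \<longlongrightarrow> 0) (at 0)"
    using gen[OF u2 v2] u by (simp add: f_def v_def)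
  have shift: "(\<lambda>n. (U h (U t u) n - U t u n) / complex_of_real h - U t v n) = U t (f h)"
    and f2: "f h \<in> lp_space 2" for h
  proof -
    define c where "c = 1 / complex_of_real h"
    define g where "g = (\<lambda>n. c * U h u n + - c * u n)"
    have g2: "g \<in> lp_space 2"
      unfolding g_def by (rule lp_space_2_add[OF lp_space_2_scale[OF Uu2] lp_space_2_scale[OF u2]])
    have f: "f h = (\<lambda>n. 1 * g n + - 1 * v n)"
      by (rule ext) (simp add: f_def g_def c_def diff_divide_distrib)
    show "f h \<in> lp_space 2"
      unfolding f by (rule lp_space_2_add[OF lp_space_2_scale[OF g2] lp_space_2_scale[OF v2]])
    have "U t (f h) = (\<lambda>n. 1 * U t g n + - 1 * U t v n)"
      unfolding f by (rule unitary_l2_linear[OF grp(1) g2 v2])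
    also have "U t g = (\<lambda>n. c * U t (U h u) n + - c * U t u n)"
      unfolding g_def by (rule unitary_l2_linear[OF grp(1) Uu2 u2])
    also have "U t (U h u) = U h (U t u)"
      using grp(2)[OF u2, of t h] grp(2)[OF u2, of h t] by (simp add: add.commute)
    finally show "(\<lambda>n. (U h (U t u) n - U t u n) / complex_of_real h - U t v n) = U t (f h)"
      by (simp add: c_def diff_divide_distrib)
  qed
  have lim2: "((\<lambda>h. lp_norm 2 (\<lambda>n. (U h (U t u) n - U t u n) / complex_of_real h - U t v n)) \<longlongrightarrow> 0) (at 0)"
    unfolding shift unitary_l2_isometry[OF grp(1) f2] by (rule lim)
  \<comment> \<open>Here the equivalence in \<open>unitary_group_of\<close> is read from left to
    right: convergence of the quotient identifies its limit through H.\<close>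
  with gen[OF Uu2 Uv2] have Utv: "U t v = (\<lambda>n. - \<i> * H (U t u) n)" by blast
  have "((\<lambda>h. ennreal (cmod ((U h (U t u) n - U t u n) / complex_of_real h - U t v n))) \<longlongrightarrow> 0) (at 0)"
    by (rule tendsto_sandwich[OF _ _ tendsto_const lim2])
       (auto intro!: always_eventually norm_le_lp_norm_2[where u = "\<lambda>n. (U _ (U t u) n - U t u n) / complex_of_real _ - U t v n"])
  then have lim3: "((\<lambda>h. cmod ((U h (U t u) n - U t u n) / complex_of_real h - U t v n)) \<longlongrightarrow> 0) (at 0)"
    by (intro tendsto_ennrealD) (auto simp: ennreal_0)
  have quotient: "cmod ((U h (U t u) n - U t u n) / complex_of_real h - U t v n) =
      norm (U (t + h) u n - U t u n - h *\<^sub>R U t v n) / norm h" if "h \<noteq> 0" for h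
  proof -
    have "U h (U t u) n = U (t + h) u n"
      using grp(2)[OF u2, of h t] by (simp add: add.commute)
    then have "(U h (U t u) n - U t u n) / complex_of_real h - U t v n =
       (U (t + h) u n - U t u n - h *\<^sub>R U t v n) / complex_of_real h"
      using that by (simp add: diff_divide_distrib scaleR_conv_of_real)
    then show ?thesis by (simp add: norm_divide)
  qed
  have "((\<lambda>h. norm (U (t + h) u n - U t u n - h *\<^sub>R U t v n) / norm h) \<longlongrightarrow> 0) (at 0)"
    by (rule Lim_transform_eventually[OF lim3]) (auto simp: eventually_at_filter quotient)
  then have "((\<lambda>t. U t u n) has_vector_derivative U t v n) (at t)"
    unfolding has_vector_derivative_def has_derivative_at
    by (simp add: bounded_linear_scaleR_left)
  then show ?thesis unfolding Utv .
qed

subsection \<open>Identification of the kernel\<close>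

lemma norm_one_plus_ii_times: "cmod (1 + \<i> * complex_of_real t) = sqrt (1 + t\<^sup>2)"
  by (simp add: cmod_def)

lemma norm_laguerre_kernel:
  assumes "\<alpha> \<ge> 0"
  shows "cmod (laguerre_kernel \<alpha> n m t) = laguerre_weight \<alpha> n * laguerre_weight \<alpha> m *
    (sqrt (1 + t\<^sup>2) powr (- (1 + \<alpha>)) * (cmod (meixner_poly \<alpha> n m (- (\<i> * t))) / sqrt (1 + t\<^sup>2) ^ (n + m)))"
proof -
  define a where "a = 1 + \<i> * complex_of_real t"
  have "Re a = 1" by (simp add: a_def)
  then have a0: "a \<noteq> 0" by auto
  have na: "cmod a = sqrt (1 + t\<^sup>2)" unfolding a_def by (rule norm_one_plus_ii_times)
  have "a powr (- of_real (1 + \<alpha>)) = exp (complex_of_real (- (1 + \<alpha>)) * Ln a)"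
    using a0 by (simp add: powr_def)
  then have "cmod (a powr (- of_real (1 + \<alpha>))) = exp (- (1 + \<alpha>) * ln (cmod a))"
    using a0 by (simp only: norm_exp_eq_Re) simp
  also have "\<dots> = cmod a powr (- (1 + \<alpha>))"
    using a0 by (simp add: powr_def)
  finally have "cmod (a powr (- of_real (1 + \<alpha>))) = cmod a powr (- (1 + \<alpha>))" .
  then show ?thesis
    using laguerre_weight_pos[OF assms, of n] laguerre_weight_pos[OF assms, of m]
    unfolding laguerre_kernel_def a_def[symmetric] na[symmetric]
    by (simp only: norm_mult norm_divide norm_power norm_of_real abs_mult abs_of_pos) simp
qed

lemma meixner_coeff_nonneg: "\<alpha> \<ge> 0 \<Longrightarrow> meixner_coeff \<alpha> n m j \<ge> 0"
  using pochhammer_pos_nonneg[of \<alpha> j] by (simp add: meixner_coeff_def)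

lemma meixner_coeff_le:
  assumes "\<alpha> \<ge> 0" "j \<le> m" "m \<le> n"
  shows "meixner_coeff \<alpha> n m j \<le> (real n + 1) ^ m * 2 ^ m"
proof -
  have "fact j \<le> pochhammer (1 + \<alpha>) j"
  proof (induction j)
    case (Suc j)
    have "fact (Suc j) = fact j * (1 + real j)" by simp
    also have "\<dots> \<le> pochhammer (1 + \<alpha>) j * (1 + \<alpha> + real j)"
      using Suc assms(1) pochhammer_pos_nonneg[OF assms(1), of j] by (intro mult_mono) auto
    finally show ?case by (simp add: pochhammer_Suc)
  qed simp
  then have 1: "fact j / pochhammer (1 + \<alpha>) j \<le> 1"
    using pochhammer_pos_nonneg[OF assms(1), of j] by simp
  have "real (n choose j) \<le> real (n ^ j)"
    using assms by (intro of_nat_mono binomial_le_pow) auto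
  also have "\<dots> \<le> (real n + 1) ^ j" by (simp add: power_mono)
  also have "\<dots> \<le> (real n + 1) ^ m" by (rule power_increasing[OF assms(2)]) simp
  finally have 2: "real (n choose j) \<le> (real n + 1) ^ m" .
  have "real (m choose j) \<le> real (2 ^ m)"
    by (intro of_nat_mono binomial_le_pow2)
  then have 3: "real (m choose j) \<le> 2 ^ m" by simp
  have "meixner_coeff \<alpha> n m j = (real (n choose j) * real (m choose j)) * (fact j / pochhammer (1 + \<alpha>) j)"
    by (simp add: meixner_coeff_def)
  also have "\<dots> \<le> ((real n + 1) ^ m * 2 ^ m) * 1"
    using pochhammer_pos_nonneg[OF assms(1), of j] 1 2 3 by (intro mult_mono) auto
  finally show ?thesis by simp
qed

text \<open>Every exponent n+m-2j is at least n-m, and |t| / sqrt(1+t^2) is increasing in |t|, hence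
  geometric decay in n uniformly for |t| \<le> \<tau>. With m fixed the coefficients and weights
  grow only polynomially in n.\<close>

lemma laguerre_kernel_decay:
  assumes "\<alpha> \<ge> 0" "\<alpha> \<le> real K" "\<bar>t\<bar> \<le> \<tau>" "m \<le> n"
  shows "cmod (laguerre_kernel \<alpha> n m t) \<le>
    laguerre_weight \<alpha> m * (real m + 1) * 2 ^ m * (real n + 1) ^ (K + m) * (\<tau> / sqrt (1 + \<tau>\<^sup>2)) ^ (n - m)"
proof -
  define a where "a = sqrt (1 + t\<^sup>2)"
  define r where "r = \<tau> / sqrt (1 + \<tau>\<^sup>2)"
  have a1: "a \<ge> 1" by (simp add: a_def)
  have tau: "\<tau> \<ge> 0" using assms(3) by simp
  have "sqrt (\<tau>\<^sup>2) \<le> sqrt (1 + \<tau>\<^sup>2)" "sqrt (1 + \<tau>\<^sup>2) > 0"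
    by (rule real_sqrt_le_mono, simp) (simp add: add_pos_nonneg)
  then have r1: "0 \<le> r" "r \<le> 1"
    using tau unfolding r_def by (simp_all only: divide_le_eq_1_pos divide_nonneg_pos real_sqrt_abs abs_of_nonneg)
  have "\<bar>t\<bar> / a \<le> r"
  proof -
    have "t\<^sup>2 \<le> \<tau>\<^sup>2" using assms(3) by (metis abs_le_square_iff abs_of_nonneg tau)
    then have "t\<^sup>2 / (1 + t\<^sup>2) \<le> \<tau>\<^sup>2 / (1 + \<tau>\<^sup>2)"
      by (simp add: divide_simps add_pos_nonneg) (simp add: algebra_simps)
    then have "sqrt (t\<^sup>2 / (1 + t\<^sup>2)) \<le> sqrt (\<tau>\<^sup>2 / (1 + \<tau>\<^sup>2))" by (rule real_sqrt_le_mono)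
    then show ?thesis using tau by (simp add: real_sqrt_divide a_def r_def)
  qed
  have monom_le: "\<bar>t\<bar> ^ (n + m - 2 * j) / a ^ (n + m) \<le> r ^ (n - m)" if "j \<le> m" for j
  proof -
    define l where "l = n + m - 2 * j"
    have l: "l \<le> n + m" "n - m \<le> l" using that assms(4) by (auto simp: l_def)
    have "\<bar>t\<bar> ^ l / a ^ (n + m) \<le> \<bar>t\<bar> ^ l / a ^ l"
      using a1 l by (intro divide_left_mono power_increasing mult_pos_pos zero_less_power) auto
    also have "\<dots> = (\<bar>t\<bar> / a) ^ l" by (simp add: power_divide)
    also have "\<dots> \<le> r ^ l" using \<open>\<bar>t\<bar> / a \<le> r\<close> a1 by (intro power_mono) auto
    also have "\<dots> \<le> r ^ (n - m)" using r1 l by (intro power_decreasing) auto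
    finally show ?thesis by (simp add: l_def)
  qed
  have "cmod (meixner_poly \<alpha> n m (- (\<i> * t))) / a ^ (n + m) \<le>
      (\<Sum>j\<le>m. meixner_coeff \<alpha> n m j * \<bar>t\<bar> ^ (n + m - 2 * j)) / a ^ (n + m)"
  proof (rule divide_right_mono)
    show "cmod (meixner_poly \<alpha> n m (- (\<i> * t))) \<le> (\<Sum>j\<le>m. meixner_coeff \<alpha> n m j * \<bar>t\<bar> ^ (n + m - 2 * j))"
      unfolding meixner_poly_def using meixner_coeff_nonneg[OF assms(1), of n m]
      by (intro sum_norm_le) (simp add: norm_mult norm_power)
  qed (use a1 in simp)
  also have "\<dots> = (\<Sum>j\<le>m. meixner_coeff \<alpha> n m j * (\<bar>t\<bar> ^ (n + m - 2 * j) / a ^ (n + m)))"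
    by (simp add: sum_divide_distrib)
  also have "\<dots> \<le> (\<Sum>j\<le>m. ((real n + 1) ^ m * 2 ^ m) * r ^ (n - m))"
    using monom_le meixner_coeff_le[OF assms(1) _ assms(4)] meixner_coeff_nonneg[OF assms(1), of n m] a1
    by (intro sum_mono mult_mono) auto
  also have "\<dots> = (real m + 1) * 2 ^ m * (real n + 1) ^ m * r ^ (n - m)"
    by (simp add: algebra_simps)
  finally have S: "cmod (meixner_poly \<alpha> n m (- (\<i> * t))) / a ^ (n + m) \<le> (real m + 1) * 2 ^ m * (real n + 1) ^ m * r ^ (n - m)" .
  have "a powr (- (1 + \<alpha>)) \<le> a powr 0"
    by (rule powr_mono) (use a1 assms(1) in auto)
  then have p: "a powr (- (1 + \<alpha>)) \<le> 1" using a1 by simp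
  have "a powr (- (1 + \<alpha>)) * (cmod (meixner_poly \<alpha> n m (- (\<i> * t))) / a ^ (n + m)) \<le>
      1 * ((real m + 1) * 2 ^ m * (real n + 1) ^ m * r ^ (n - m))"
    using S p a1 by (intro mult_mono) auto
  then have "cmod (laguerre_kernel \<alpha> n m t) \<le> (laguerre_weight \<alpha> n * laguerre_weight \<alpha> m) *
      ((real m + 1) * 2 ^ m * (real n + 1) ^ m * r ^ (n - m))"
    unfolding norm_laguerre_kernel[OF assms(1)] a_def[symmetric]
    using laguerre_weight_pos[OF assms(1), of n] laguerre_weight_pos[OF assms(1), of m]
    by (intro mult_left_mono) auto
  also have "\<dots> \<le> ((real n + 1) ^ K * laguerre_weight \<alpha> m) * ((real m + 1) * 2 ^ m * (real n + 1) ^ m * r ^ (n - m))"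
    using laguerre_weight_le[OF assms(1,2), of n] laguerre_weight_pos[OF assms(1), of m] r1
    by (intro mult_right_mono) auto
  also have "\<dots> = laguerre_weight \<alpha> m * (real m + 1) * 2 ^ m * (real n + 1) ^ (K + m) * r ^ (n - m)"
    by (simp add: power_add mult_ac)
  finally show ?thesis unfolding r_def .
qed

lemma poly_times_geometric_tendsto_0:
  fixes r :: real
  assumes "0 < r" "r < 1"
  shows "(\<lambda>k. (real k + 2) ^ q * r ^ (k - m)) \<longlonglongrightarrow> 0"
proof -
  define c where "c = - ln r"
  have c: "c > 0" using assms by (simp add: c_def)
  have "filterlim (\<lambda>k. c * (real k + 2)) at_top sequentially"
    by (intro filterlim_tendsto_pos_mult_at_top[OF tendsto_const c]
          filterlim_at_top_add_at_top filterlim_real_sequentially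
          filterlim_tendsto_add_at_top[OF tendsto_const, of _ _ 2, simplified add.commute])
  then have "(\<lambda>k. (c * (real k + 2)) ^ q / exp (c * (real k + 2))) \<longlonglongrightarrow> 0"
    by (rule filterlim_compose[OF tendsto_power_div_exp_0])
  from tendsto_mult_left[OF this, of "1 / (c ^ q * r ^ (m + 2))"]
  have lim: "(\<lambda>k. 1 / (c ^ q * r ^ (m + 2)) * ((c * (real k + 2)) ^ q / exp (c * (real k + 2)))) \<longlonglongrightarrow> 0"
    by simp
  show ?thesis
  proof (rule Lim_transform_eventually[OF lim])
    show "\<forall>\<^sub>F k in sequentially. 1 / (c ^ q * r ^ (m + 2)) * ((c * (real k + 2)) ^ q / exp (c * (real k + 2))) =
        (real k + 2) ^ q * r ^ (k - m)"
      using eventually_ge_at_top[of m]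
    proof eventually_elim
      case (elim k)
      have "exp (c * (real k + 2)) = inverse (exp (real (k + 2) * ln r))"
        by (simp add: c_def exp_minus[symmetric] algebra_simps)
      also have "exp (real (k + 2) * ln r) = r ^ (k + 2)"
        using assms by (subst exp_of_nat_mult) simp
      finally have e: "1 / exp (c * (real k + 2)) = r ^ (k + 2)" by (simp add: field_simps)
      have "k + 2 = (k - m) + (m + 2)" using elim by simp
      then have "r ^ (k + 2) = r ^ (k - m) * r ^ (m + 2)" by (metis power_add)
      then have "(c * (real k + 2)) ^ q * (1 / exp (c * (real k + 2))) =
         (c ^ q * r ^ (m + 2)) * ((real k + 2) ^ q * r ^ (k - m))"
        unfolding e by (simp only: power_mult_distrib mult_ac)
      moreover have "c ^ q * r ^ (m + 2) \<noteq> 0" using c assms by simp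
      ultimately show ?case
        by (simp only: times_divide_eq_right mult_1_right times_divide_eq_left mult_1_left
            nonzero_mult_div_cancel_left not_False_eq_True)
    qed
  qed
qed

lemma laguerre_kernel_0: 
  assumes "\<alpha> \<ge> 0"
  shows "laguerre_kernel \<alpha> n m 0 = unit_seq m n"
proof (cases "n = m")
  case True
  define p where "p = pochhammer (1 + \<alpha>) m"
  have p: "p > 0" unfolding p_def by (rule pochhammer_pos_nonneg[OF assms])
  have "meixner_poly \<alpha> m m 0 = (\<Sum>j\<in>{m}. of_real (meixner_coeff \<alpha> m m j) * 0 ^ (m + m - 2 * j))"
    unfolding meixner_poly_def by (rule sum.mono_neutral_right) auto
  also have "\<dots> = of_real (fact m / p)"
    by (simp add: meixner_coeff_def p_def)
  finally have "meixner_poly \<alpha> m m 0 = of_real (fact m / p)" .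
  moreover have "laguerre_weight \<alpha> m * laguerre_weight \<alpha> m = p / fact m"
    using p by (simp add: laguerre_weight_def p_def)
  ultimately have "laguerre_kernel \<alpha> m m 0 = of_real (p / fact m) * of_real (fact m / p)"
    by (simp add: laguerre_kernel_def)
  also have "\<dots> = 1" using p by simp
  finally show ?thesis by (simp add: True unit_seq_def)
next
  case False
  have "meixner_poly \<alpha> n m 0 = 0"
    unfolding meixner_poly_def
  proof (intro sum.neutral ballI)
    fix j assume j: "j \<in> {..m}"
    show "of_real (meixner_coeff \<alpha> n m j) * 0 ^ (n + m - 2 * j) = (0 :: complex)"
    proof (cases "j \<le> n")
      case True
      then have "n + m - 2 * j > 0" using j False by auto
      then show ?thesis by simp
    qed (simp add: meixner_coeff_eq_0)
  qed
  then show ?thesis using False by (simp add: laguerre_kernel_def unit_seq_def)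
qed

lemma continuous_on_laguerre_kernel: "continuous_on A (\<lambda>t. laguerre_kernel \<alpha> n m t)"
proof -
  have "1 + \<i> * complex_of_real t \<noteq> 0" for t
  proof
    assume "1 + \<i> * complex_of_real t = 0"
    then have "Re (1 + \<i> * complex_of_real t) = 0" by (simp only: zero_complex.sel)
    then show False by simp
  qed
  then show ?thesis
    unfolding laguerre_kernel_def meixner_poly_def
    by (intro continuous_intros continuous_on_powr_complex) auto
qed

text \<open>Discrete Green formula for a real symmetric tridiagonal matrix. The pairing is bilinear,
  without conjugation. For J = 0 the truncated index J-1 is harmless because the coefficient
  vanishes.\<close>

lemma laguerre_op_green:
  "(\<Sum>j<J. laguerre_op \<alpha> x j * y j - x j * laguerre_op \<alpha> y j) =
     of_real (sqrt (real J * (real J + \<alpha>))) * (x J * y (J - 1) - x (J - 1) * y J)"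
proof (induction J)
  case (Suc J)
  define a where "a = complex_of_real (sqrt (real J * (real J + \<alpha>)))"
  have a0: "J = 0 \<Longrightarrow> a = 0" by (simp add: a_def)
  define b where "b = complex_of_real (sqrt (real (Suc J) * (real (Suc J) + \<alpha>)))"
  have op: "laguerre_op \<alpha> z J = a * z (J - 1) + of_real (2 * real J + 1 + \<alpha>) * z J + b * z (Suc J)" for z
    using a0 by (simp add: laguerre_op_def a_def b_def add_ac)
  show ?case
    unfolding sum.lessThan_Suc Suc.IH op a_def[symmetric] b_def[symmetric]
    by (simp add: algebra_simps)
qed simp

text \<open>
  For \<open>f j s = (U s e\<^sub>n) j\<close> and \<open>M j s = K j m s\<close> the sum \<open>\<Sum>j. M j (\<sigma> t) f j ((1 - \<sigma>) t)\<close> does not depend on \<open>\<sigma>\<close>: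
  by Green's formula its partial sums vary only through a boundary term, which tends to \<open>0\<close> because the
  kernel decays geometrically. The kernel equation is known for \<open>t \<noteq> 0\<close> only, which suffices for \<open>0 < \<sigma>\<close>.
\<close>

lemma unitary_group_eq_laguerre_kernel:
  assumes \<alpha>: "\<alpha> \<ge> 0" and U: "unitary_group_of (laguerre_dom \<alpha>) (laguerre_op \<alpha>) U"
  shows "U t (unit_seq n) m = laguerre_kernel \<alpha> n m t"
proof -
  have grp: "unitary_l2 (U t)" "U 0 (unit_seq n) = unit_seq n" for t
    using U unit_seq_lp_space_2[of n] unfolding unitary_group_of_def unitary_group_def by blast+
  show ?thesis
  proof (cases "t = 0")
    case True
    then show ?thesis using laguerre_kernel_0[OF \<alpha>, of n m] by (simp add: grp unit_seq_def)
  next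
    case False
    define f where "f j s = U s (unit_seq n) j" for j s
    define M where "M j s = laguerre_kernel \<alpha> j m s" for j s
    have f': "(f j has_vector_derivative - \<i> * laguerre_op \<alpha> (\<lambda>k. f k s) j) (at s)" for j s
      unfolding f_def[abs_def]
      by (rule unitary_group_of_has_derivative[OF U _ _ unit_seq_laguerre_dom]) (auto simp: laguerre_dom_def)
    have M': "(M j has_vector_derivative - \<i> * laguerre_op \<alpha> (\<lambda>k. M k s) j) (at s)" if "s \<noteq> 0" for j s
      unfolding M_def[abs_def] by (rule laguerre_kernel_has_derivative[OF \<alpha> that])
    have f_le: "cmod (f j s) \<le> 1" for j s
    proof -
      have "ennreal (cmod (f j s)) \<le> lp_norm 2 (U s (unit_seq n))"
        unfolding f_def by (rule norm_le_lp_norm_2)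
      also have "\<dots> = 1"
        using unitary_l2_isometry[OF grp(1) unit_seq_lp_space_2] lp_norm_2_unit_seq by simp
      finally show ?thesis by simp
    qed
    define B where "B k \<sigma> = (\<Sum>j<Suc k. M j (\<sigma> * t) * f j ((1 - \<sigma>) * t))" for k \<sigma>
    define C where "C k s = complex_of_real (sqrt (real (Suc k) * (real (Suc k) + \<alpha>))) *
       (M (Suc k) (s * t) * f k ((1 - s) * t) - M k (s * t) * f (Suc k) ((1 - s) * t))" for k s
    have B': "(B k has_vector_derivative - \<i> * of_real t * C k \<sigma>) (at \<sigma>)" if "0 < \<sigma>" for k \<sigma>
    proof -
      define x where "x = (\<lambda>j. M j (\<sigma> * t))"
      define y where "y = (\<lambda>j. f j ((1 - \<sigma>) * t))"
      have st: "\<sigma> * t \<noteq> 0" using that False by simp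
      have "((\<lambda>\<sigma>. \<sigma> * t) has_vector_derivative t) (at \<sigma>)"
        by (auto intro!: derivative_eq_intros simp: has_real_derivative_iff_has_vector_derivative[symmetric])
      from vector_diff_chain_at[OF this M'[OF st]]
      have d1: "((\<lambda>\<sigma>. M j (\<sigma> * t)) has_vector_derivative t *\<^sub>R (- \<i> * laguerre_op \<alpha> x j)) (at \<sigma>)" for j
        by (simp add: o_def x_def)
      have "((\<lambda>\<sigma>. (1 - \<sigma>) * t) has_vector_derivative - t) (at \<sigma>)"
        by (auto intro!: derivative_eq_intros simp: has_real_derivative_iff_has_vector_derivative[symmetric])
      from vector_diff_chain_at[OF this f']
      have d2: "((\<lambda>\<sigma>. f j ((1 - \<sigma>) * t)) has_vector_derivative (- t) *\<^sub>R (- \<i> * laguerre_op \<alpha> y j)) (at \<sigma>)" for j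
        by (simp add: o_def y_def)
      have "(B k has_vector_derivative (\<Sum>j<Suc k. x j * ((- t) *\<^sub>R (- \<i> * laguerre_op \<alpha> y j)) +
          (t *\<^sub>R (- \<i> * laguerre_op \<alpha> x j)) * y j)) (at \<sigma>)"
        unfolding B_def[abs_def] x_def y_def
        by (intro has_vector_derivative_sum has_vector_derivative_mult d1[unfolded x_def] d2[unfolded y_def])
      also have "(\<Sum>j<Suc k. x j * ((- t) *\<^sub>R (- \<i> * laguerre_op \<alpha> y j)) + (t *\<^sub>R (- \<i> * laguerre_op \<alpha> x j)) * y j) =
         - \<i> * of_real t * (\<Sum>j<Suc k. laguerre_op \<alpha> x j * y j - x j * laguerre_op \<alpha> y j)"
        unfolding sum_distrib_left by (intro sum.cong refl) (simp add: scaleR_conv_of_real algebra_simps)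
      also have "(\<Sum>j<Suc k. laguerre_op \<alpha> x j * y j - x j * laguerre_op \<alpha> y j) = C k \<sigma>"
        unfolding laguerre_op_green by (simp add: C_def x_def y_def)
      finally show ?thesis .
    qed
    obtain K where K: "\<alpha> \<le> real K" using real_arch_simple by blast
    define \<tau> where "\<tau> = \<bar>t\<bar>"
    define r where "r = \<tau> / sqrt (1 + \<tau>\<^sup>2)"
    have tau: "\<tau> > 0" using False by (simp add: \<tau>_def)
    have "sqrt (\<tau>\<^sup>2) < sqrt (1 + \<tau>\<^sup>2)" "sqrt (1 + \<tau>\<^sup>2) > 0"
      by (rule real_sqrt_less_mono, simp) (simp add: add_pos_nonneg)
    then have r: "0 < r" "r < 1"
      using tau unfolding r_def by (simp_all only: divide_less_eq_1_pos divide_pos_pos real_sqrt_abs abs_of_pos)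
    define E where "E = laguerre_weight \<alpha> m * (real m + 1) * 2 ^ m"
    have E: "E > 0" using laguerre_weight_pos[OF \<alpha>, of m] by (simp add: E_def)
    \<comment> \<open>\<tau> comes from the factor t, (1+\<alpha>)(k+2) bounds the off-diagonal
      entry, 2 counts the boundary products, and the rest bounds the kernel entries k and k+1. The
      entries of the group are at most 1.\<close>
    define e where "e k = \<tau> * ((1 + \<alpha>) * 2 * E * ((real k + 2) ^ (K + m + 1) * r ^ (k - m)))" for k
    have C_le: "cmod (- \<i> * of_real t * C k \<sigma>) \<le> e k" if "m \<le> k" "0 < \<sigma>" "\<sigma> < 1" for k \<sigma>
    proof -
      define X where "X = E * (real k + 2) ^ (K + m) * r ^ (k - m)"
      have X0: "X \<ge> 0" using E r by (simp add: X_def)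
      have st: "\<bar>\<sigma> * t\<bar> \<le> \<tau>"
        using that mult_right_mono[of \<sigma> 1 "\<bar>t\<bar>"] by (simp add: \<tau>_def abs_mult)
      have M1: "cmod (M k (\<sigma> * t)) \<le> X"
      proof -
        have "cmod (M k (\<sigma> * t)) \<le> E * (real k + 1) ^ (K + m) * r ^ (k - m)"
          unfolding M_def E_def r_def by (rule laguerre_kernel_decay[OF \<alpha> K st that(1)])
        also have "\<dots> \<le> X"
          unfolding X_def using E r by (intro mult_right_mono mult_left_mono power_mono) auto
        finally show ?thesis .
      qed
      have M2: "cmod (M (Suc k) (\<sigma> * t)) \<le> X"
      proof -
        have "cmod (M (Suc k) (\<sigma> * t)) \<le> E * (real (Suc k) + 1) ^ (K + m) * r ^ (Suc k - m)"
          unfolding M_def E_def r_def by (rule laguerre_kernel_decay[OF \<alpha> K st]) (use that in simp)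
        also have "\<dots> \<le> E * (real k + 2) ^ (K + m) * r ^ (k - m)"
          using E r by (intro mult_mono power_decreasing) (auto simp: add_ac)
        finally show ?thesis by (simp add: X_def)
      qed
      have "sqrt (real (Suc k) * (real (Suc k) + \<alpha>)) \<le> sqrt ((real (Suc k) + \<alpha>)\<^sup>2)"
        using \<alpha> by (intro real_sqrt_le_mono) (simp add: power2_eq_square mult_right_mono)
      also have "\<dots> = real (Suc k) + \<alpha>" using \<alpha> by simp
      also have "\<dots> \<le> (1 + \<alpha>) * (real k + 2)" using \<alpha> by (simp add: algebra_simps)
      finally have a: "sqrt (real (Suc k) * (real (Suc k) + \<alpha>)) \<le> (1 + \<alpha>) * (real k + 2)" .
      have "cmod (M (Suc k) (\<sigma> * t) * f k ((1 - \<sigma>) * t) - M k (\<sigma> * t) * f (Suc k) ((1 - \<sigma>) * t)) \<le> X * 1 + X * 1"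
        by (rule order_trans[OF norm_triangle_ineq4])
           (unfold norm_mult, intro add_mono mult_mono M1 M2 f_le norm_ge_zero X0)
      then have "cmod (C k \<sigma>) \<le> ((1 + \<alpha>) * (real k + 2)) * (2 * X)"
        unfolding C_def norm_mult norm_of_real using \<alpha> a by (intro mult_mono) auto
      then have "cmod (- \<i> * of_real t * C k \<sigma>) \<le> \<tau> * (((1 + \<alpha>) * (real k + 2)) * (2 * X))"
        unfolding norm_mult by (simp add: \<tau>_def mult_left_mono)
      also have "\<dots> = e k" by (simp add: e_def X_def mult_ac)
      finally show ?thesis .
    qed
    have B_diff: "cmod (B k 1 - B k 0) \<le> e k" if "m \<le> k" for k
    proof -
      have contf: "continuous_on A (f j)" for A j
        using f' has_vector_derivative_continuous continuous_at_imp_continuous_on by blast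
      have contM: "continuous_on A (M j)" for A j
        unfolding M_def[abs_def] by (rule continuous_on_laguerre_kernel)
      have cont: "continuous_on {0..1} (B k)"
        unfolding B_def[abs_def]
        by (intro continuous_on_sum continuous_on_mult continuous_on_compose2[OF contM]
              continuous_on_compose2[OF contf] continuous_on_id continuous_on_const continuous_on_diff) auto
      have "\<exists>x\<in>{0<..<1}. norm (B k 1 - B k 0) \<le> norm ((\<lambda>h. h *\<^sub>R (- \<i> * of_real t * C k x)) (1 - 0))"
      proof (rule mvt_general[OF zero_less_one cont])
        fix x :: real assume "0 < x" "x < 1"
        then show "(B k has_derivative (\<lambda>h. h *\<^sub>R (- \<i> * of_real t * C k x))) (at x)"
          using B'[of x k] by (simp only: has_vector_derivative_def)
      qed
      then obtain x where x: "0 < x" "x < 1" "norm (B k 1 - B k 0) \<le> cmod (- \<i> * of_real t * C k x)"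
        by auto
      then show ?thesis using C_le[OF that x(1,2)] by simp
    qed
    \<comment> \<open>At \<sigma> = 1 the group column is the unit vector at n, at \<sigma> = 0 the
      kernel column is the one at m. Each leaves a single term once k reaches both indices.\<close>
    have B_ends: "B k 1 - B k 0 = laguerre_kernel \<alpha> n m t - U t (unit_seq n) m" if "k \<ge> m" "k \<ge> n" for k
    proof -
      have "B k 1 = (\<Sum>j\<in>{n}. M j t * f j 0)"
        unfolding B_def using that
        by (simp only: mult_1 diff_self mult_zero_left)
           (rule sum.mono_neutral_right, auto simp: f_def grp unit_seq_def)
      moreover have "B k 0 = (\<Sum>j\<in>{m}. M j 0 * f j t)"
        unfolding B_def using that
        by (simp only: mult_1 diff_zero mult_zero_left)
           (rule sum.mono_neutral_right, auto simp: M_def laguerre_kernel_0[OF \<alpha>] unit_seq_def)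
      ultimately show ?thesis
        by (simp add: M_def f_def grp laguerre_kernel_0[OF \<alpha>] unit_seq_def)
    qed
    have "e \<longlonglongrightarrow> \<tau> * ((1 + \<alpha>) * 2 * E * 0)"
      unfolding e_def[abs_def] by (intro tendsto_mult_left poly_times_geometric_tendsto_0 r)
    then have "cmod (laguerre_kernel \<alpha> n m t - U t (unit_seq n) m) \<le> \<tau> * ((1 + \<alpha>) * 2 * E * 0)"
    proof (rule tendsto_lowerbound)
      show "\<forall>\<^sub>F k in sequentially. cmod (laguerre_kernel \<alpha> n m t - U t (unit_seq n) m) \<le> e k"
        using eventually_ge_at_top[of "max m n"]
        by eventually_elim (use B_diff B_ends in \<open>metis max.bounded_iff\<close>)
    qed simp
    then show ?thesis by simp
  qed
qed

subsection \<open>The kernel bound\<close>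

lemma pochhammer_Suc_of_nat: "pochhammer (1 + real k) l * fact k = fact (k + l)"
proof (induction l)
  case (Suc l)
  have "pochhammer (1 + real k) (Suc l) * fact k = (pochhammer (1 + real k) l * fact k) * (1 + real k + real l)"
    by (simp add: pochhammer_Suc)
  also have "\<dots> = fact (k + Suc l)"
    unfolding Suc.IH by (simp add: algebra_simps)
  finally show ?case .
qed simp

text \<open>For a natural second parameter k, the quotient of the two Pochhammer symbols is (n+k)! /
  (n+k-j)!, that is, j! binom(n+k, j).\<close>

lemma jacobi_coeff_eq_meixner_coeff:
  assumes "j \<le> n"
  shows "jacobi_coeff n \<alpha> (real k) j = meixner_coeff \<alpha> n (n + k) j"
proof -
  have 1: "pochhammer (1 + real k) n = fact (n + k) / fact k"
    using pochhammer_Suc_of_nat[of k n] by (simp add: add.commute field_simps)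
  have 2: "pochhammer (1 + real k) (n - j) = fact (n + k - j) / fact k"
    using pochhammer_Suc_of_nat[of k "n - j"] assms by (simp add: field_simps)
  have 3: "real (n + k choose j) = fact (n + k) / (fact j * fact (n + k - j))"
    by (rule binomial_fact) (use assms in simp)
  show ?thesis
    unfolding jacobi_coeff_def meixner_coeff_def 1 2 3 by (simp add: field_simps)
qed

lemma jacobi_norm_eq_weights:
  assumes "\<alpha> \<ge> 0"
  shows "jacobi_norm n \<alpha> (real k) = (laguerre_weight \<alpha> n)\<^sup>2 * (laguerre_weight \<alpha> (n + k))\<^sup>2"
proof -
  have w: "(laguerre_weight \<alpha> i)\<^sup>2 = Gamma (real i + \<alpha> + 1) / (Gamma (\<alpha> + 1) * fact i)" for i
  proof -
    have "pochhammer (1 + \<alpha>) i = Gamma (real i + \<alpha> + 1) / Gamma (\<alpha> + 1)"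
      using assms by (subst pochhammer_Gamma) (auto simp: add_ac elim!: nonpos_Ints_cases)
    moreover have "pochhammer (1 + \<alpha>) i / fact i \<ge> 0"
      using pochhammer_pos_nonneg[OF assms, of i] by simp
    ultimately show ?thesis by (simp add: laguerre_weight_def)
  qed
  have "Gamma (real n + real k + 1) = fact (n + k)"
    using Gamma_fact[of "n + k", where 'a = real] by (simp add: add_ac)
  then show ?thesis
    unfolding w jacobi_norm_def by (simp add: power2_eq_square add_ac mult_ac)
qed

text \<open>With s = 1/(1+t^2) one has -1/t^2 = -s/(1-s), so (1-s)^n turns the Meixner sum into the
  basis s^j (1-s)^(n-j). The squared prefactor is s^\<alpha> s, whose last s cancels 1+t^2. Of the
  power (1-s)^(2n+k), 2n goes into the squared polynomial and k into the weight.\<close>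

lemma norm_laguerre_kernel_eq_jacobi_fun:
  assumes "\<alpha> \<ge> 0" "t \<noteq> 0"
  shows "(1 + t\<^sup>2) * (cmod (laguerre_kernel \<alpha> n (n + k) t))\<^sup>2 =
    jacobi_norm n \<alpha> (real k) * (jacobi_fun n \<alpha> (real k) (1 / (1 + t\<^sup>2)))\<^sup>2"
proof -
  define a where "a = 1 + t\<^sup>2"
  define N where "N = n + (n + k)"
  define P where "P = (\<Sum>j\<le>n. meixner_coeff \<alpha> n (n + k) j * (- 1 / t\<^sup>2) ^ j)"
  have a: "a > 1" using assms(2) by (simp add: a_def)
  have s: "1 - 1 / a = t\<^sup>2 / a" 
  proof -
    have "t\<^sup>2 = a - 1" by (simp add: a_def)
    then show ?thesis using a by (simp only:) (simp add: diff_divide_distrib)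
  qed
  have t2: "t\<^sup>2 > 0" using assms(2) by simp
  have "meixner_poly \<alpha> n (n + k) (- (\<i> * t)) = (- (\<i> * t)) ^ N * (\<Sum>j\<le>n. of_real (meixner_coeff \<alpha> n (n + k) j) * (1 / (- (\<i> * t))\<^sup>2) ^ j)"
    unfolding meixner_poly_sym[of \<alpha> n] N_def add.commute[of n "n + k"]
    by (subst meixner_poly_nonzero) (use assms(2) in \<open>auto simp: meixner_coeff_sym[of \<alpha> n]\<close>)
  also have "1 / (- (\<i> * complex_of_real t))\<^sup>2 = of_real (- 1 / t\<^sup>2)"
    by (simp add: power_mult_distrib)
  also have "(\<Sum>j\<le>n. of_real (meixner_coeff \<alpha> n (n + k) j) * of_real (- 1 / t\<^sup>2) ^ j) = complex_of_real P"
    by (simp add: P_def)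
  finally have S: "cmod (meixner_poly \<alpha> n (n + k) (- (\<i> * t))) = \<bar>t\<bar> ^ N * \<bar>P\<bar>"
    by (simp add: norm_mult norm_power)
  have Q: "poly (jacobi_poly n \<alpha> (real k)) (1 / a) = (t\<^sup>2 / a) ^ n * P"
    unfolding poly_jacobi_poly P_def sum_distrib_left s
  proof (intro sum.cong refl)
    fix j assume j: "j \<in> {..n}"
    then obtain i where i: "n = j + i" by (auto simp: le_iff_add)
    have eq: "(-1) ^ j * ((1 / a) ^ j * (t\<^sup>2 / a) ^ i) = (t\<^sup>2 / a) ^ (j + i) * (- 1 / t\<^sup>2) ^ j"
    proof -
      have p: "(-1) ^ j * (1 / a) ^ j = (t\<^sup>2 / a) ^ j * (- 1 / t\<^sup>2) ^ j"
      proof -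
        have "(t\<^sup>2 / a) * (- 1 / t\<^sup>2) = (-1) * (1 / a)" using t2 by simp
        then show ?thesis by (metis power_mult_distrib)
      qed
      show ?thesis
        by (simp only: power_add mult.assoc[symmetric] p) (simp only: mult_ac)
    qed
    have reorder: "x * c * y = z * (c * w)" if "x * y = z * w" for x y z w c :: real
      using that by (metis mult.commute mult.assoc)
    have "jacobi_coeff n \<alpha> (real k) j = meixner_coeff \<alpha> n (n + k) j"
      using j by (intro jacobi_coeff_eq_meixner_coeff) auto
    moreover have "n - j = i" by (simp add: i)
    ultimately show "(-1) ^ j * jacobi_coeff n \<alpha> (real k) j * ((1 / a) ^ j * (t\<^sup>2 / a) ^ (n - j)) =
      (t\<^sup>2 / a) ^ n * (meixner_coeff \<alpha> n (n + k) j * (- 1 / t\<^sup>2) ^ j)"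
      using reorder[OF eq] by (simp only: i)
  qed
  have w: "(x powr (c / 2))\<^sup>2 = x powr c" if "x > 0" for x c :: real
    using that by (simp add: power2_eq_square flip: powr_add)
  have fn: "(jacobi_fun n \<alpha> (real k) (1 / a))\<^sup>2 = a powr (- \<alpha>) * (t\<^sup>2 / a) ^ N * P\<^sup>2"
  proof -
    have "(jacobi_fun n \<alpha> (real k) (1 / a))\<^sup>2 = (1 / a) powr \<alpha> * (t\<^sup>2 / a) powr (real k) * ((t\<^sup>2 / a) ^ n * P)\<^sup>2"
      unfolding jacobi_fun_def Q power_mult_distrib s
      using a t2 by (simp only: w divide_pos_pos zero_less_one less_trans[OF zero_less_one a])
    also have "(t\<^sup>2 / a) powr (real k) = (t\<^sup>2 / a) ^ k"
      using a t2 by (intro powr_realpow) simp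
    also have "(1 / a) powr \<alpha> = a powr (- \<alpha>)"
      using a by (simp add: powr_divide powr_minus_divide)
    also have "a powr (- \<alpha>) * (t\<^sup>2 / a) ^ k * ((t\<^sup>2 / a) ^ n * P)\<^sup>2 = a powr (- \<alpha>) * (t\<^sup>2 / a) ^ N * P\<^sup>2"
      unfolding N_def power_add power_mult_distrib power2_eq_square[of "(t\<^sup>2 / a) ^ n"] by (simp only: mult_ac)
    finally show ?thesis .
  qed
  have "(cmod (laguerre_kernel \<alpha> n (n + k) t))\<^sup>2 = ((laguerre_weight \<alpha> n)\<^sup>2 * (laguerre_weight \<alpha> (n + k))\<^sup>2) *
     ((sqrt a powr (- (1 + \<alpha>)))\<^sup>2 * ((\<bar>t\<bar> ^ N * \<bar>P\<bar>) / sqrt a ^ N)\<^sup>2)"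
    unfolding norm_laguerre_kernel[OF assms(1)] a_def[symmetric] S N_def[symmetric] by (simp only: power_mult_distrib)
  also have "(sqrt a powr (- (1 + \<alpha>)))\<^sup>2 = a powr (- (1 + \<alpha>))"
  proof -
    have "sqrt a powr (- (1 + \<alpha>)) = a powr ((- (1 + \<alpha>)) / 2)"
      using a by (simp add: powr_half_sqrt[symmetric] powr_powr)
    then show ?thesis using w[of a "- (1 + \<alpha>)"] a by simp
  qed
  also have "((\<bar>t\<bar> ^ N * \<bar>P\<bar>) / sqrt a ^ N)\<^sup>2 = (t\<^sup>2 / a) ^ N * P\<^sup>2"
  proof -
    have "((\<bar>t\<bar> ^ N * \<bar>P\<bar>) / sqrt a ^ N)\<^sup>2 = ((\<bar>t\<bar> / sqrt a)\<^sup>2) ^ N * P\<^sup>2"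
    proof -
      have "(x ^ N)\<^sup>2 = (x\<^sup>2) ^ N" for x :: real by (metis mult.commute power_mult)
      then have "((\<bar>t\<bar> / sqrt a) ^ N * \<bar>P\<bar>)\<^sup>2 = ((\<bar>t\<bar> / sqrt a)\<^sup>2) ^ N * P\<^sup>2"
        by (simp only: power_mult_distrib power2_abs)
      then show ?thesis by (simp add: power_divide)
    qed
    also have "(\<bar>t\<bar> / sqrt a)\<^sup>2 = t\<^sup>2 / a" using a by (simp add: power_divide)
    finally show ?thesis .
  qed
  also have "a powr (- (1 + \<alpha>)) = a powr (- \<alpha>) / a"
  proof -
    have "- (1 + \<alpha>) = - \<alpha> - 1" by simp
    then have "a powr (- (1 + \<alpha>)) = a powr (- \<alpha>) / a powr 1" by (simp only: powr_diff)
    then show ?thesis using a by simp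
  qed
  finally have "a * (cmod (laguerre_kernel \<alpha> n (n + k) t))\<^sup>2 =
     ((laguerre_weight \<alpha> n)\<^sup>2 * (laguerre_weight \<alpha> (n + k))\<^sup>2) * (a powr (- \<alpha>) * (t\<^sup>2 / a) ^ N * P\<^sup>2)"
    using a by simp
  then show ?thesis
    unfolding jacobi_norm_eq_weights[OF assms(1)] a_def[symmetric] fn .
qed

theorem laguerre_kernel_le:
  assumes "\<alpha> \<ge> 0"
  shows "cmod (laguerre_kernel \<alpha> n m t) \<le> 1 / sqrt (1 + t\<^sup>2)"
proof (cases "t = 0")
  case True
  then show ?thesis using laguerre_kernel_0[OF assms, of n m] by (simp add: unit_seq_def)
next
  case False
  have le: "cmod (laguerre_kernel \<alpha> n (n + k) t) \<le> 1 / sqrt (1 + t\<^sup>2)" for n k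
  proof -
    have "(1 + t\<^sup>2) * (cmod (laguerre_kernel \<alpha> n (n + k) t))\<^sup>2 \<le> 1"
      unfolding norm_laguerre_kernel_eq_jacobi_fun[OF assms False]
      by (rule jacobi_fun_le) (use assms False in \<open>auto simp: add_pos_nonneg divide_less_eq\<close>)
    moreover have "1 + t\<^sup>2 > 0" by (simp add: add_pos_nonneg)
    ultimately have "(cmod (laguerre_kernel \<alpha> n (n + k) t))\<^sup>2 \<le> 1 / (1 + t\<^sup>2)"
      by (simp add: field_simps)
    then have "cmod (laguerre_kernel \<alpha> n (n + k) t) \<le> sqrt (1 / (1 + t\<^sup>2))"
      by (rule real_le_rsqrt)
    then show ?thesis by (simp add: real_sqrt_divide)
  qed
  show ?thesis
  proof (cases "n \<le> m")
    case True
    then show ?thesis using le[of n "m - n"] by simp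
  next
    case False
    then show ?thesis using le[of m "n - m"] by (simp add: laguerre_kernel_sym[of \<alpha> n m])
  qed
qed

lemma laguerre_kernel_0_0: "\<alpha> = 0 \<Longrightarrow> cmod (laguerre_kernel \<alpha> 0 0 t) = 1 / sqrt (1 + t\<^sup>2)"
  by (simp add: norm_laguerre_kernel laguerre_weight_def meixner_poly_def powr_minus_divide)

subsection \<open>Riesz--Thorin interpolation\<close>

text \<open>The factor exp(e (z^2-1)) has modulus at most exp(-e (Im z)^2) on the strip, so the
  maximum principle on a tall rectangle applies. Then e tends to 0.\<close>

lemma three_lines:
  fixes f :: "complex \<Rightarrow> complex"
  assumes hol: "f holomorphic_on UNIV"
    and bdd: "\<And>z. 0 \<le> Re z \<Longrightarrow> Re z \<le> 1 \<Longrightarrow> cmod (f z) \<le> B"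
    and edge: "\<And>z. Re z = 0 \<or> Re z = 1 \<Longrightarrow> cmod (f z) \<le> 1"
    and z: "0 \<le> Re z" "Re z \<le> 1"
  shows "cmod (f z) \<le> 1"
proof -
  have B0: "B \<ge> 0" using order_trans[OF norm_ge_zero bdd[of 0]] by simp
  have eps: "cmod (f z) * exp (e * Re (z\<^sup>2 - 1)) \<le> 1" if e: "e > 0" for e :: real
  proof -
    define g where "g w = f w * exp (of_real e * (w\<^sup>2 - 1))" for w
    have ng: "cmod (g w) = cmod (f w) * exp (e * Re (w\<^sup>2 - 1))" for w
      by (simp add: g_def norm_mult)
    have re: "Re (w\<^sup>2 - 1) \<le> - (Im w)\<^sup>2" if "0 \<le> Re w" "Re w \<le> 1" for w
      using power_le_one[OF that, of 2] by (simp add: power2_eq_square)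
    \<comment> \<open>The height is chosen so that z lies in the rectangle and B \<le> e R \<le> e
      R^2 \<le> exp(e R^2), which makes the horizontal sides harmless.\<close>
    define R where "R = \<bar>Im z\<bar> + B / e + 1"
    have R: "R \<ge> 1" "R \<ge> \<bar>Im z\<bar>" "R \<ge> B / e" using B0 e by (auto simp: R_def)
    define S where "S = cbox (Complex 0 (- R)) (Complex 1 R)"
    have inS: "w \<in> S \<longleftrightarrow> 0 \<le> Re w \<and> Re w \<le> 1 \<and> - R \<le> Im w \<and> Im w \<le> R" for w
      by (auto simp: S_def in_cbox_complex_iff)
    have holg: "g holomorphic_on T" for T
      unfolding g_def[abs_def] by (intro holomorphic_intros holomorphic_on_subset[OF hol]) auto
    have "cmod (g z) \<le> 1"
    proof (rule maximum_modulus_frontier[of g S])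
      show "g holomorphic_on interior S" by (rule holg)
      show "continuous_on (closure S) g" by (intro holomorphic_on_imp_continuous_on holg)
      show "bounded S" by (simp add: S_def)
      show "z \<in> S" using z R by (auto simp: inS)
      fix w assume "w \<in> frontier S"
      then have "w \<in> S" and nb: "w \<notin> box (Complex 0 (- R)) (Complex 1 R)"
        by (auto simp: S_def frontier_cbox)
      then have w: "0 \<le> Re w" "Re w \<le> 1" "- R \<le> Im w" "Im w \<le> R" by (auto simp: inS)
      have "Re w = 0 \<or> Re w = 1 \<or> \<bar>Im w\<bar> = R"
        using nb w by (auto simp: in_box_complex_iff)
      then consider "Re w = 0 \<or> Re w = 1" | "\<bar>Im w\<bar> = R" by blast
      then show "cmod (g w) \<le> 1"
      proof cases
        case 1
        have "e * Re (w\<^sup>2 - 1) \<le> e * 0"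
          using re[OF w(1,2)] e by (intro mult_left_mono order_trans[OF re[OF w(1,2)]]) auto
        then have "cmod (f w) * exp (e * Re (w\<^sup>2 - 1)) \<le> 1 * 1"
          by (intro mult_mono edge 1) auto
        then show ?thesis by (simp add: ng)
      next
        case 2
        have "B \<le> e * R" using R(3) e by (simp add: field_simps)
        also have "\<dots> \<le> e * R\<^sup>2"
          using R(1) e by (intro mult_left_mono) (auto simp: power2_eq_square)
        also have "\<dots> \<le> exp (e * R\<^sup>2)"
          by (rule order_trans[OF _ exp_ge_add_one_self]) simp
        finally have BR: "B \<le> exp (e * R\<^sup>2)" .
        have "(Im w)\<^sup>2 = R\<^sup>2" using 2 by (metis power2_abs)
        then have "e * Re (w\<^sup>2 - 1) \<le> e * (- R\<^sup>2)"
          using re[OF w(1,2)] e by (intro mult_left_mono) auto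
        then have "cmod (f w) * exp (e * Re (w\<^sup>2 - 1)) \<le> exp (e * R\<^sup>2) * exp (e * (- R\<^sup>2))"
          using BR bdd[OF w(1,2)] by (intro mult_mono) auto
        also have "\<dots> = 1" by (simp flip: exp_add)
        finally show ?thesis by (simp add: ng)
      qed
    qed
    then show ?thesis by (simp add: ng)
  qed
  have "((\<lambda>e. cmod (f z) * exp (e * Re (z\<^sup>2 - 1))) \<longlongrightarrow> cmod (f z) * exp (0 * Re (z\<^sup>2 - 1))) (at_right 0)"
    by (intro tendsto_mult tendsto_const tendsto_exp tendsto_ident_at)
  then have "cmod (f z) * exp (0 * Re (z\<^sup>2 - 1)) \<le> 1"
    by (rule tendsto_upperbound) (use eventually_at_right_less[of 0] eps in \<open>auto elim: eventually_mono\<close>)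
  then show ?thesis by simp
qed

text \<open>
  \<open>interp p c z\<close> is \<open>sgn c \<cdot> |c|\<^bsup>p (1 - z/2)\<^esup>\<close>: an \<open>\<ell>\<^sup>p\<close> unit vector is moved to \<open>\<ell>\<^sup>1\<close> on \<open>Re z = 0\<close> and
  to \<open>\<ell>\<^sup>2\<close> on \<open>Re z = 1\<close>, and is left unchanged at \<open>z = 2 - 2/p\<close>.
\<close>

definition interp :: "real \<Rightarrow> complex \<Rightarrow> complex \<Rightarrow> complex" where
  "interp p c z = (if c = 0 then 0 else sgn c * exp (of_real p * (1 - z / 2) * of_real (ln (cmod c))))"

lemma norm_interp: "cmod (interp p c z) = cmod c powr (p * (1 - Re z / 2))"
  by (simp add: interp_def norm_mult norm_sgn powr_def)

lemma interp_eq: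
  assumes "p \<ge> 1"
  shows "interp p c (of_real (2 - 2 / p)) = c"
proof (cases "c = 0")
  case False
  have "complex_of_real p * (1 - of_real (2 - 2 / p) / 2) = of_real (p * (1 - (2 - 2 / p) / 2))"
    by simp
  also have "p * (1 - (2 - 2 / p) / 2) = 1" using assms by (simp add: field_simps)
  finally have "interp p c (of_real (2 - 2 / p)) = sgn c * exp (of_real (ln (cmod c)))"
    using False by (simp add: interp_def)
  also have "exp (complex_of_real (ln (cmod c))) = of_real (cmod c)"
    using False by (simp add: exp_of_real)
  finally show ?thesis using False by (simp add: sgn_eq)
qed (simp add: interp_def)

lemma holomorphic_interp: "interp p c holomorphic_on S"
proof (cases "c = 0")
  case True
  then show ?thesis by (simp add: interp_def[abs_def])
next
  case False
  then show ?thesis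
    unfolding interp_def[abs_def] by (simp, intro holomorphic_intros) auto
qed

text \<open>Finite sections make the interpolating function a finite sum of exponentials: entire and
  bounded on the strip. Both vectors carry the same exponent p because testing against
  \<open>\<ell>\<^sup>p\<close> gives the dual norm of the output.\<close>

lemma riesz_thorin_bilinear:
  fixes a :: "nat \<Rightarrow> nat \<Rightarrow> complex" and u v :: "nat \<Rightarrow> complex"
  assumes s: "s > 0" and a_le: "\<And>n m. cmod (a n m) \<le> s"
    and a2: "\<And>u v. cmod (\<Sum>n<L. \<Sum>m<L. v n * a n m * u m) \<le> sqrt (\<Sum>n<L. (cmod (v n))\<^sup>2) * sqrt (\<Sum>m<L. (cmod (u m))\<^sup>2)"
    and p: "1 \<le> p" "p \<le> 2"
    and u: "(\<Sum>m<L. cmod (u m) powr p) \<le> 1" and v: "(\<Sum>n<L. cmod (v n) powr p) \<le> 1"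
  shows "cmod (\<Sum>n<L. \<Sum>m<L. v n * a n m * u m) \<le> s powr (2 / p - 1)"
proof -
  define Q where "Q z = (\<Sum>n<L. \<Sum>m<L. interp p (v n) z * a n m * interp p (u m) z)" for z
  \<comment> \<open>The factor s^(z-1) normalises both edges to 1: the \<open>\<ell>\<^sup>1\<close>
    bound is s at Re z = 0, the \<open>\<ell>\<^sup>2\<close> bound is 1 at Re z = 1.\<close>
  define F where "F z = exp ((z - 1) * of_real (ln s)) * Q z" for z
  have nF: "cmod (F z) = s powr (Re z - 1) * cmod (Q z)" for z
    using s by (simp add: F_def norm_mult powr_def)
  have hol: "F holomorphic_on UNIV"
    unfolding F_def[abs_def] Q_def by (intro holomorphic_intros holomorphic_interp)
  have le1: "cmod (w k) \<le> 1" if "(\<Sum>m<L. cmod (w m) powr p) \<le> 1" "k < L" for w :: "nat \<Rightarrow> complex" and k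
  proof (rule ccontr)
    assume "\<not> cmod (w k) \<le> 1"
    then have "1 < cmod (w k) powr p"
      using p by (intro gr_one_powr) auto
    also have "\<dots> = (\<Sum>m\<in>{k}. cmod (w m) powr p)" by simp
    also have "\<dots> \<le> (\<Sum>m<L. cmod (w m) powr p)"
      using that(2) by (intro sum_mono2) auto
    finally show False using that(1) by simp
  qed
  have interp_le: "cmod (interp p (w k) z) \<le> 1"
    if "(\<Sum>m<L. cmod (w m) powr p) \<le> 1" "k < L" "Re z \<le> 1" for w :: "nat \<Rightarrow> complex" and k z
    unfolding norm_interp using that p le1[OF that(1,2)] by (intro powr_le1) auto
  \<comment> \<open>A crude bound growing with L suffices, since \<open>three_lines\<close> does not
    retain it.\<close>
  have bdd: "cmod (F z) \<le> max 1 (1 / s) * (\<Sum>n<L. \<Sum>m<L. s)" if z: "0 \<le> Re z" "Re z \<le> 1" for z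
  proof -
    have "cmod (Q z) \<le> (\<Sum>n<L. \<Sum>m<L. s)"
      unfolding Q_def
    proof (intro sum_norm_le)
      fix n m assume "n \<in> {..<L}" "m \<in> {..<L}"
      then have "cmod (interp p (v n) z) * cmod (a n m) * cmod (interp p (u m) z) \<le> 1 * s * 1"
        using interp_le[OF v] interp_le[OF u] z a_le[of n m] s by (intro mult_mono) auto
      then show "cmod (interp p (v n) z * a n m * interp p (u m) z) \<le> s"
        by (simp add: norm_mult)
    qed
    moreover have "s powr (Re z - 1) \<le> max 1 (1 / s)"
    proof (cases "s \<ge> 1")
      case True
      then have "s powr (Re z - 1) \<le> s powr 0" using z by (intro powr_mono) auto
      then show ?thesis using s by simp
    next
      case False
      then have "s powr (Re z - 1) \<le> s powr (- 1)" using z s by (intro powr_mono') auto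
      then show ?thesis using s by (simp add: powr_minus_divide)
    qed
    ultimately show ?thesis unfolding nF using s by (intro mult_mono) auto
  qed
  have edge: "cmod (F z) \<le> 1" if "Re z = 0 \<or> Re z = 1" for z
  proof (cases "Re z = 0")
    case True
    have "cmod (Q z) \<le> (\<Sum>n<L. \<Sum>m<L. s * (cmod (v n) powr p * cmod (u m) powr p))"
      unfolding Q_def
    proof (intro sum_norm_le)
      fix n m :: nat
      have "cmod (v n) powr p * cmod (a n m) * cmod (u m) powr p \<le> cmod (v n) powr p * s * cmod (u m) powr p"
        using a_le[of n m] by (intro mult_right_mono mult_left_mono) auto
      then show "cmod (interp p (v n) z * a n m * interp p (u m) z) \<le> s * (cmod (v n) powr p * cmod (u m) powr p)"
        using True by (simp add: norm_mult norm_interp mult_ac)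
    qed
    also have "\<dots> = s * ((\<Sum>n<L. cmod (v n) powr p) * (\<Sum>m<L. cmod (u m) powr p))"
      unfolding sum_product by (simp only: sum_distrib_left)
    also have "\<dots> \<le> s * (1 * 1)"
      using u v s by (intro mult_left_mono mult_mono) (auto intro: sum_nonneg)
    finally have "s powr (Re z - 1) * cmod (Q z) \<le> s powr (Re z - 1) * s"
      using s by (intro mult_left_mono) auto
    also have "\<dots> = 1" using True s by (simp add: powr_minus_divide)
    finally show ?thesis by (simp add: nF)
  next
    case False
    then have re: "Re z = 1" using that by simp
    have sq: "(\<Sum>m<L. (cmod (interp p (w m) z))\<^sup>2) = (\<Sum>m<L. cmod (w m) powr p)" for w :: "nat \<Rightarrow> complex"
    proof (intro sum.cong refl)
      fix m :: nat
      have "(cmod (interp p (w m) z))\<^sup>2 = cmod (w m) powr (p * (1 / 2) + p * (1 / 2))"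
        unfolding norm_interp powr_add power2_eq_square re by simp
      then show "(cmod (interp p (w m) z))\<^sup>2 = cmod (w m) powr p" by simp
    qed
    have "cmod (Q z) \<le> sqrt (\<Sum>n<L. (cmod (interp p (v n) z))\<^sup>2) * sqrt (\<Sum>m<L. (cmod (interp p (u m) z))\<^sup>2)"
      unfolding Q_def by (rule a2)
    also have "\<dots> \<le> 1 * 1"
      unfolding sq using u v by (intro mult_mono) (auto intro: sum_nonneg)
    finally show ?thesis using s by (simp add: nF re)
  qed
  define z where "z = complex_of_real (2 - 2 / p)"
  have "cmod (F z) \<le> 1"
    by (rule three_lines[OF hol bdd edge]) (use p in \<open>auto simp: z_def field_simps\<close>)
  moreover have "Q z = (\<Sum>n<L. \<Sum>m<L. v n * a n m * u m)"
    unfolding Q_def z_def interp_eq[OF p(1)] ..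
  moreover have "s powr (Re z - 1) = 1 / s powr (2 / p - 1)"
    using powr_minus_divide[of s "2 / p - 1"] by (simp add: z_def)
  ultimately show ?thesis
    using s by (simp add: nF field_simps)
qed

text \<open>Converse of Hoelder's inequality. The test vector conj(sgn w) |w|^(q-1) S^(-1/p) is the
  case of equality, with unit \<open>\<ell>\<^sup>p\<close> norm because p (q-1) = q.\<close>

lemma sum_powr_dual_le:
  fixes w :: "nat \<Rightarrow> complex"
  assumes p: "1 < p" and c: "c \<ge> 0"
    and dual: "\<And>v. (\<Sum>n<L. cmod (v n) powr p) \<le> 1 \<Longrightarrow> cmod (\<Sum>n<L. v n * w n) \<le> c"
  shows "(\<Sum>n<L. cmod (w n) powr (p / (p - 1))) \<le> c powr (p / (p - 1))"
proof -
  define q where "q = p / (p - 1)"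
  define S where "S = (\<Sum>n<L. cmod (w n) powr q)"
  have q: "q > 0" "p * (q - 1) = q" "1 - 1 / p = 1 / q"
    using p by (simp_all add: q_def field_simps)
  have S0: "S \<ge> 0" unfolding S_def by (rule sum_nonneg) simp
  show ?thesis
  proof (cases "S = 0")
    case False
    with S0 have S: "S > 0" by simp
    define v where "v n = cnj (sgn (w n)) * of_real (cmod (w n) powr (q - 1) * S powr (- (1 / p)))" for n
    have nv: "cmod (v n) = cmod (w n) powr (q - 1) * S powr (- (1 / p))" for n
      by (cases "w n = 0") (simp_all add: v_def norm_mult norm_sgn)
    have "cmod (v n) powr p = cmod (w n) powr q / S" for n
    proof -
      have "cmod (v n) powr p = cmod (w n) powr ((q - 1) * p) * S powr (- (1 / p) * p)"
        unfolding nv by (simp add: powr_mult powr_powr)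
      also have "(q - 1) * p = q" using q(2) by (simp add: mult.commute)
      also have "- (1 / p) * p = - 1" using p by simp
      finally show ?thesis using S by (simp add: powr_minus_divide)
    qed
    then have "(\<Sum>n<L. cmod (v n) powr p) = 1"
      using S by (simp add: S_def[symmetric] flip: sum_divide_distrib)
    then have le: "cmod (\<Sum>n<L. v n * w n) \<le> c" by (intro dual) simp
    have "v n * w n = of_real (cmod (w n) powr q * S powr (- (1 / p)))" for n
    proof (cases "w n = 0")
      case False
      have "cnj (sgn (w n)) * w n = of_real (cmod (w n))"
        using False by (simp add: sgn_eq complex_norm_square[symmetric] power2_eq_square field_simps
            mult.commute[of "cnj _"])
      then have "v n * w n = of_real (cmod (w n) * (cmod (w n) powr (q - 1) * S powr (- (1 / p))))"
        unfolding v_def by (simp add: mult_ac)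
      also have "cmod (w n) * (cmod (w n) powr (q - 1) * S powr (- (1 / p))) = cmod (w n) powr q * S powr (- (1 / p))"
        using False by (simp add: powr_diff)
      finally show ?thesis .
    qed (simp add: v_def)
    then have "(\<Sum>n<L. v n * w n) = of_real (S * S powr (- (1 / p)))"
      by (simp add: S_def sum_distrib_right)
    also have "S * S powr (- (1 / p)) = S powr (1 - 1 / p)"
      using S by (simp add: powr_diff powr_minus_divide)
    finally have "S powr (1 / q) \<le> c" using le by (simp add: q(3))
    then have "(S powr (1 / q)) powr q \<le> c powr q" using q by (intro powr_mono2) auto
    then have "S \<le> c powr q" using S q by (simp add: powr_powr)
    then show ?thesis by (simp add: S_def q_def)
  qed (simp add: S_def q_def)
qed

text \<open>By isometry the truncation error keeps the norm of the tail of u, which bounds every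
  coordinate. This recovers A u from the matrix entries.\<close>

lemma unitary_l2_truncation_tendsto:
  assumes A: "unitary_l2 A" and u: "u \<in> lp_space 2"
  shows "(\<lambda>L. \<Sum>m<L. u m * A (unit_seq m) n) \<longlonglongrightarrow> A u n"
proof -
  define g where "g L = (\<lambda>n. \<Sum>m<L. u m * unit_seq m n)" for L
  have g: "g L n = (if n < L then u n else 0)" for L n
  proof -
    have "g L n = (\<Sum>m<L. if m = n then u m else 0)"
      unfolding g_def by (intro sum.cong) (auto simp: unit_seq_def)
    then show ?thesis by simp
  qed
  have g2: "g L \<in> lp_space 2" for L
    unfolding g_def by (rule sum_unit_seq_lp_space_2[OF A])
  have Ag: "A (g L) n = (\<Sum>m<L. u m * A (unit_seq m) n)" for L
    unfolding g_def unitary_l2_sum[OF A] ..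
  define d where "d L = (\<lambda>n. 1 * u n + - 1 * g L n)" for L
  have d2: "d L \<in> lp_space 2" for L
    unfolding d_def using lp_space_2_add[OF lp_space_2_scale[OF u] lp_space_2_scale[OF g2]] .
  have "A (d L) = (\<lambda>n. 1 * A u n + - 1 * A (g L) n)" for L
    unfolding d_def by (rule unitary_l2_linear[OF A u g2])
  then have Ad: "A (d L) n = A u n - A (g L) n" for L by simp
  define f where "f n = (cmod (u n))\<^sup>2" for n
  have f: "summable f" using u by (simp add: f_def[abs_def] lp_space_2)
  have "(\<lambda>n. (cmod (d L n))\<^sup>2) sums (suminf f - sum f {..<L})" for L
  proof -
    have "(\<lambda>n. f n - (if n \<in> {..<L} then f n else 0)) sums (suminf f - sum f {..<L})"
      by (intro sums_diff summable_sums[OF f] sums_If_finite_set) simp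
    also have "(\<lambda>n. f n - (if n \<in> {..<L} then f n else 0)) = (\<lambda>n. (cmod (d L n))\<^sup>2)"
      by (rule ext) (simp add: d_def g f_def)
    finally show ?thesis .
  qed
  then have norm_d: "lp_norm 2 (d L) = ennreal (sqrt (suminf f - sum f {..<L}))" for L
    by (simp add: lp_norm_2 sums_iff)
  have "cmod (A u n - A (g L) n) \<le> sqrt (suminf f - sum f {..<L})" for L
  proof -
    have "ennreal (cmod (A (d L) n)) \<le> lp_norm 2 (A (d L))" by (rule norm_le_lp_norm_2)
    also have "\<dots> = ennreal (sqrt (suminf f - sum f {..<L}))"
      by (simp only: unitary_l2_isometry[OF A d2] norm_d)
    finally show ?thesis
      unfolding Ad using sum_le_suminf[OF f, of "{..<L}"]
      by (subst (asm) ennreal_le_iff) (auto simp: f_def)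
  qed
  moreover have "(\<lambda>L. sqrt (suminf f - sum f {..<L})) \<longlonglongrightarrow> sqrt (suminf f - suminf f)"
    by (intro tendsto_real_sqrt tendsto_diff tendsto_const summable_LIMSEQ f)
  ultimately have "(\<lambda>L. A (g L) n - A u n) \<longlonglongrightarrow> 0"
    by (intro Lim_null_comparison[of "\<lambda>L. A (g L) n - A u n" "\<lambda>L. sqrt (suminf f - sum f {..<L})"])
       (auto simp: norm_minus_commute)
  then show ?thesis
    unfolding Ag by (rule LIM_zero_cancel)
qed

text \<open>Cauchy-Schwarz, with isometry applied to the truncated u. Cutting the output to L
  coordinates only decreases its norm.\<close>

lemma unitary_l2_form_le:
  assumes A: "unitary_l2 A"
  shows "cmod (\<Sum>n<L. \<Sum>m<L. v n * A (unit_seq m) n * u m) \<le>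
    sqrt (\<Sum>n<L. (cmod (v n))\<^sup>2) * sqrt (\<Sum>m<L. (cmod (u m))\<^sup>2)"
proof -
  define g where "g = (\<lambda>n. \<Sum>m<L. u m * unit_seq m n)"
  have g: "g n = (if n < L then u n else 0)" for n
  proof -
    have "g n = (\<Sum>m<L. if m = n then u m else 0)"
      unfolding g_def by (intro sum.cong) (auto simp: unit_seq_def)
    then show ?thesis by simp
  qed
  have g2: "g \<in> lp_space 2" unfolding g_def by (rule sum_unit_seq_lp_space_2[OF A])
  have Ag2: "summable (\<lambda>n. (cmod (A g n))\<^sup>2)"
    using unitary_l2_closed[OF A g2] by (simp add: lp_space_2)
  have "(\<lambda>n. if n \<in> {..<L} then (cmod (u n))\<^sup>2 else 0) sums (\<Sum>n<L. (cmod (u n))\<^sup>2)"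
    by (rule sums_If_finite_set) simp
  also have "(\<lambda>n. if n \<in> {..<L} then (cmod (u n))\<^sup>2 else 0) = (\<lambda>n. (cmod (g n))\<^sup>2)"
    by (rule ext) (simp add: g)
  finally have "lp_norm 2 g = ennreal (sqrt (\<Sum>n<L. (cmod (u n))\<^sup>2))"
    by (simp add: lp_norm_2 sums_iff)
  moreover have "lp_norm 2 (A g) = ennreal (sqrt (\<Sum>n. (cmod (A g n))\<^sup>2))"
    using Ag2 by (simp add: lp_norm_2)
  ultimately have norm: "sqrt (\<Sum>n. (cmod (A g n))\<^sup>2) = sqrt (\<Sum>n<L. (cmod (u n))\<^sup>2)"
    using unitary_l2_isometry[OF A g2] suminf_nonneg[OF Ag2]
    by (simp add: ennreal_inj sum_nonneg)
  have "(\<Sum>n<L. \<Sum>m<L. v n * A (unit_seq m) n * u m) = (\<Sum>n<L. v n * A g n)"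
    unfolding g_def unitary_l2_sum[OF A] sum_distrib_left by (simp only: mult_ac)
  also have "cmod \<dots> \<le> (\<Sum>n<L. \<bar>cmod (v n)\<bar> * \<bar>cmod (A g n)\<bar>)"
    by (rule sum_norm_le) (simp add: norm_mult)
  also have "\<dots> \<le> L2_set (\<lambda>n. cmod (v n)) {..<L} * L2_set (\<lambda>n. cmod (A g n)) {..<L}"
    by (rule L2_set_mult_ineq)
  also have "\<dots> \<le> sqrt (\<Sum>n<L. (cmod (v n))\<^sup>2) * sqrt (\<Sum>n. (cmod (A g n))\<^sup>2)"
    unfolding L2_set_def
    by (intro mult_left_mono real_sqrt_le_mono sum_le_suminf[OF Ag2] real_sqrt_ge_zero sum_nonneg) auto
  also have "\<dots> = sqrt (\<Sum>n<L. (cmod (v n))\<^sup>2) * sqrt (\<Sum>m<L. (cmod (u m))\<^sup>2)"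
    by (simp only: norm)
  finally show ?thesis .
qed

section \<open>From finite sections to operators between sequence spaces\<close>

lemma lp_norm_ennreal:
  assumes "p > 0"
  shows "lp_norm (ennreal p) u = (if summable (\<lambda>n. cmod (u n) powr p) then ennreal ((\<Sum>n. cmod (u n) powr p) powr (1 / p)) else \<infinity>)"
  using assms by (simp add: lp_norm_def)

lemma lp_unit_ball:
  assumes p: "p > 0" and u: "lp_norm (ennreal p) u \<le> 1"
  shows "summable (\<lambda>n. cmod (u n) powr p)" "(\<Sum>n<L. cmod (u n) powr p) \<le> 1"
proof -
  show sm: "summable (\<lambda>n. cmod (u n) powr p)"
    using u p by (rule_tac ccontr) (simp add: lp_norm_ennreal top_unique)
  define S where "S = (\<Sum>n. cmod (u n) powr p)"
  have S0: "S \<ge> 0" unfolding S_def by (rule suminf_nonneg[OF sm]) simp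
  have "S powr (1 / p) \<le> 1"
    using u p sm by (simp add: lp_norm_ennreal S_def)
  then have "(S powr (1 / p)) powr p \<le> 1 powr p" using p by (intro powr_mono2) auto
  then have "S \<le> 1" using S0 p by (simp add: powr_powr)
  moreover have "(\<Sum>n<L. cmod (u n) powr p) \<le> S"
    unfolding S_def by (rule sum_le_suminf[OF sm]) auto
  ultimately show "(\<Sum>n<L. cmod (u n) powr p) \<le> 1" by simp
qed

text \<open>Entries of a vector in the unit ball have modulus at most 1, so raising the exponent
  from p to 2 decreases each term.\<close>

lemma lp_unit_ball_subset_lp_space_2:
  assumes p: "1 \<le> p" "p \<le> 2" and u: "lp_norm (ennreal p) u \<le> 1"
  shows "u \<in> lp_space 2"
  unfolding lp_space_2
proof (rule summable_comparison_test')
  show "summable (\<lambda>n. cmod (u n) powr p)" by (rule lp_unit_ball(1)[OF _ u]) (use p in simp)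
  fix n :: nat
  have "cmod (u n) powr p \<le> (\<Sum>k<Suc n. cmod (u k) powr p)"
    by (simp add: sum_nonneg)
  also have "\<dots> \<le> 1" by (rule lp_unit_ball(2)[OF _ u]) (use p in simp)
  finally have "cmod (u n) powr p \<le> 1" .
  moreover have "1 < cmod (u n) powr p" if "1 < cmod (u n)"
    using that p by (intro gr_one_powr) auto
  ultimately have le: "cmod (u n) \<le> 1" by fastforce
  have "(cmod (u n))\<^sup>2 = cmod (u n) powr 2" by (cases "u n = 0") auto
  also have "\<dots> \<le> cmod (u n) powr p" using p le by (intro powr_mono') auto
  finally show "norm ((cmod (u n))\<^sup>2) \<le> cmod (u n) powr p" by simp
qed

text \<open>Duality and interpolation bound each L x L section. For a fixed number K of output
  coordinates L goes to infinity, and then K does. For p = 1 the target norm is a supremum, and the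
  entry bound is used directly.\<close>

theorem lp_opnorm_interpolation:
  assumes A: "unitary_l2 A" and s: "s > 0" and le: "\<And>n m. cmod (A (unit_seq m) n) \<le> s"
    and p: "1 \<le> p" "p \<le> 2"
  shows "lp_opnorm (ennreal p) (conj_exponent p) A \<le> ennreal (s powr (2 / p - 1))"
  unfolding lp_opnorm_def
proof (rule SUP_least)
  fix u assume "u \<in> {u \<in> lp_space (ennreal p). lp_norm (ennreal p) u \<le> 1}"
  then have u: "lp_norm (ennreal p) u \<le> 1" by simp
  have u2: "u \<in> lp_space 2" by (rule lp_unit_ball_subset_lp_space_2[OF p u])
  have uL: "(\<Sum>m<L. cmod (u m) powr p) \<le> 1" for L
    by (rule lp_unit_ball(2)[OF _ u]) (use p in simp)
  define w where "w L n = (\<Sum>m<L. u m * A (unit_seq m) n)" for L n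
  have lim: "(\<lambda>L. w L n) \<longlonglongrightarrow> A u n" for n
    unfolding w_def by (rule unitary_l2_truncation_tendsto[OF A u2])
  show "lp_norm (conj_exponent p) (A u) \<le> ennreal (s powr (2 / p - 1))"
  proof (cases "p = 1")
    case True
    have "cmod (A u n) \<le> s" for n
    proof (rule tendsto_upperbound[OF tendsto_norm[OF lim]])
      have "cmod (w L n) \<le> s" for L
      proof -
        have "cmod (w L n) \<le> (\<Sum>m<L. cmod (u m) * s)"
          unfolding w_def by (rule sum_norm_le) (simp add: norm_mult mult_left_mono le)
        also have "\<dots> = (\<Sum>m<L. cmod (u m) powr p) * s" by (simp add: True sum_distrib_right)
        also have "\<dots> \<le> 1 * s" using uL[of L] s by (intro mult_right_mono) auto
        finally show ?thesis by simp
      qed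
      then show "\<forall>\<^sub>F L in sequentially. cmod (w L n) \<le> s" by simp
    qed simp
    then show ?thesis
      using s by (simp add: True conj_exponent_def lp_norm_def SUP_le_iff ennreal_leI)
  next
    case False
    then have p1: "1 < p" using p by simp
    define q where "q = p / (p - 1)"
    have q: "q > 0" using p1 by (simp add: q_def)
    define c where "c = s powr (2 / p - 1)"
    have c: "c > 0" using s by (simp add: c_def)
    have wq: "(\<Sum>n<L. cmod (w L n) powr q) \<le> c powr q" for L
      unfolding q_def
    proof (rule sum_powr_dual_le[OF p1])
      fix v :: "nat \<Rightarrow> complex" assume v: "(\<Sum>n<L. cmod (v n) powr p) \<le> 1"
      have "(\<Sum>n<L. v n * w L n) = (\<Sum>n<L. \<Sum>m<L. v n * A (unit_seq m) n * u m)"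
        unfolding w_def sum_distrib_left by (simp only: mult_ac)
      also have "cmod \<dots> \<le> c"
        unfolding c_def
        by (rule riesz_thorin_bilinear[OF s _ _ p uL v]) (rule le, rule unitary_l2_form_le[OF A])
      finally show "cmod (\<Sum>n<L. v n * w L n) \<le> c" .
    qed (use c in simp)
    have Auq: "(\<Sum>n<K. cmod (A u n) powr q) \<le> c powr q" for K
    proof (rule tendsto_upperbound)
      show "(\<lambda>L. \<Sum>n<K. cmod (w L n) powr q) \<longlonglongrightarrow> (\<Sum>n<K. cmod (A u n) powr q)"
        using q by (intro tendsto_sum tendsto_powr' tendsto_norm lim tendsto_const) auto
      show "\<forall>\<^sub>F L in sequentially. (\<Sum>n<K. cmod (w L n) powr q) \<le> c powr q"
        using eventually_ge_at_top[of K]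
      proof eventually_elim
        case (elim L)
        have "(\<Sum>n<K. cmod (w L n) powr q) \<le> (\<Sum>n<L. cmod (w L n) powr q)"
          using elim by (intro sum_mono2) auto
        also note wq
        finally show ?case .
      qed
    qed simp
    have sm: "summable (\<lambda>n. cmod (A u n) powr q)"
      by (rule summableI_nonneg_bounded[of _ "c powr q"]) (use Auq in auto)
    have "(\<Sum>n. cmod (A u n) powr q) \<le> c powr q"
      by (rule suminf_le_const[OF sm Auq])
    then have "(\<Sum>n. cmod (A u n) powr q) powr (1 / q) \<le> (c powr q) powr (1 / q)"
      using q by (intro powr_mono2 suminf_nonneg[OF sm]) auto
    also have "\<dots> = c" using q c by (simp add: powr_powr)
    finally show ?thesis
      using sm q by (simp add: conj_exponent_def False q_def[symmetric] lp_norm_ennreal c_def ennreal_leI)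
  qed
qed

subsection \<open>Dispersive estimates\<close>

theorem corollary11p3:
  fixes \<alpha> :: real and U :: "real \<Rightarrow> (nat \<Rightarrow> complex) \<Rightarrow> nat \<Rightarrow> complex"
  assumes "\<alpha> \<ge> 0"
    and "unitary_group_of (laguerre_dom \<alpha>) (laguerre_op \<alpha>) U"
  shows "(\<forall>t :: real. lp_opnorm 1 \<infinity> (U t) \<le> ennreal (1 / sqrt (1 + t\<^sup>2))) \<and>
    (\<alpha> = 0 \<longrightarrow> (\<forall>t :: real. lp_opnorm 1 \<infinity> (U t) = ennreal (1 / sqrt (1 + t\<^sup>2)))) \<and>
    (\<forall>(p :: real) (t :: real). 1 \<le> p \<and> p \<le> 2 \<longrightarrow>
       lp_opnorm (ennreal p) (conj_exponent p) (U t)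
         \<le> ennreal ((1 + t\<^sup>2) powr (- (1 / p - 1 / 2))))"
proof -
  have unitary: "unitary_l2 (U t)" for t
    using assms(2) unfolding unitary_group_of_def unitary_group_def by blast
  have le: "cmod (U t (unit_seq m) n) \<le> 1 / sqrt (1 + t\<^sup>2)" for t n m
    unfolding unitary_group_eq_laguerre_kernel[OF assms] by (rule laguerre_kernel_le[OF assms(1)])
  have bound: "lp_opnorm (ennreal p) (conj_exponent p) (U t) \<le> ennreal ((1 + t\<^sup>2) powr (- (1 / p - 1 / 2)))"
    if p: "1 \<le> p" "p \<le> 2" for p t
  proof -
    have pos: "1 + t\<^sup>2 > 0" by (simp add: add_pos_nonneg)
    then have "1 / sqrt (1 + t\<^sup>2) > 0" by simp
    from lp_opnorm_interpolation[OF unitary this le p]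
    have "lp_opnorm (ennreal p) (conj_exponent p) (U t) \<le> ennreal ((1 / sqrt (1 + t\<^sup>2)) powr (2 / p - 1))" .
    also have "1 / sqrt (1 + t\<^sup>2) = (1 + t\<^sup>2) powr (- (1 / 2))"
      using pos by (simp only: powr_minus_divide powr_half_sqrt less_imp_le)
    also have "((1 + t\<^sup>2) powr (- (1 / 2))) powr (2 / p - 1) = (1 + t\<^sup>2) powr (- (1 / 2) * (2 / p - 1))"
      by (rule powr_powr)
    also have "- (1 / 2) * (2 / p - 1) = - (1 / p - 1 / 2)"
      by (simp add: field_simps)
    finally show ?thesis .
  qed
  have one: "lp_opnorm 1 \<infinity> (U t) \<le> ennreal (1 / sqrt (1 + t\<^sup>2))" for t
  proof -
    have pos: "1 + t\<^sup>2 > 0" by (simp add: add_pos_nonneg)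
    have "lp_opnorm (ennreal 1) (conj_exponent 1) (U t) \<le> ennreal ((1 + t\<^sup>2) powr (- (1 / 1 - 1 / 2)))"
      by (rule bound) auto
    also have "(1 + t\<^sup>2) powr (- (1 / 1 - 1 / 2)) = (1 + t\<^sup>2) powr (- (1 / 2))" by simp
    also have "\<dots> = 1 / sqrt (1 + t\<^sup>2)"
      using pos by (simp only: powr_minus_divide powr_half_sqrt less_imp_le)
    finally show ?thesis by (simp add: conj_exponent_def)
  qed
  \<comment> \<open>The first unit vector is the test vector; its image has the entry 1/(1+it) at
    index 0.\<close>
  have "lp_opnorm 1 \<infinity> (U t) \<ge> ennreal (1 / sqrt (1 + t\<^sup>2))" if "\<alpha> = 0" for t
  proof -
    have "(\<lambda>n. cmod (unit_seq 0 n) powr 1) sums (\<Sum>n\<in>{0}. cmod (unit_seq 0 n) powr 1)"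
      by (rule sums_finite) (auto simp: unit_seq_def)
    then have "(\<lambda>n. cmod (unit_seq 0 n) powr 1) sums 1" by (simp add: unit_seq_def)
    then have norm1: "lp_norm (ennreal 1) (unit_seq 0) = 1"
      by (subst lp_norm_ennreal) (simp_all add: sums_iff)
    have "ennreal (1 / sqrt (1 + t\<^sup>2)) = ennreal (cmod (U t (unit_seq 0) 0))"
      unfolding unitary_group_eq_laguerre_kernel[OF assms] laguerre_kernel_0_0[OF that] ..
    also have "\<dots> \<le> lp_norm \<infinity> (U t (unit_seq 0))"
      unfolding lp_norm_def using SUP_upper[of 0 UNIV "\<lambda>n. ennreal (cmod (U t (unit_seq 0) n))"] by simp
    also have "\<dots> \<le> lp_opnorm 1 \<infinity> (U t)"
      unfolding lp_opnorm_def by (rule SUP_upper) (use norm1 in \<open>simp add: lp_space_def\<close>)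
    finally show ?thesis .
  qed
  with bound one show ?thesis
    by (auto intro!: antisym)
qed

end
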